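(* Let $(M,F,\mu)$ be an infinitesimal harmonic Finsler manifold. Then $(M,F,\mu)$ is an Einstein Finsler manifold with constant $S$-curvature and constant Ricci curvature.
   Context: Setting. $M$ is an $n$-dimensional ($n>1$) connected orientable smooth manifold with a Finsler structure $F:TM\to[0,\infty)$ ($C^\infty$ on $TM\setminus0$, positively $1$-homogeneous in $y$, $g_{ij}(x,y)=\frac12\frac{\partial^2F^2}{\partial y^i\partial y^j}$ positive definite for $y\neq0$) and an arbitrary volume measure $d\mu=\sigma_\mu(x)dx$, $\sigma_\mu>0$. $F$ is assumed forward complete ($\exp_x$ defined on all of $T_xM$ for every $x$). $I_xM=\{y\in T_xM:F(x,y)=1\}$, $IM=\bigcup_xI_xM$. Density. In polar coordinates $\exp_x(ry)$, $r>0$, $y\in I_xM$, around $x$, $d\mu=\overline\sigma_x(r,y)\,dr\wedge d\nu_x(y)$, where $d\nu_x$ is the Riemannian volume form of $I_xM$ for the metric $\dot g$ induced by $g_{ij}(x,y)dy^i\otimes dy^j$. Infinitesimal harmonic. $(M,F,\mu)$ is infinitesimal harmonic if for every $k\in\mathbb Z^+$ there is a constant $c_k\in\mathbb R$ (independent of the point and direction) such that the $k$-th radial derivative of the density at the origin satisfies $\frac{d^k}{dr^k}\overline\sigma_x(r,y)\big|_{r=0}=c_k$ for all $x\in M$ and $y\in I_xM$. Curvatures. Distortion: $\tau_\mu(x,y)=\log\big(\sqrt{\det g_{ij}(x,y)}/\sigma_\mu(x)\big)$. $S$-curvature: $S_\mu(x,y)=\frac{d}{dt}\tau_\mu(\eta(t),\dot\eta(t))|_{t=0}$,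 $\eta$ the geodesic with $\dot\eta(0)=y\in T_xM$. Constant $S$-curvature means $S_\mu(x,y)=c$ for all $(x,y)\in IM$, $c$ a constant. $\mathrm{Ric}$ is the Finsler Ricci curvature (trace of the Riemann curvature $R_y$); Einstein means $\mathrm{Ric}(x,y)$ for $y\in I_xM$ depends on $x$ only, and constant Ricci curvature means it is a constant on $IM$. *)

theory Defs
  imports "HOL-Analysis.Analysis"
begin

section \<open>Smooth maps between Euclidean spaces\<close>

text \<open>Meant for open \<open>S\<close>.\<close>

primrec Ck_on :: "nat \<Rightarrow> ('a::euclidean_space \<Rightarrow> 'b::euclidean_space) \<Rightarrow> 'a set \<Rightarrow> bool" where
  "Ck_on 0 f S \<longleftrightarrow> continuous_on S f"
| "Ck_on (Suc k) f S \<longleftrightarrow>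
     (\<forall>x\<in>S. f differentiable (at x)) \<and>
     (\<forall>v. Ck_on k (\<lambda>x. frechet_derivative f (at x) v) S)"

definition smooth_on :: "'a set \<Rightarrow> ('a::euclidean_space \<Rightarrow> 'b::euclidean_space) \<Rightarrow> bool" where
  "smooth_on S f \<longleftrightarrow> (\<forall>k. Ck_on k f S)"

text \<open>Partial derivatives of a function of the position \<open>x\<close> and the fibre coordinate \<open>\<xi>\<close>.\<close>

definition pdx :: "'n::finite \<Rightarrow> (real^'n \<Rightarrow> real^'n \<Rightarrow> real) \<Rightarrow> real^'n \<Rightarrow> real^'n \<Rightarrow> real" where
  "pdx k f x \<xi> = frechet_derivative (\<lambda>z. f z \<xi>) (at x) (axis k 1)"

definition pdy :: "'n::finite \<Rightarrow> (real^'n \<Rightarrow> real^'n \<Rightarrow> real) \<Rightarrow> real^'n \<Rightarrow> real^'n \<Rightarrow> real" where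
  "pdy k f x \<xi> = frechet_derivative (f x) (at \<xi>) (axis k 1)"


section \<open>Smooth manifolds\<close>

text \<open>The manifold \<open>M\<close> is the whole type \<open>'m\<close>; its dimension is \<open>CARD('n)\<close>. A chart is a pair of
  its domain and its coordinate map, the values of the latter outside the domain being irrelevant.\<close>

type_synonym ('m, 'n) chart = "'m set \<times> ('m \<Rightarrow> real^'n)"

abbreviation cdom :: "('m, 'n) chart \<Rightarrow> 'm set" where "cdom \<equiv> fst"
abbreviation cmap :: "('m, 'n) chart \<Rightarrow> 'm \<Rightarrow> real^'n" where "cmap \<equiv> snd"

definition cinv :: "('m, 'n) chart \<Rightarrow> real^'n \<Rightarrow> 'm" where
  "cinv c = inv_into (cdom c) (cmap c)"

definition is_chart :: "('m::topological_space, 'n::finite) chart \<Rightarrow> bool" where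
  "is_chart c \<longleftrightarrow> open (cdom c) \<and> open (cmap c ` cdom c) \<and>
     homeomorphism (cdom c) (cmap c ` cdom c) (cmap c) (cinv c)"

definition transition :: "('m, 'n) chart \<Rightarrow> ('m, 'n) chart \<Rightarrow> real^'n \<Rightarrow> real^'n" where
  "transition c d = cmap d \<circ> cinv c"

definition smoothly_compatible :: "('m, 'n::finite) chart \<Rightarrow> ('m, 'n) chart \<Rightarrow> bool" where
  "smoothly_compatible c d \<longleftrightarrow>
     smooth_on (cmap c ` (cdom c \<inter> cdom d)) (transition c d) \<and>
     smooth_on (cmap d ` (cdom c \<inter> cdom d)) (transition d c)"

definition smooth_atlas :: "('m::topological_space, 'n::finite) chart set \<Rightarrow> bool" where
  "smooth_atlas A \<longleftrightarrow> (\<forall>c\<in>A. is_chart c) \<and> (\<Union>c\<in>A. cdom c) = UNIV \<and>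
     (\<forall>c\<in>A. \<forall>d\<in>A. smoothly_compatible c d)"

definition orientable :: "('m::topological_space, 'n::finite) chart set \<Rightarrow> bool" where
  "orientable A \<longleftrightarrow> (\<exists>B. smooth_atlas B \<and> (\<forall>c\<in>A. \<forall>d\<in>B. smoothly_compatible c d) \<and>
     (\<forall>c\<in>B. \<forall>d\<in>B. \<forall>p\<in>cdom c \<inter> cdom d.
        det (matrix (frechet_derivative (transition c d) (at (cmap c p)))) > 0))"

definition charts_at :: "('m, 'n) chart set \<Rightarrow> 'm \<Rightarrow> ('m, 'n) chart set" where
  "charts_at A p = {c \<in> A. p \<in> cdom c}"

text \<open>Pointwise quantities whose coordinate expression does not depend on the chart are evaluated
  in an arbitrarily chosen chart.\<close>

definition chart_at :: "('m, 'n) chart set \<Rightarrow> 'm \<Rightarrow> ('m, 'n) chart" where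
  "chart_at A p = (SOME c. c \<in> charts_at A p)"


section \<open>Tangent vectors\<close>

text \<open>A tangent vector at \<open>p\<close> is the family of its coordinate vectors in all charts around \<open>p\<close>,
  related by the Jacobians of the transition maps (and set to \<open>0\<close> at the other charts, so that
  equality of tangent vectors is equality of functions).\<close>

type_synonym ('m, 'n) tvec = "('m, 'n) chart \<Rightarrow> real^'n"

definition tangent_space :: "('m, 'n::finite) chart set \<Rightarrow> 'm \<Rightarrow> ('m, 'n) tvec set" where
  "tangent_space A p = {v.
     (\<forall>c\<in>charts_at A p. \<forall>d\<in>charts_at A p.
        v d = frechet_derivative (transition c d) (at (cmap c p)) (v c)) \<and>
     (\<forall>c. c \<notin> charts_at A p \<longrightarrow> v c = 0)}"

definition tlin :: "real \<Rightarrow> ('m, 'n::finite) tvec \<Rightarrow> real \<Rightarrow> ('m, 'n) tvec \<Rightarrow> ('m, 'n) tvec" where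
  "tlin a v b w = (\<lambda>c. a *\<^sub>R v c + b *\<^sub>R w c)"

definition tscale :: "real \<Rightarrow> ('m, 'n::finite) tvec \<Rightarrow> ('m, 'n) tvec" where
  "tscale a v = (\<lambda>c. a *\<^sub>R v c)"

text \<open>The tangent vector at \<open>p\<close> with coordinates \<open>\<xi>\<close> in the chart \<open>c\<close>.\<close>

definition tvec_of :: "('m, 'n::finite) chart set \<Rightarrow> ('m, 'n) chart \<Rightarrow> 'm \<Rightarrow> real^'n \<Rightarrow> ('m, 'n) tvec" where
  "tvec_of A c p \<xi> = (\<lambda>d. if d \<in> charts_at A p
     then frechet_derivative (transition c d) (at (cmap c p)) \<xi> else 0)"

definition velocity :: "('m, 'n::finite) chart set \<Rightarrow> real set \<Rightarrow> (real \<Rightarrow> 'm) \<Rightarrow> real \<Rightarrow> ('m, 'n) tvec" where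
  "velocity A I \<eta> t = (\<lambda>d. if d \<in> charts_at A (\<eta> t)
     then vector_derivative (\<lambda>s. cmap d (\<eta> s)) (at t within I) else 0)"


section \<open>Finsler structures\<close>

text \<open>The coordinate expression \<open>F(x, \<xi>)\<close> in the chart \<open>c\<close>.\<close>

definition F_loc :: "('m, 'n::finite) chart set \<Rightarrow> ('m \<Rightarrow> ('m, 'n) tvec \<Rightarrow> real) \<Rightarrow> ('m, 'n) chart
    \<Rightarrow> real^'n \<Rightarrow> real^'n \<Rightarrow> real" where
  "F_loc A F c x \<xi> = F (cinv c x) (tvec_of A c (cinv c x) \<xi>)"

abbreviation F2_loc :: "('m, 'n::finite) chart set \<Rightarrow> ('m \<Rightarrow> ('m, 'n) tvec \<Rightarrow> real) \<Rightarrow> ('m, 'n) chart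
    \<Rightarrow> real^'n \<Rightarrow> real^'n \<Rightarrow> real" where
  "F2_loc A F c \<equiv> (\<lambda>x \<xi>. (F_loc A F c x \<xi>)\<^sup>2)"

definition g_loc :: "('m, 'n::finite) chart set \<Rightarrow> ('m \<Rightarrow> ('m, 'n) tvec \<Rightarrow> real) \<Rightarrow> ('m, 'n) chart
    \<Rightarrow> real^'n \<Rightarrow> real^'n \<Rightarrow> real^'n^'n" where
  "g_loc A F c x \<xi> = (\<chi> i j. 1/2 * pdy i (pdy j (F2_loc A F c)) x \<xi>)"

definition finsler_structure :: "('m::topological_space, 'n::finite) chart set
    \<Rightarrow> ('m \<Rightarrow> ('m, 'n) tvec \<Rightarrow> real) \<Rightarrow> bool" where
  "finsler_structure A F \<longleftrightarrow>
     (\<forall>p. \<forall>v\<in>tangent_space A p. F p v \<ge> 0) \<and>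
     (\<forall>p. \<forall>v\<in>tangent_space A p. \<forall>a>0. F p (tscale a v) = a * F p v) \<and>
     (\<forall>c\<in>A. smooth_on ((cmap c ` cdom c) \<times> (- {0})) (\<lambda>(x, \<xi>). F_loc A F c x \<xi>)) \<and>
     (\<forall>c\<in>A. \<forall>x\<in>cmap c ` cdom c. \<forall>\<xi>. \<xi> \<noteq> 0 \<longrightarrow>
        (\<forall>w. w \<noteq> 0 \<longrightarrow> w \<bullet> (g_loc A F c x \<xi> *v w) > 0))"

definition g_form :: "('m, 'n::finite) chart set \<Rightarrow> ('m \<Rightarrow> ('m, 'n) tvec \<Rightarrow> real)
    \<Rightarrow> 'm \<Rightarrow> ('m, 'n) tvec \<Rightarrow> ('m, 'n) tvec \<Rightarrow> ('m, 'n) tvec \<Rightarrow> real" where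
  "g_form A F p y u w = (let c = chart_at A p in u c \<bullet> (g_loc A F c (cmap c p) (y c) *v w c))"

definition indicatrix :: "('m, 'n::finite) chart set \<Rightarrow> ('m \<Rightarrow> ('m, 'n) tvec \<Rightarrow> real)
    \<Rightarrow> 'm \<Rightarrow> ('m, 'n) tvec set" where
  "indicatrix A F p = {y \<in> tangent_space A p. F p y = 1}"

text \<open>\<open>T\<^sub>y(I\<^sub>pM)\<close>, as the kernel of the differential of \<open>F(p, \<cdot>)\<close> at \<open>y\<close>.\<close>

definition indicatrix_tangent :: "('m, 'n::finite) chart set \<Rightarrow> ('m \<Rightarrow> ('m, 'n) tvec \<Rightarrow> real)
    \<Rightarrow> 'm \<Rightarrow> ('m, 'n) tvec \<Rightarrow> ('m, 'n) tvec set" where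
  "indicatrix_tangent A F p y = {w \<in> tangent_space A p.
     ((\<lambda>t. F p (tlin 1 y t w)) has_real_derivative 0) (at 0)}"


section \<open>Geodesics, exponential map, forward completeness\<close>

text \<open>The geodesic coefficients
    \<open>G\<^sup>i = 1/4 g\<^sup>i\<^sup>l (\<partial>\<^sup>2F\<^sup>2/\<partial>x\<^sup>k\<partial>y\<^sup>l y\<^sup>k - \<partial>F\<^sup>2/\<partial>x\<^sup>l)\<close>,
  extended by \<open>0\<close> (continuously) to the zero section, where \<open>F\<^sup>2\<close> need not be twice differentiable.\<close>

definition spray :: "('m, 'n::finite) chart set \<Rightarrow> ('m \<Rightarrow> ('m, 'n) tvec \<Rightarrow> real) \<Rightarrow> ('m, 'n) chart
    \<Rightarrow> real^'n \<Rightarrow> real^'n \<Rightarrow> real^'n" where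
  "spray A F c x \<xi> = (if \<xi> = 0 then 0 else
     (1/4) *\<^sub>R (matrix_inv (g_loc A F c x \<xi>) *v
       (\<chi> l. (\<Sum>k\<in>UNIV. pdx k (pdy l (F2_loc A F c)) x \<xi> * \<xi> $ k) - pdx l (F2_loc A F c) x \<xi>)))"

text \<open>In every chart \<open>\<eta>'' + 2 G(\<eta>, \<eta>') = 0\<close>; derivatives are one-sided at the end points
  belonging to \<open>I\<close>.\<close>

definition geodesic_on :: "('m::topological_space, 'n::finite) chart set
    \<Rightarrow> ('m \<Rightarrow> ('m, 'n) tvec \<Rightarrow> real) \<Rightarrow> real set \<Rightarrow> (real \<Rightarrow> 'm) \<Rightarrow> bool" where
  "geodesic_on A F I \<eta> \<longleftrightarrow> continuous_on I \<eta> \<and>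
     (\<forall>t\<in>I. \<forall>d\<in>charts_at A (\<eta> t).
        ((\<lambda>s. cmap d (\<eta> s)) has_vector_derivative velocity A I \<eta> t d) (at t within I) \<and>
        ((\<lambda>s. velocity A I \<eta> s d) has_vector_derivative
           (-2) *\<^sub>R spray A F d (cmap d (\<eta> t)) (velocity A I \<eta> t d)) (at t within I))"

definition geodesic_from :: "('m::topological_space, 'n::finite) chart set
    \<Rightarrow> ('m \<Rightarrow> ('m, 'n) tvec \<Rightarrow> real) \<Rightarrow> real set \<Rightarrow> 'm \<Rightarrow> ('m, 'n) tvec \<Rightarrow> (real \<Rightarrow> 'm) \<Rightarrow> bool" where
  "geodesic_from A F I p v \<eta> \<longleftrightarrow>
     geodesic_on A F I \<eta> \<and> \<eta> 0 = p \<and> velocity A I \<eta> 0 = v"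

definition finsler_exp :: "('m::topological_space, 'n::finite) chart set
    \<Rightarrow> ('m \<Rightarrow> ('m, 'n) tvec \<Rightarrow> real) \<Rightarrow> 'm \<Rightarrow> ('m, 'n) tvec \<Rightarrow> 'm" where
  "finsler_exp A F p v = (THE q. \<exists>\<eta>. geodesic_from A F {0..1} p v \<eta> \<and> \<eta> 1 = q)"

definition forward_complete :: "('m::topological_space, 'n::finite) chart set
    \<Rightarrow> ('m \<Rightarrow> ('m, 'n) tvec \<Rightarrow> real) \<Rightarrow> bool" where
  "forward_complete A F \<longleftrightarrow>
     (\<forall>p. \<forall>v\<in>tangent_space A p. \<exists>\<eta>. geodesic_from A F {0..1} p v \<eta>)"

text \<open>The differential of \<open>exp\<^sub>p\<close> at \<open>v\<close> applied to \<open>w\<close>, a tangent vector at \<open>exp\<^sub>p v\<close>.\<close>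

definition dexp :: "('m::topological_space, 'n::finite) chart set
    \<Rightarrow> ('m \<Rightarrow> ('m, 'n) tvec \<Rightarrow> real) \<Rightarrow> 'm \<Rightarrow> ('m, 'n) tvec \<Rightarrow> ('m, 'n) tvec \<Rightarrow> ('m, 'n) tvec" where
  "dexp A F p v w = velocity A UNIV (\<lambda>t. finsler_exp A F p (tlin 1 v t w)) 0"


section \<open>Volume measure, density in polar coordinates\<close>

text \<open>\<open>d\<mu> = \<sigma>(x) dx\<close> in each chart, with \<open>\<sigma>\<close> smooth and positive.\<close>

definition volume_measure :: "('m::topological_space, 'n::finite) chart set \<Rightarrow> 'm measure
    \<Rightarrow> (('m, 'n) chart \<Rightarrow> real^'n \<Rightarrow> real) \<Rightarrow> bool" where
  "volume_measure A \<mu> \<sigma> \<longleftrightarrow> sets \<mu> = sets borel \<and>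
     (\<forall>c\<in>A. smooth_on (cmap c ` cdom c) (\<sigma> c) \<and> (\<forall>x\<in>cmap c ` cdom c. \<sigma> c x > 0) \<and>
        (\<forall>S\<in>sets borel. S \<subseteq> cdom c \<longrightarrow>
           emeasure \<mu> S = (\<integral>\<^sup>+x\<in>cmap c ` S. ennreal (\<sigma> c x) \<partial>lborel)))"

text \<open>\<open>|d\<mu>(u\<^sub>1, \<dots>, u\<^sub>n)|\<close> for tangent vectors at \<open>q\<close>.\<close>

definition vol :: "('m, 'n::finite) chart set \<Rightarrow> (('m, 'n) chart \<Rightarrow> real^'n \<Rightarrow> real)
    \<Rightarrow> 'm \<Rightarrow> ('n \<Rightarrow> ('m, 'n) tvec) \<Rightarrow> real" where
  "vol A \<sigma> q u = (let c = chart_at A q in \<sigma> c (cmap c q) * \<bar>det (\<chi> i. u i c)\<bar>)"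

text \<open>The number \<open>s\<close> with \<open>P\<^sup>*d\<mu> = s dr \<and> d\<nu>\<close> at \<open>(r, y)\<close>, where \<open>P(r, y) = exp\<^sub>p(r y)\<close> are the
  polar coordinates. The tangent vectors at \<open>(r, y)\<close> are the pairs \<open>(a, e)\<close> with \<open>e \<in> T\<^sub>y(I\<^sub>pM)\<close>;
  \<open>P\<close> maps \<open>(a, e)\<close> to \<open>d(exp\<^sub>p)\<^bsub>ry\<^esub>(a y + r e)\<close>. As \<open>d\<nu>\<close> is the Riemannian volume form of
  \<open>g\<^sub>y\<close> restricted to the indicatrix, \<open>dr \<and> d\<nu>\<close> is the volume form of the product metric
  \<open>dr\<^sup>2 + g\<^sub>y\<close>, i.e. up to sign the square root of the Gram determinant. The sign is fixed by
  \<open>s \<ge> 0\<close> (the orientation of the indicatrix for which polar coordinates near \<open>p\<close> are positive).\<close>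

definition polar_density :: "('m::topological_space, 'n::finite) chart set
    \<Rightarrow> ('m \<Rightarrow> ('m, 'n) tvec \<Rightarrow> real) \<Rightarrow> (('m, 'n) chart \<Rightarrow> real^'n \<Rightarrow> real)
    \<Rightarrow> 'm \<Rightarrow> real \<Rightarrow> ('m, 'n) tvec \<Rightarrow> real" where
  "polar_density A F \<sigma> p r y = (THE s.
     \<forall>(a :: 'n \<Rightarrow> real) e. (\<forall>i. e i \<in> indicatrix_tangent A F p y) \<longrightarrow>
       vol A \<sigma> (finsler_exp A F p (tscale r y)) (\<lambda>i. dexp A F p (tscale r y) (tlin (a i) y r (e i)))
         = s * sqrt (det (\<chi> i j. a i * a j + g_form A F p y (e i) (e j))))"

text \<open>\<open>f\<close>, given on \<open>r > 0\<close>, extends to a \<open>k\<close> times differentiable function on some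
  \<open>[0, \<epsilon>)\<close> whose \<open>k\<close>-th (one-sided) derivative at \<open>0\<close> is \<open>l\<close>; \<open>D j\<close> is the \<open>j\<close>-th derivative
  of the extension \<open>D 0\<close>.\<close>

definition has_radial_derivative :: "nat \<Rightarrow> (real \<Rightarrow> real) \<Rightarrow> real \<Rightarrow> bool" where
  "has_radial_derivative k f l \<longleftrightarrow> (\<exists>\<epsilon>>0. \<exists>D :: nat \<Rightarrow> real \<Rightarrow> real.
     (\<forall>r\<in>{0<..<\<epsilon>}. D 0 r = f r) \<and>
     (\<forall>j<k. \<forall>r\<in>{0..<\<epsilon>}. (D j has_real_derivative D (Suc j) r) (at r within {0..<\<epsilon>})) \<and>
     D k 0 = l)"

definition infinitesimal_harmonic :: "('m::topological_space, 'n::finite) chart set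
    \<Rightarrow> ('m \<Rightarrow> ('m, 'n) tvec \<Rightarrow> real) \<Rightarrow> (('m, 'n) chart \<Rightarrow> real^'n \<Rightarrow> real) \<Rightarrow> bool" where
  "infinitesimal_harmonic A F \<sigma> \<longleftrightarrow>
     (\<forall>k\<ge>1. \<exists>c. \<forall>p. \<forall>y\<in>indicatrix A F p.
        has_radial_derivative k (\<lambda>r. polar_density A F \<sigma> p r y) c)"


section \<open>Curvatures\<close>

definition distortion :: "('m, 'n::finite) chart set \<Rightarrow> ('m \<Rightarrow> ('m, 'n) tvec \<Rightarrow> real)
    \<Rightarrow> (('m, 'n) chart \<Rightarrow> real^'n \<Rightarrow> real) \<Rightarrow> 'm \<Rightarrow> ('m, 'n) tvec \<Rightarrow> real" where
  "distortion A F \<sigma> p y = (let c = chart_at A p in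
     ln (sqrt (det (g_loc A F c (cmap c p) (y c))) / \<sigma> c (cmap c p)))"

definition S_curvature :: "('m::topological_space, 'n::finite) chart set
    \<Rightarrow> ('m \<Rightarrow> ('m, 'n) tvec \<Rightarrow> real) \<Rightarrow> (('m, 'n) chart \<Rightarrow> real^'n \<Rightarrow> real)
    \<Rightarrow> 'm \<Rightarrow> ('m, 'n) tvec \<Rightarrow> real" where
  "S_curvature A F \<sigma> p y = (THE s. \<exists>\<epsilon>>0. \<exists>\<eta>. geodesic_from A F {-\<epsilon><..<\<epsilon>} p y \<eta> \<and>
     ((\<lambda>t. distortion A F \<sigma> (\<eta> t) (velocity A {-\<epsilon><..<\<epsilon>} \<eta> t)) has_real_derivative s) (at 0))"

text \<open>\<open>R\<^sup>i\<^sub>k = 2 \<partial>G\<^sup>i/\<partial>x\<^sup>k - y\<^sup>j \<partial>\<^sup>2G\<^sup>i/\<partial>x\<^sup>j\<partial>y\<^sup>k + 2 G\<^sup>j \<partial>\<^sup>2G\<^sup>i/\<partial>y\<^sup>j\<partial>y\<^sup>k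
  - \<partial>G\<^sup>i/\<partial>y\<^sup>j \<partial>G\<^sup>j/\<partial>y\<^sup>k\<close>\<close>

definition riemann_curvature_loc :: "('m, 'n::finite) chart set \<Rightarrow> ('m \<Rightarrow> ('m, 'n) tvec \<Rightarrow> real)
    \<Rightarrow> ('m, 'n) chart \<Rightarrow> real^'n \<Rightarrow> real^'n \<Rightarrow> real^'n^'n" where
  "riemann_curvature_loc A F c x \<xi> = (let G = (\<lambda>i x \<xi>. spray A F c x \<xi> $ i) in
     \<chi> i k. 2 * pdx k (G i) x \<xi>
       - (\<Sum>j\<in>UNIV. \<xi> $ j * pdx j (pdy k (G i)) x \<xi>)
       + 2 * (\<Sum>j\<in>UNIV. G j x \<xi> * pdy j (pdy k (G i)) x \<xi>)
       - (\<Sum>j\<in>UNIV. pdy j (G i) x \<xi> * pdy k (G j) x \<xi>))"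

definition ricci :: "('m, 'n::finite) chart set \<Rightarrow> ('m \<Rightarrow> ('m, 'n) tvec \<Rightarrow> real)
    \<Rightarrow> 'm \<Rightarrow> ('m, 'n) tvec \<Rightarrow> real" where
  "ricci A F p y = (let c = chart_at A p in trace (riemann_curvature_loc A F c (cmap c p) (y c)))"

definition einstein :: "('m, 'n::finite) chart set \<Rightarrow> ('m \<Rightarrow> ('m, 'n) tvec \<Rightarrow> real) \<Rightarrow> bool" where
  "einstein A F \<longleftrightarrow> (\<exists>\<rho> :: 'm \<Rightarrow> real. \<forall>p. \<forall>y\<in>indicatrix A F p. ricci A F p y = \<rho> p)"

definition constant_ricci_curvature :: "('m, 'n::finite) chart set
    \<Rightarrow> ('m \<Rightarrow> ('m, 'n) tvec \<Rightarrow> real) \<Rightarrow> bool" where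
  "constant_ricci_curvature A F \<longleftrightarrow> (\<exists>\<kappa>::real. \<forall>p. \<forall>y\<in>indicatrix A F p. ricci A F p y = \<kappa>)"

definition constant_S_curvature :: "('m::topological_space, 'n::finite) chart set
    \<Rightarrow> ('m \<Rightarrow> ('m, 'n) tvec \<Rightarrow> real) \<Rightarrow> (('m, 'n) chart \<Rightarrow> real^'n \<Rightarrow> real) \<Rightarrow> bool" where
  "constant_S_curvature A F \<sigma> \<longleftrightarrow>
     (\<exists>c::real. \<forall>p. \<forall>y\<in>indicatrix A F p. S_curvature A F \<sigma> p y = c)"

end

theory Submission
  imports Defs
begin

text \<open>
  Let \<open>y\<close> be a unit vector at \<open>p\<close>, \<open>x(t)\<close> the geodesic with \<open>x'(0) = y\<close>, and \<open>M(t)\<close> the matrix of the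
  Jacobi fields along it that vanish at \<open>0\<close>, all in one chart. Then \<open>d(exp\<^sub>p)\<^bsub>ty\<^esub> = M(t)/t\<close>, and the
  polar density is \<open>t\<^sup>n\<^sup>-\<^sup>1 f(t)\<close> with \<open>f(t) = \<kappa> \<sigma>(x(t)) |det (M(t)/t)|\<close>, \<open>\<kappa>\<close> independent of \<open>t\<close>. Write \<open>N\<close> for
  the matrix \<open>\<partial>G\<^sup>i/\<partial>y\<^sup>j\<close> and a prime for the derivative along the geodesic flow. The linearized geodesic
  equation \<open>M'' = - 2 G\<^sub>x M - 2 N M'\<close> gives
  \<open>f(t) = f(0) (1 + \<alpha> t + (\<beta> + \<alpha>\<^sup>2)/2 t\<^sup>2 + o(t\<^sup>2))\<close> with \<open>\<alpha> = d log \<sigma>(y) - tr N\<close> and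
  \<open>\<beta> = \<alpha>' - (2 tr G\<^sub>x - tr N' - tr N\<^sup>2)/3 = \<alpha>' - Ric(y)/3\<close>.

  The radial derivatives of order \<open>n - 1\<close>, \<open>n\<close>, \<open>n + 1\<close> determine \<open>f(0)\<close>, \<open>\<alpha>\<close> and \<open>\<beta>\<close>, so these are constants.
  Since \<open>f(0) = exp (-\<tau>)\<close>, the distortion is constant and the \<open>S\<close>-curvature vanishes. Since \<open>\<alpha> = C F\<close> by
  homogeneity and \<open>F\<close> is constant along geodesics, \<open>\<alpha>' = 0\<close> and \<open>Ric = - 3 \<beta>\<close> is constant.
\<close>

section \<open>Smooth maps\<close>

text \<open>Forward completeness supplies geodesics on [0, 1] only, as curves in the manifold, and
  \<open>finsler_exp\<close> is a definite description over such curves. Hence the flow in the chart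
  has to be identified with every geodesic that has the same initial data
  (\<open>geodesic_unique_in_chart\<close>), and the two-sided geodesics demanded by the S-curvature
  are obtained by starting slightly earlier on the flow line. The density \<sigma> is tied to the
  charts through the measure, so its transformation rule comes from the change of variables theorem.
  The expansions are one-sided Taylor expansions with Peano remainder: they fit the definition of
  the radial derivatives, and beyond a limit at 0 they ask for derivatives of f at t > 0 only. By
  the usual formula \<alpha> is minus the S-curvature, but seeing this takes the derivative of log
  det g along geodesics; homogeneity of \<alpha> and conservation of F give \<alpha>' = 0 without
  that computation.\<close>

lemma Ck_on_cong:
  assumes "open S" "\<And>x. x \<in> S \<Longrightarrow> f x = g x" "Ck_on k f S"
  shows "Ck_on k g S"
  using assms(2,3)
proof (induction k arbitrary: f g)
  case 0 then show ?case using continuous_on_cong by auto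
next
  case (Suc k)
  have fg: "(f has_derivative D) (at x) \<longleftrightarrow> (g has_derivative D) (at x)" if "x \<in> S" for x D
    using has_derivative_transform_within_open[of f D x UNIV S g]
      has_derivative_transform_within_open[of g D x UNIV S f] assms(1) that Suc.prems(1) by auto
  have fd: "frechet_derivative f (at x) = frechet_derivative g (at x)" if "x \<in> S" for x
    unfolding frechet_derivative_def using fg[OF that] by simp
  show ?case
  proof (simp, intro conjI ballI allI)
    show "g differentiable (at x)" if "x \<in> S" for x
      using Suc.prems(2) fg[OF that] that frechet_derivative_works
      by (metis Ck_on.simps(2) differentiable_def)
    show "Ck_on k (\<lambda>x. frechet_derivative g (at x) v) S" for v
      by (rule Suc.IH[of "\<lambda>x. frechet_derivative f (at x) v"]) (use fd Suc.prems in auto)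
  qed
qed

lemma Ck_on_Suc_imp: "Ck_on (Suc k) f S \<Longrightarrow> Ck_on k f S"
proof (induction k arbitrary: f)
  case 0
  then show ?case
    using differentiable_at_withinI by (fastforce intro!: differentiable_imp_continuous_on simp: differentiable_on_def)
next
  case (Suc k)
  then show ?case by (metis Ck_on.simps(2))
qed

lemma Ck_on_le: "j \<le> k \<Longrightarrow> Ck_on k f S \<Longrightarrow> Ck_on j f S"
  by (induction rule: dec_induct) (use Ck_on_Suc_imp in blast)+

lemma Ck_on_imp_continuous_on: "Ck_on k f S \<Longrightarrow> continuous_on S f"
  using Ck_on_le[of 0 k] by auto

text \<open>\<open>Ck_on\<close> is phrased with the chosen derivative
  \<open>frechet_derivative\<close>; by uniqueness of derivatives an explicitly written one may take
  its place. The closure properties under arithmetic below go through this rule.\<close>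

lemma Ck_on_SucI:
  assumes "open S" "\<And>x. x \<in> S \<Longrightarrow> (f has_derivative D x) (at x)"
    and "\<And>v. Ck_on k (\<lambda>x. D x v) S"
  shows "Ck_on (Suc k) f S"
proof (simp, intro conjI ballI allI)
  show "f differentiable (at x)" if "x \<in> S" for x
    using assms(2)[OF that] by (auto simp: differentiable_def)
  show "Ck_on k (\<lambda>x. frechet_derivative f (at x) v) S" for v
    by (rule Ck_on_cong[OF assms(1) _ assms(3)[of v]])
      (use assms(2) frechet_derivative_at in metis)
qed

lemma Ck_on_SucD:
  assumes "Ck_on (Suc k) f S" "x \<in> S"
  shows "(f has_derivative frechet_derivative f (at x)) (at x)"
  using assms frechet_derivative_works by auto

lemma Ck_on_const: "Ck_on k (\<lambda>x. c) S"
  by (induction k arbitrary: c) auto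

lemma Ck_on_linear:
  assumes "bounded_linear L" "open S" shows "Ck_on k L S"
proof (cases k)
  case 0 then show ?thesis using assms by (simp add: linear_continuous_on)
next
  case (Suc j)
  show ?thesis unfolding Suc
    by (rule Ck_on_SucI[where D = "\<lambda>x. L"])
      (use assms bounded_linear_imp_has_derivative in \<open>auto intro: Ck_on_const\<close>)
qed

lemma Ck_on_add:
  assumes "open S" "Ck_on k f S" "Ck_on k g S"
  shows "Ck_on k (\<lambda>x. f x + g x) S"
  using assms(2,3)
proof (induction k arbitrary: f g)
  case 0 then show ?case by (simp add: continuous_on_add)
next
  case (Suc k)
  show ?case
    by (rule Ck_on_SucI[OF assms(1) has_derivative_add[OF Ck_on_SucD Ck_on_SucD]])
      (use Suc in auto)
qed

text \<open>The product rule pairs a derivative with an undifferentiated factor, so the induction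
  uses both factors at the lower order as well, by \<open>Ck_on_Suc_imp\<close>. Real products and
  scalar multiples are instances.\<close>

lemma Ck_on_bilinear:
  assumes "open S" "bounded_bilinear b" "Ck_on k f S" "Ck_on k g S"
  shows "Ck_on k (\<lambda>x. b (f x) (g x)) S"
  using assms(3,4)
proof (induction k arbitrary: f g)
  case 0 then show ?case using assms(2) by (simp add: bounded_bilinear.continuous_on)
next
  case (Suc k)
  show ?case
    by (rule Ck_on_SucI[OF assms(1) bounded_bilinear.FDERIV[OF assms(2) Ck_on_SucD Ck_on_SucD]])
      (use Suc.prems Suc.prems[THEN Ck_on_Suc_imp] in \<open>auto intro!: Ck_on_add[OF assms(1)] Suc.IH\<close>)
qed

lemmas Ck_on_mult = Ck_on_bilinear[OF _ bounded_bilinear_mult]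
lemmas Ck_on_scaleR = Ck_on_bilinear[OF _ bounded_bilinear_scaleR]

lemma Ck_on_minus:
  assumes "open S" "Ck_on k f S" shows "Ck_on k (\<lambda>x. - f x) S"
  using Ck_on_scaleR[OF assms(1) Ck_on_const[of k "-1"] assms(2)] by simp

lemma Ck_on_diff:
  assumes "open S" "Ck_on k f S" "Ck_on k g S"
  shows "Ck_on k (\<lambda>x. f x - g x) S"
  using Ck_on_add[OF assms(1,2) Ck_on_minus[OF assms(1,3)]] by simp

lemma Ck_on_sum:
  assumes "open S" "\<And>i. i \<in> I \<Longrightarrow> Ck_on k (f i) S"
  shows "Ck_on k (\<lambda>x. \<Sum>i\<in>I. f i x) S"
  using assms(2)
  by (induction I rule: infinite_finite_induct) (auto intro: Ck_on_const Ck_on_add[OF assms(1)])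

lemma Ck_on_prod:
  fixes f :: "'i \<Rightarrow> 'a::euclidean_space \<Rightarrow> real"
  assumes "open S" "\<And>i. i \<in> I \<Longrightarrow> Ck_on k (f i) S"
  shows "Ck_on k (\<lambda>x. \<Prod>i\<in>I. f i x) S"
  using assms(2)
  by (induction I rule: infinite_finite_induct) (auto intro: Ck_on_const Ck_on_mult[OF assms(1)])

lemma Ck_on_inverse:
  fixes f :: "'a::euclidean_space \<Rightarrow> real"
  assumes "open S" "Ck_on k f S" "\<And>x. x \<in> S \<Longrightarrow> f x \<noteq> 0"
  shows "Ck_on k (\<lambda>x. inverse (f x)) S"
  using assms(2)
proof (induction k)
  case 0 then show ?case using assms(3) by (auto intro: continuous_on_inverse)
next
  case (Suc k)
  show ?case
    by (rule Ck_on_SucI[OF assms(1) Deriv.has_derivative_inverse[OF _ Ck_on_SucD]])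
      (use Suc Ck_on_Suc_imp assms in \<open>auto intro!: Ck_on_minus Ck_on_mult Suc.IH\<close>)
qed

text \<open>The derivative of f o L in direction v is the derivative of f along the fixed direction
  L v, again composed with L; so the induction stays within such composites.\<close>

lemma Ck_on_compose_linear:
  assumes "open S" "Ck_on k f S" "bounded_linear L" "open T" "L ` T \<subseteq> S"
  shows "Ck_on k (\<lambda>x. f (L x)) T"
  using assms(2)
proof (induction k arbitrary: f)
  case 0
  then show ?case using assms
    by (auto intro: continuous_on_compose2 linear_continuous_on)
next
  case (Suc k)
  show ?case
    by (rule Ck_on_SucI[OF assms(4) has_derivative_compose[OF bounded_linear_imp_has_derivative[OF assms(3)] Ck_on_SucD]])
      (use Suc.prems assms in \<open>auto intro!: Suc.IH[of "\<lambda>x. frechet_derivative f (at x) (L v)" for v]\<close>)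
qed

lemma Ck_on_linear_compose:
  assumes "open S" "Ck_on k f S" "bounded_linear L"
  shows "Ck_on k (\<lambda>x. L (f x)) S"
  using assms(2)
proof (induction k arbitrary: f)
  case 0
  then show ?case using assms
    by (auto intro: bounded_linear.continuous_on)
next
  case (Suc k)
  show ?case
    by (rule Ck_on_SucI[OF assms(1) bounded_linear.has_derivative[OF assms(3) Ck_on_SucD]])
      (use Suc assms in auto)
qed

lemma Ck_on_vec:
  fixes f :: "'a::euclidean_space \<Rightarrow> real^'n"
  assumes "open S" "\<And>i. Ck_on k (\<lambda>x. f x $ i) S"
  shows "Ck_on k f S"
proof -
  have "f = (\<lambda>x. \<Sum>i\<in>UNIV. (f x $ i) *\<^sub>R axis i 1)"
    by (auto simp: vec_eq_iff axis_def if_distrib cong: if_cong)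
  moreover have "Ck_on k (\<lambda>x. \<Sum>i\<in>UNIV. (f x $ i) *\<^sub>R axis i (1::real)) S"
    by (intro Ck_on_sum Ck_on_scaleR Ck_on_const assms)
  ultimately show ?thesis by simp
qed

lemma Ck_on_Pair:
  assumes "open S" "Ck_on k f S" "Ck_on k g S"
  shows "Ck_on k (\<lambda>x. (f x, g x)) S"
proof -
  have "Ck_on k (\<lambda>x. (f x, 0) + (0, g x)) S"
    by (intro Ck_on_add assms Ck_on_linear_compose[OF assms(1,2), of "\<lambda>a. (a, 0)"]
        Ck_on_linear_compose[OF assms(1,3), of "\<lambda>a. (0, a)"])
      (auto intro!: bounded_linear_intros)
  then show ?thesis by simp
qed

lemma Ck_on_det:
  fixes f :: "'a::euclidean_space \<Rightarrow> real^'n^'n"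
  assumes "open S" "\<And>i j. Ck_on k (\<lambda>x. f x $ i $ j) S"
  shows "Ck_on k (\<lambda>x. det (f x)) S"
  unfolding det_def by (intro Ck_on_sum Ck_on_mult Ck_on_prod Ck_on_const assms)

section \<open>Inverse matrices by Cramer's rule\<close>

lemma matrix_inv_mult:
  fixes M :: "real^'n^'n"
  assumes "det M \<noteq> 0"
  shows "M ** matrix_inv M = mat 1" "matrix_inv M ** M = mat 1"
  using assms invertible_det_nz[of M] someI_ex[of "\<lambda>B. M ** B = mat 1 \<and> B ** M = mat 1"]
  unfolding invertible_def matrix_inv_def by blast+

lemma matrix_inv_mult_vec:
  fixes M :: "real^'n^'n"
  assumes "det M \<noteq> 0"
  shows "M *v (matrix_inv M *v b) = b"
    and "matrix_inv M *v b = (\<chi> k. det (\<chi> i j. if j = k then b $ i else M $ i $ j) / det M)"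
proof -
  show *: "M *v (matrix_inv M *v b) = b"
    by (simp add: matrix_vector_mul_assoc matrix_inv_mult[OF assms])
  show "matrix_inv M *v b = (\<chi> k. det (\<chi> i j. if j = k then b $ i else M $ i $ j) / det M)"
    using cramer[OF assms] * by blast
qed

text \<open>By Cramer's rule the components are polynomials in the entries of M and b, divided by
  det M. This is what makes the spray smooth.\<close>

lemma Ck_on_matrix_inv_mult:
  fixes M :: "'a::euclidean_space \<Rightarrow> real^'n^'n"
  assumes S: "open S" and M: "\<And>i j. Ck_on k (\<lambda>x. M x $ i $ j) S"
    and b: "\<And>i. Ck_on k (\<lambda>x. b x $ i) S" and nz: "\<And>x. x \<in> S \<Longrightarrow> det (M x) \<noteq> 0"
  shows "Ck_on k (\<lambda>x. matrix_inv (M x) *v b x) S"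
proof (rule Ck_on_vec[OF S])
  fix l
  have *: "Ck_on k (\<lambda>x. det (\<chi> i j. if j = l then b x $ i else M x $ i $ j) * inverse (det (M x))) S"
  proof (intro Ck_on_mult Ck_on_inverse Ck_on_det S nz M)
    show "Ck_on k (\<lambda>x. (\<chi> i j. if j = l then b x $ i else M x $ i $ j) $ i $ j) S" for i j
      using b M by (cases "j = l") auto
  qed
  show "Ck_on k (\<lambda>x. (matrix_inv (M x) *v b x) $ l) S"
    by (rule Ck_on_cong[OF S _ *]) (simp add: matrix_inv_mult_vec nz divide_inverse)
qed

section \<open>Partial derivatives in the position and the fibre coordinate\<close>

lemma pdx_eq:
  fixes f :: "real^'n::finite \<Rightarrow> real^'n \<Rightarrow> real"
  assumes "(case_prod f has_derivative D) (at (x, \<xi>))"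
  shows "((\<lambda>z. f z \<xi>) has_derivative (\<lambda>h. D (h, 0))) (at x)" "pdx k f x \<xi> = D (axis k 1, 0)"
proof -
  have "((\<lambda>z. case_prod f (z, \<xi>)) has_derivative (\<lambda>h. D (h, 0))) (at x)"
    by (rule has_derivative_compose[of "\<lambda>z. (z, \<xi>)" "\<lambda>h. (h, 0)" x UNIV "case_prod f" D])
      (use assms in \<open>auto intro!: derivative_eq_intros\<close>)
  then show 1: "((\<lambda>z. f z \<xi>) has_derivative (\<lambda>h. D (h, 0))) (at x)" by simp
  show "pdx k f x \<xi> = D (axis k 1, 0)"
    unfolding pdx_def frechet_derivative_at[OF 1, symmetric] by simp
qed

lemma pdy_eq:
  fixes f :: "real^'n::finite \<Rightarrow> real^'n \<Rightarrow> real"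
  assumes "(case_prod f has_derivative D) (at (x, \<xi>))"
  shows "(f x has_derivative (\<lambda>h. D (0, h))) (at \<xi>)" "pdy k f x \<xi> = D (0, axis k 1)"
proof -
  have "((\<lambda>z. case_prod f (x, z)) has_derivative (\<lambda>h. D (0, h))) (at \<xi>)"
    by (rule has_derivative_compose[of "\<lambda>z. (x, z)" "\<lambda>h. (0, h)" \<xi> UNIV "case_prod f" D])
      (use assms in \<open>auto intro!: derivative_eq_intros\<close>)
  then show 1: "(f x has_derivative (\<lambda>h. D (0, h))) (at \<xi>)" by simp
  show "pdy k f x \<xi> = D (0, axis k 1)"
    unfolding pdy_def frechet_derivative_at[OF 1, symmetric] by simp
qed

lemma linear_axis_sum:
  fixes L :: "real^'n::finite \<Rightarrow> 'b::real_vector"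
  assumes "linear L"
  shows "L v = (\<Sum>i\<in>UNIV. v $ i *\<^sub>R L (axis i 1))"
proof -
  have "v = (\<Sum>i\<in>UNIV. v $ i *\<^sub>R axis i 1)"
    by (auto simp: vec_eq_iff axis_def if_distrib cong: if_cong)
  then have "L v = L (\<Sum>i\<in>UNIV. v $ i *\<^sub>R axis i 1)" by simp
  also have "\<dots> = (\<Sum>i\<in>UNIV. v $ i *\<^sub>R L (axis i 1))"
    using assms by (simp add: linear_sum linear_scale)
  finally show ?thesis .
qed

lemma derivative_pd:
  fixes f :: "real^'n::finite \<Rightarrow> real^'n \<Rightarrow> real"
  assumes "(case_prod f has_derivative D) (at (x, \<xi>))"
  shows "D (v, w) = (\<Sum>i\<in>UNIV. pdx i f x \<xi> * v $ i) + (\<Sum>i\<in>UNIV. pdy i f x \<xi> * w $ i)"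
proof -
  have l: "linear D" using assms has_derivative_linear by blast
  have "D (v, w) = D ((v, 0) + (0, w))" by simp
  also have "\<dots> = D (v, 0) + D (0, w)" by (rule linear_add[OF l])
  also have "D (v, 0) = (\<Sum>i\<in>UNIV. v $ i *\<^sub>R D (axis i 1, 0))"
    using linear_axis_sum[of "\<lambda>v. D (v, 0)" v] l linear_compose[of "\<lambda>v. (v, 0)" D]
    by (auto simp: o_def linear_iff)
  also have "D (0, w) = (\<Sum>i\<in>UNIV. w $ i *\<^sub>R D (0, axis i 1))"
    using linear_axis_sum[of "\<lambda>v. D (0, v)" w] l linear_compose[of "\<lambda>v. (0, v)" D]
    by (auto simp: o_def linear_iff)
  finally show ?thesis using pdx_eq(2)[OF assms] pdy_eq(2)[OF assms] by (simp add: mult.commute)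
qed

lemma Ck_on_pdx:
  fixes f :: "real^'n::finite \<Rightarrow> real^'n \<Rightarrow> real"
  assumes "open S" "Ck_on (Suc k) (case_prod f) S"
  shows "Ck_on k (case_prod (pdx i f)) S"
proof -
  have "Ck_on k (\<lambda>z. frechet_derivative (case_prod f) (at z) (axis i 1, 0)) S"
    using assms(2) by simp
  then show ?thesis
    by (rule Ck_on_cong[OF assms(1), rotated]) (use pdx_eq(2)[OF Ck_on_SucD[OF assms(2)]] in auto)
qed

lemma Ck_on_pdy:
  fixes f :: "real^'n::finite \<Rightarrow> real^'n \<Rightarrow> real"
  assumes "open S" "Ck_on (Suc k) (case_prod f) S"
  shows "Ck_on k (case_prod (pdy i f)) S"
proof -
  have "Ck_on k (\<lambda>z. frechet_derivative (case_prod f) (at z) (0, axis i 1)) S"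
    using assms(2) by simp
  then show ?thesis
    by (rule Ck_on_cong[OF assms(1), rotated]) (use pdy_eq(2)[OF Ck_on_SucD[OF assms(2)]] in auto)
qed

lemma smooth_on_pd:
  fixes f :: "real^'n::finite \<Rightarrow> real^'n \<Rightarrow> real"
  assumes "open S" "smooth_on S (case_prod f)"
  shows "smooth_on S (case_prod (pdx i f))" "smooth_on S (case_prod (pdy i f))"
  using assms Ck_on_pdx Ck_on_pdy unfolding smooth_on_def by blast+

lemma smooth_onD:
  assumes "smooth_on S f" "x \<in> S"
  shows "(f has_derivative frechet_derivative f (at x)) (at x)"
  using assms Ck_on_SucD unfolding smooth_on_def by blast

lemma smooth_on_imp_continuous_on: "smooth_on S f \<Longrightarrow> continuous_on S f"
  unfolding smooth_on_def using Ck_on_imp_continuous_on by blast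

lemma smooth_on_frechet_derivative:
  "smooth_on S f \<Longrightarrow> smooth_on S (\<lambda>x. frechet_derivative f (at x) v)"
  unfolding smooth_on_def by (metis Ck_on.simps(2))

section \<open>Short-time theory of ordinary differential equations\<close>

lemma at_within_interval_nontrivial:
  fixes J :: "real set"
  assumes "is_interval J" "t \<in> J" "s \<in> J" "s \<noteq> t"
  shows "at t within J \<noteq> bot"
  using connected_imp_perfect[of J t] assms is_interval_connected trivial_limit_within[of t J] by blast

lemma vector_mvt_bound:
  fixes e :: "real \<Rightarrow> 'a::real_normed_vector"
  assumes "convex I" "s \<in> I" "t \<in> I"
    and der: "\<And>r. r \<in> I \<Longrightarrow> (e has_vector_derivative e' r) (at r within I)"
    and le: "\<And>r. r \<in> I \<Longrightarrow> norm (e' r) \<le> B"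
  shows "norm (e t - e s) \<le> B * \<bar>t - s\<bar>"
proof -
  have "norm (e t - e s) \<le> B * norm (t - s)"
  proof (rule differentiable_bound[OF assms(1) _ _ assms(3,2), where f' = "\<lambda>r h. h *\<^sub>R e' r"])
    show "(e has_derivative (\<lambda>h. h *\<^sub>R e' r)) (at r within I)" if "r \<in> I" for r
      using der[OF that] by (simp add: has_vector_derivative_def)
    show "onorm (\<lambda>h. h *\<^sub>R e' r) \<le> B" if "r \<in> I" for r
      by (rule onorm_le) (use mult_left_mono[OF le[OF that] abs_ge_zero] in \<open>simp add: mult.commute\<close>)
  qed
  then show ?thesis by simp
qed

text \<open>A form of Gronwall's inequality for short intervals: where |e| is largest, the mean
  value inequality bounds it by |e t0| + (b - a) \<delta> plus L (b - a) times the same maximum. As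
  L (b - a) is at most 1/2, that term is absorbed on the left.\<close>

lemma short_time_bound:
  fixes e :: "real \<Rightarrow> 'a::real_normed_vector"
  assumes t0: "t0 \<in> {a..b}" and t: "t \<in> {a..b}"
    and der: "\<And>s. s \<in> {a..b} \<Longrightarrow> (e has_vector_derivative e' s) (at s within {a..b})"
    and le: "\<And>s. s \<in> {a..b} \<Longrightarrow> norm (e' s) \<le> L * norm (e s) + \<delta>"
    and L: "0 \<le> L" "L * (b - a) \<le> 1/2"
  shows "norm (e t) \<le> 2 * (norm (e t0) + (b - a) * \<delta>)"
proof -
  have "continuous_on {a..b} (\<lambda>s. norm (e s))"
    by (intro continuous_on_norm continuous_on_vector_derivative[OF der])
  then obtain m where m: "m \<in> {a..b}" "\<And>s. s \<in> {a..b} \<Longrightarrow> norm (e s) \<le> norm (e m)"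
    using continuous_attains_sup[of "{a..b}" "\<lambda>s. norm (e s)"] t0 by (metis compact_Icc empty_iff)
  let ?M = "norm (e m)"
  have B: "norm (e' s) \<le> L * ?M + \<delta>" if "s \<in> {a..b}" for s
    using le[OF that] mult_left_mono[OF m(2)[OF that] L(1)] by linarith
  then have B0: "0 \<le> L * ?M + \<delta>" using norm_ge_zero order_trans t0 by blast
  have "norm (e m - e t0) \<le> (L * ?M + \<delta>) * \<bar>m - t0\<bar>"
    by (rule vector_mvt_bound[of "{a..b}"]) (use der B t0 m in auto)
  also have "\<dots> \<le> (L * ?M + \<delta>) * (b - a)"
    using m(1) t0 B0 by (intro mult_left_mono) auto
  finally have "?M \<le> norm (e t0) + (L * (b - a)) * ?M + \<delta> * (b - a)"
    using norm_triangle_ineq2[of "e m" "e t0"] by (simp add: algebra_simps)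
  moreover have "(L * (b - a)) * ?M \<le> 1/2 * ?M"
    by (rule mult_right_mono[OF L(2)]) simp
  ultimately have "?M \<le> 2 * (norm (e t0) + (b - a) * \<delta>)" by (simp add: algebra_simps)
  then show ?thesis using m(2)[OF t] by linarith
qed

text \<open>Banach's fixed point theorem is applied to bounded continuous functions on the whole
  real line. For this the field is extended from the ball by nearest-point projection and time is
  clamped to [-\<epsilon>, \<epsilon>]; the solution of the modified equation does not leave the
  ball, where both fields agree. One \<epsilon> serves all initial values in the half ball.\<close>

lemma picard_local:
  fixes X :: "'a::euclidean_space \<Rightarrow> 'a"
  assumes \<rho>: "\<rho> > 0" and L: "L \<ge> 0"
    and Lip: "\<And>a b. a \<in> cball z0 \<rho> \<Longrightarrow> b \<in> cball z0 \<rho> \<Longrightarrow> norm (X a - X b) \<le> L * norm (a - b)"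
  obtains \<epsilon> where "\<epsilon> > 0"
    "\<And>z. z \<in> ball z0 (\<rho>/2) \<Longrightarrow> \<exists>u. u 0 = z \<and>
      (\<forall>t\<in>{-\<epsilon><..<\<epsilon>}. u t \<in> ball z0 \<rho> \<and> (u has_vector_derivative X (u t)) (at t))"
proof -
  define cp where "cp = closest_point (cball z0 \<rho>)"
  have cp_in: "cp a \<in> cball z0 \<rho>" for a
    unfolding cp_def using \<rho> by (intro closest_point_in_set) auto
  have cp_id: "cp a = a" if "a \<in> cball z0 \<rho>" for a
    unfolding cp_def using that by (intro closest_point_self) auto
  define Y where "Y = (\<lambda>a. X (cp a))"
  have YL: "norm (Y a - Y b) \<le> L * norm (a - b)" for a b
  proof -
    have "norm (Y a - Y b) \<le> L * norm (cp a - cp b)" unfolding Y_def by (intro Lip cp_in)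
    also have "\<dots> \<le> L * norm (a - b)"
      using closest_point_lipschitz[of "cball z0 \<rho>" a b] \<rho> L
      by (intro mult_left_mono) (auto simp: cp_def dist_norm)
    finally show ?thesis .
  qed
  have "L-lipschitz_on UNIV Y" using YL L by (intro lipschitz_onI) (auto simp: dist_norm)
  then have Ycont: "continuous_on UNIV Y" by (rule lipschitz_on_continuous_on)
  define B where "B = norm (X z0) + L * \<rho>"
  have B0: "B \<ge> 0" using L \<rho> by (simp add: B_def)
  have YB: "norm (Y a) \<le> B" for a
  proof -
    have "norm (Y a - X z0) \<le> L * norm (cp a - z0)" unfolding Y_def using \<rho> by (intro Lip cp_in) auto
    also have "\<dots> \<le> L * \<rho>" using cp_in[of a] L by (intro mult_left_mono) (auto simp: dist_norm norm_minus_commute)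
    finally show ?thesis unfolding B_def using norm_triangle_ineq2[of "Y a" "X z0"] by linarith
  qed
  \<comment> \<open>The first bound keeps solutions from the half ball inside radius \<rho>, as
    their speed is at most B; the second makes the integral operator a contraction with factor
    1/2.\<close>
  define \<epsilon> where "\<epsilon> = min (\<rho> / (2 * (B + 1))) (1 / (2 * (L + 1)))"
  have \<epsilon>: "\<epsilon> > 0" using \<rho> B0 L by (simp add: \<epsilon>_def)
  have "\<epsilon> * (B + 1) \<le> \<rho> / (2 * (B + 1)) * (B + 1)"
    using B0 by (intro mult_right_mono) (auto simp: \<epsilon>_def)
  also have "\<dots> = \<rho>/2" using B0 add_nonneg_eq_0_iff[of B 1] by (simp add: divide_simps)
  finally have \<epsilon>B: "\<epsilon> * B < \<rho>/2" using \<epsilon> by (simp add: distrib_left)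
  have "\<epsilon> * (L + 1) \<le> 1 / (2 * (L + 1)) * (L + 1)"
    using L by (intro mult_right_mono) (auto simp: \<epsilon>_def)
  also have "\<dots> = 1/2" using L by simp
  finally have \<epsilon>L: "\<epsilon> * L \<le> 1/2" using \<epsilon> by (simp add: distrib_left)
  define I where "I = {-\<epsilon>..\<epsilon>}"
  define cl where "cl t = max (-\<epsilon>) (min \<epsilon> t)" for t :: real
  have cl_in: "cl t \<in> I" "\<bar>cl t\<bar> \<le> \<epsilon>" for t using \<epsilon> by (auto simp: cl_def I_def)
  have I0: "0 \<in> I" "convex I" using \<epsilon> by (auto simp: I_def)
  have intd: "((\<lambda>t. integral {-\<epsilon>..t} h) has_vector_derivative h s) (at s within I)"
    if "continuous_on UNIV h" "s \<in> I" for h :: "real \<Rightarrow> 'a" and s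
    unfolding I_def by (rule integral_has_vector_derivative)
      (use that in \<open>auto simp: I_def intro: continuous_on_subset\<close>)
  have "\<exists>u. u 0 = z \<and>
      (\<forall>t\<in>{-\<epsilon><..<\<epsilon>}. u t \<in> ball z0 \<rho> \<and> (u has_vector_derivative X (u t)) (at t))"
    if z: "z \<in> ball z0 (\<rho>/2)" for z
  proof -
    \<comment> \<open>The integrals start at -\<epsilon> and are subtracted, which gives the
      integral from 0 for both signs of t.\<close>
    define P where "P u t = z + (integral {-\<epsilon>..cl t} (\<lambda>s. Y (apply_bcontfun u s)) -
        integral {-\<epsilon>..0} (\<lambda>s. Y (apply_bcontfun u s)))" for u :: "real \<Rightarrow>\<^sub>C 'a" and t
    have Yu: "continuous_on UNIV (\<lambda>s. Y (apply_bcontfun u s))" for u :: "real \<Rightarrow>\<^sub>C 'a"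
      using continuous_on_compose2[OF Ycont continuous_on_apply_bcontfun] by simp
    have cont: "continuous_on UNIV (P u)" for u
    proof -
      have "continuous_on I (\<lambda>t. integral {-\<epsilon>..t} (\<lambda>s. Y (apply_bcontfun u s)))"
        by (rule continuous_on_vector_derivative[OF intd[OF Yu]])
      then have "continuous_on UNIV (\<lambda>t. integral {-\<epsilon>..cl t} (\<lambda>s. Y (apply_bcontfun u s)))"
        by (rule continuous_on_compose2) (use cl_in in \<open>auto simp: cl_def intro!: continuous_intros\<close>)
      then show ?thesis unfolding P_def by (intro continuous_intros)
    qed
    have bnd: "norm (P u t - z) \<le> B * \<epsilon>" for u t
    proof -
      have "norm (P u t - z) \<le> B * \<bar>cl t - 0\<bar>"
        unfolding P_def using vector_mvt_bound[OF I0(2) I0(1) cl_in(1) intd[OF Yu]] YB by simp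
      also have "\<dots> \<le> B * \<epsilon>" using cl_in(2)[of t] B0 by (intro mult_left_mono) auto
      finally show ?thesis .
    qed
    have bcf: "P u \<in> bcontfun" for u
    proof -
      have "norm (P u t) \<le> norm z + B * \<epsilon>" for t
        using bnd[of u t] norm_triangle_sub[of "P u t" z] by linarith
      then show ?thesis by (rule bcontfun_normI[OF cont])
    qed
    define T where "T u = Bcontfun (P u)" for u
    have T: "apply_bcontfun (T u) = P u" for u
      unfolding T_def by (rule Bcontfun_inverse[OF bcf])
    have "dist (T u) (T v) \<le> 1/2 * dist u v" for u v
    proof (rule dist_bound)
      fix t
      define h where "h s = Y (apply_bcontfun u s) - Y (apply_bcontfun v s)" for s
      have hc: "continuous_on UNIV h" unfolding h_def by (intro continuous_intros Yu)
      have hB: "norm (h s) \<le> L * dist u v" for s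
      proof -
        have "norm (h s) \<le> L * norm (apply_bcontfun u s - apply_bcontfun v s)"
          unfolding h_def by (rule YL)
        also have "\<dots> \<le> L * dist u v"
          using dist_bounded[of u s v] L by (intro mult_left_mono) (auto simp: dist_norm)
        finally show ?thesis .
      qed
      have ii: "(\<lambda>s. Y (apply_bcontfun w s)) integrable_on {-\<epsilon>..r}" for w :: "real \<Rightarrow>\<^sub>C 'a" and r
        by (intro integrable_continuous_interval continuous_on_subset[OF Yu]) auto
      have "P u t - P v t = integral {-\<epsilon>..cl t} h - integral {-\<epsilon>..0} h"
        unfolding P_def h_def by (simp add: integral_diff[OF ii ii])
      also have "norm \<dots> \<le> L * dist u v * \<bar>cl t - 0\<bar>"
        using vector_mvt_bound[OF I0(2) I0(1) cl_in(1) intd[OF hc]] hB by simp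
      also have "\<dots> \<le> L * dist u v * \<epsilon>"
        using cl_in(2)[of t] L by (intro mult_left_mono mult_nonneg_nonneg) auto
      also have "\<dots> \<le> 1/2 * dist u v"
        using mult_right_mono[OF \<epsilon>L, of "dist u v"] by (simp add: algebra_simps)
      finally show "dist (apply_bcontfun (T u) t) (apply_bcontfun (T v) t) \<le> 1/2 * dist u v"
        unfolding T by (simp add: dist_norm)
    qed
    then have "\<exists>!u. T u = u"
      by (intro banach_fix_type[of "1/2" T] allI) auto
    then obtain u where u: "T u = u" by blast
    have Pu: "apply_bcontfun u t = P u t" for t using T[of u] unfolding u by simp
    have uI: "apply_bcontfun u t = z + (integral {-\<epsilon>..t} (\<lambda>s. Y (apply_bcontfun u s)) -
        integral {-\<epsilon>..0} (\<lambda>s. Y (apply_bcontfun u s)))" if "t \<in> I" for t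
    proof -
      have "cl t = t" using that by (auto simp: cl_def I_def)
      then show ?thesis using Pu[of t] unfolding P_def by metis
    qed
    have in_ball: "apply_bcontfun u t \<in> ball z0 \<rho>" for t
    proof -
      have "dist z0 (apply_bcontfun u t) \<le> dist z0 z + norm (P u t - z)"
        using dist_triangle[of z0 "apply_bcontfun u t" z] by (simp add: dist_norm norm_minus_commute Pu[symmetric])
      then show ?thesis using z bnd[of u t] \<epsilon>B by (simp add: mult.commute)
    qed
    have "(apply_bcontfun u has_vector_derivative X (apply_bcontfun u t)) (at t)"
      if t: "t \<in> {-\<epsilon><..<\<epsilon>}" for t
    proof -
      have "((\<lambda>t. z + (integral {-\<epsilon>..t} (\<lambda>s. Y (apply_bcontfun u s)) -
        integral {-\<epsilon>..0} (\<lambda>s. Y (apply_bcontfun u s)))) has_vector_derivative Y (apply_bcontfun u t)) (at t within I)"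
        using intd[OF Yu[of u], of t] t by (auto simp: I_def intro!: derivative_eq_intros)
      then have "((\<lambda>t. z + (integral {-\<epsilon>..t} (\<lambda>s. Y (apply_bcontfun u s)) -
        integral {-\<epsilon>..0} (\<lambda>s. Y (apply_bcontfun u s)))) has_vector_derivative Y (apply_bcontfun u t)) (at t)"
        using at_within_interior[of t I] t by (simp add: I_def)
      then have "(apply_bcontfun u has_vector_derivative Y (apply_bcontfun u t)) (at t)"
        by (rule has_vector_derivative_transform_within_open[of _ _ _ "{-\<epsilon><..<\<epsilon>}"])
          (use t uI in \<open>auto simp: I_def\<close>)
      then show ?thesis using in_ball[of t] cp_id by (simp add: Y_def)
    qed
    moreover have "apply_bcontfun u 0 = z" using uI[OF I0(1)] by simp
    ultimately show ?thesis using in_ball by blast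
  qed
  with \<epsilon> show ?thesis using that by blast
qed

text \<open>The difference of two solutions satisfies \<open>short_time_bound\<close> with \<delta>
  = 0. For u t0 = v t0 this is uniqueness, the form in which curves are identified below.\<close>

lemma ode_dependence:
  fixes X :: "'a::real_normed_vector \<Rightarrow> 'a"
  assumes Lip: "\<And>a b. a \<in> B \<Longrightarrow> b \<in> B \<Longrightarrow> norm (X a - X b) \<le> L * norm (a - b)"
    and L: "0 \<le> L" "L * (b - a) \<le> 1/2" and t: "t0 \<in> {a..b}" "t \<in> {a..b}"
    and u: "\<And>s. s \<in> {a..b} \<Longrightarrow> u s \<in> B \<and> (u has_vector_derivative X (u s)) (at s within {a..b})"
    and v: "\<And>s. s \<in> {a..b} \<Longrightarrow> v s \<in> B \<and> (v has_vector_derivative X (v s)) (at s within {a..b})"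
  shows "norm (u t - v t) \<le> 2 * norm (u t0 - v t0)"
proof -
  have "norm (u t - v t) \<le> 2 * (norm (u t0 - v t0) + (b - a) * 0)"
  proof (rule short_time_bound[OF t _ _ L, where e' = "\<lambda>s. X (u s) - X (v s)"])
    show "((\<lambda>s. u s - v s) has_vector_derivative X (u s) - X (v s)) (at s within {a..b})"
      if "s \<in> {a..b}" for s
      using u[OF that] v[OF that] by (auto intro: has_vector_derivative_diff)
    show "norm (X (u s) - X (v s)) \<le> L * norm (u s - v s) + 0" if "s \<in> {a..b}" for s
      using u[OF that] v[OF that] Lip by auto
  qed
  then show ?thesis by simp
qed

section \<open>Local bounds for maps of class C^1 and C^2\<close>

lemma norm_linear_le_Basis:
  fixes D :: "'a::euclidean_space \<Rightarrow> 'b::real_normed_vector"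
  assumes "linear D" "\<And>i. i \<in> Basis \<Longrightarrow> norm (D i) \<le> B i"
  shows "norm (D h) \<le> (\<Sum>i\<in>Basis. B i) * norm h"
proof -
  have "D h = (\<Sum>i\<in>Basis. (h \<bullet> i) *\<^sub>R D i)"
    using linear_sum[OF assms(1)] linear_scale[OF assms(1)] euclidean_representation[of h]
    by (metis (no_types, lifting) sum.cong)
  also have "norm \<dots> \<le> (\<Sum>i\<in>Basis. norm h * B i)"
    using assms(2) by (intro sum_norm_le) (auto intro!: mult_mono Basis_le_norm)
  also have "\<dots> = (\<Sum>i\<in>Basis. B i) * norm h"
    by (subst sum_distrib_left[symmetric]) (rule mult.commute)
  finally show ?thesis .
qed

lemma Ck1_local_lipschitz:
  fixes X :: "'a::euclidean_space \<Rightarrow> 'b::euclidean_space"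
  assumes "open S" "Ck_on (Suc 0) X S" "z0 \<in> S"
  obtains \<rho> L where "\<rho> > 0" "L \<ge> 0" "cball z0 \<rho> \<subseteq> S"
    "\<And>a b. a \<in> cball z0 \<rho> \<Longrightarrow> b \<in> cball z0 \<rho> \<Longrightarrow> norm (X a - X b) \<le> L * norm (a - b)"
proof -
  obtain \<rho> where \<rho>: "\<rho> > 0" "cball z0 \<rho> \<subseteq> S"
    using assms open_contains_cball by blast
  let ?D = "\<lambda>x. frechet_derivative X (at x)"
  have "\<exists>B. \<forall>x\<in>cball z0 \<rho>. norm (?D x i) \<le> B" for i
  proof -
    have "continuous_on (cball z0 \<rho>) (\<lambda>x. ?D x i)"
      using assms(2) \<rho>(2) by (auto intro: continuous_on_subset)
    then have "compact ((\<lambda>x. ?D x i) ` cball z0 \<rho>)" by (intro compact_continuous_image) auto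
    then show ?thesis using compact_imp_bounded[of "(\<lambda>x. ?D x i) ` cball z0 \<rho>"]
      by (auto simp: bounded_iff)
  qed
  then obtain B where B: "\<And>i x. x \<in> cball z0 \<rho> \<Longrightarrow> norm (?D x i) \<le> B i" by metis
  have D: "(X has_derivative ?D x) (at x)" if "x \<in> cball z0 \<rho>" for x
    using Ck_on_SucD[OF assms(2)] \<rho>(2) that by auto
  let ?L = "\<Sum>i\<in>Basis. B i"
  have "norm (X a - X b) \<le> ?L * norm (a - b)" if "a \<in> cball z0 \<rho>" "b \<in> cball z0 \<rho>" for a b
  proof (rule differentiable_bound[OF convex_cball _ _ that, where f' = ?D])
    show "(X has_derivative ?D x) (at x within cball z0 \<rho>)" if "x \<in> cball z0 \<rho>" for x
      using D[OF that] has_derivative_at_withinI by blast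
    show "onorm (?D x) \<le> ?L" if "x \<in> cball z0 \<rho>" for x
      by (rule onorm_le, rule norm_linear_le_Basis)
        (use D[OF that] B[OF that] has_derivative_linear in auto)
  qed
  moreover have "?L \<ge> 0"
    using B[of z0] \<rho> by (intro sum_nonneg) (meson centre_in_cball less_imp_le norm_ge_zero order_trans)
  ultimately show ?thesis using that \<rho> by blast
qed

text \<open>Each directional derivative along a basis vector is of class C^1, hence locally
  Lipschitz. Summation over the basis makes the full derivative Lipschitz, and linearization along
  segments then gives the quadratic remainder.\<close>

lemma Ck2_local_bounds:
  fixes X :: "'a::euclidean_space \<Rightarrow> 'b::euclidean_space"
  assumes S: "open S" "Ck_on (Suc (Suc 0)) X S" "z0 \<in> S"
  obtains \<rho> L M where "\<rho> > 0" "L \<ge> 0" "M \<ge> 0" "cball z0 \<rho> \<subseteq> S"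
    "\<And>a b. a \<in> cball z0 \<rho> \<Longrightarrow> b \<in> cball z0 \<rho> \<Longrightarrow> norm (X a - X b) \<le> L * norm (a - b)"
    "\<And>a b. a \<in> cball z0 \<rho> \<Longrightarrow> b \<in> cball z0 \<rho> \<Longrightarrow>
      norm (X b - X a - frechet_derivative X (at a) (b - a)) \<le> M * (norm (b - a))\<^sup>2"
    "\<And>a h. a \<in> cball z0 \<rho> \<Longrightarrow> norm (frechet_derivative X (at a) h) \<le> L * norm h"
proof -
  let ?D = "\<lambda>x. frechet_derivative X (at x)"
  have C1: "Ck_on (Suc 0) X S" using S(2) by (rule Ck_on_Suc_imp)
  obtain \<rho>0 L0 where 0: "\<rho>0 > 0" "L0 \<ge> 0" "cball z0 \<rho>0 \<subseteq> S"
    "\<And>a b. a \<in> cball z0 \<rho>0 \<Longrightarrow> b \<in> cball z0 \<rho>0 \<Longrightarrow> norm (X a - X b) \<le> L0 * norm (a - b)"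
    using Ck1_local_lipschitz[OF S(1) C1 S(3)] by blast
  have "\<exists>\<rho> L. \<rho> > 0 \<and> L \<ge> 0 \<and> (\<forall>a\<in>cball z0 \<rho>. \<forall>b\<in>cball z0 \<rho>. norm (?D a i - ?D b i) \<le> L * norm (a - b))" for i
  proof -
    have "Ck_on (Suc 0) (\<lambda>x. ?D x i) S" using S(2) by (metis Ck_on.simps(2))
    from Ck1_local_lipschitz[OF S(1) this S(3)] show ?thesis by metis
  qed
  then obtain r K where rK: "\<And>i. r i > 0" "\<And>i. K i \<ge> 0"
    "\<And>i a b. a \<in> cball z0 (r i) \<Longrightarrow> b \<in> cball z0 (r i) \<Longrightarrow> norm (?D a i - ?D b i) \<le> K i * norm (a - b)"
    by metis
  define \<rho> where "\<rho> = Min (insert \<rho>0 (r ` Basis))"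
  have \<rho>: "\<rho> > 0" "\<rho> \<le> \<rho>0" "\<And>i. i \<in> Basis \<Longrightarrow> \<rho> \<le> r i"
    unfolding \<rho>_def using 0(1) rK(1) by (auto simp del: Min_insert)
  define M where "M = (\<Sum>i\<in>Basis. K i)"
  have M: "M \<ge> 0" unfolding M_def using rK(2) by (intro sum_nonneg) auto
  have D: "(X has_derivative ?D x) (at x)" if "x \<in> cball z0 \<rho>" for x
    using Ck_on_SucD[OF C1, of x] 0(3) \<rho>(2) that by (auto simp: subset_iff)
  have DM: "norm (?D a h - ?D b h) \<le> (M * norm (a - b)) * norm h"
    if ab: "a \<in> cball z0 \<rho>" "b \<in> cball z0 \<rho>" for a b h
  proof -
    have "norm ((\<lambda>h. ?D a h - ?D b h) h) \<le> (\<Sum>i\<in>Basis. K i * norm (a - b)) * norm h"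
      using D[OF ab(1)] D[OF ab(2)] rK(3) ab \<rho>(3)
      by (intro norm_linear_le_Basis linear_compose_sub has_derivative_linear) fastforce+
    then show ?thesis by (simp add: M_def sum_distrib_right)
  qed
  have rem: "norm (X b - X a - ?D a (b - a)) \<le> M * (norm (b - a))\<^sup>2"
    if ab: "a \<in> cball z0 \<rho>" "b \<in> cball z0 \<rho>" for a b
  proof -
    have seg: "closed_segment a b \<subseteq> cball z0 \<rho>"
      using ab by (intro closed_segment_subset) auto
    have "norm (X b - X a - ?D a (b - a)) \<le> norm (b - a) * (M * norm (b - a))"
    proof (rule differentiable_bound_linearization[where S = "closed_segment a b"])
      show "a + t *\<^sub>R (b - a) \<in> closed_segment a b" if "t \<in> {0..1}" for t
        using that by (auto simp: in_segment algebra_simps)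
      show "(X has_derivative ?D x) (at x within closed_segment a b)" if "x \<in> closed_segment a b" for x
        using D seg that has_derivative_at_withinI by blast
      show "onorm (?D x - ?D a) \<le> M * norm (b - a)" if x: "x \<in> closed_segment a b" for x
      proof (rule onorm_le)
        fix h
        have "norm ((?D x - ?D a) h) \<le> (M * norm (x - a)) * norm h"
          using DM[of x a h] seg x ab by (auto simp: fun_diff_def)
        also have "\<dots> \<le> (M * norm (b - a)) * norm h"
          using segment_bound(1)[OF x] M by (intro mult_right_mono mult_left_mono) auto
        finally show "norm ((?D x - ?D a) h) \<le> M * norm (b - a) * norm h" .
      qed
    qed auto
    then show ?thesis by (simp add: power2_eq_square algebra_simps)
  qed
  define L where "L = max L0 ((\<Sum>i\<in>Basis. norm (?D z0 i)) + M * \<rho>)"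
  have DL: "norm (?D a h) \<le> L * norm h" if a: "a \<in> cball z0 \<rho>" for a h
  proof -
    have z0: "z0 \<in> cball z0 \<rho>" using \<rho> by simp
    have "norm (?D a h) \<le> norm (?D z0 h) + norm (?D a h - ?D z0 h)"
      using norm_triangle_sub by blast
    also have "\<dots> \<le> (\<Sum>i\<in>Basis. norm (?D z0 i)) * norm h + (M * norm (a - z0)) * norm h"
      using DM[OF a z0] D[OF z0] has_derivative_linear
      by (intro add_mono norm_linear_le_Basis) auto
    also have "\<dots> \<le> (\<Sum>i\<in>Basis. norm (?D z0 i)) * norm h + (M * \<rho>) * norm h"
      using a M by (intro add_left_mono mult_right_mono mult_left_mono) (auto simp: dist_norm norm_minus_commute)
    also have "\<dots> \<le> L * norm h"
      unfolding L_def distrib_right[symmetric] by (intro mult_right_mono) auto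
    finally show ?thesis .
  qed
  have Lip: "norm (X a - X b) \<le> L * norm (a - b)"
    if "a \<in> cball z0 \<rho>" "b \<in> cball z0 \<rho>" for a b
  proof -
    have "norm (X a - X b) \<le> L0 * norm (a - b)" using 0(4) that \<rho>(2) by auto
    also have "\<dots> \<le> L * norm (a - b)" unfolding L_def by (intro mult_right_mono) auto
    finally show ?thesis .
  qed
  have "L \<ge> 0" using 0(2) by (simp add: L_def)
  moreover have "cball z0 \<rho> \<subseteq> S" using 0(3) \<rho>(2) by auto
  ultimately show ?thesis using that[OF \<rho>(1) _ M _ Lip rem DL] by blast
qed

text \<open>Differentiability of the flow in its initial value. The columns Y b of the derivative
  arise by solving the flow together with its linearization as one equation on the doubled space.
  The difference quotient is compared with them by \<open>short_time_bound\<close>, whose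
  inhomogeneity is of order h^2 by the Taylor remainder of X.\<close>

lemma flow_variation:
  fixes X :: "'a::euclidean_space \<Rightarrow> 'a"
  assumes S: "open S" "Ck_on (Suc (Suc 0)) X S" "z0 \<in> S"
  obtains \<epsilon> \<delta> \<rho> L u Y where "\<epsilon> > 0" "\<delta> > 0" "\<rho> > 0" "L \<ge> 0" "L * (2 * \<epsilon>) \<le> 1/2" "ball z0 \<rho> \<subseteq> S"
    "\<And>a b. a \<in> ball z0 \<rho> \<Longrightarrow> b \<in> ball z0 \<rho> \<Longrightarrow> norm (X a - X b) \<le> L * norm (a - b)"
    "\<And>z. z \<in> ball z0 \<delta> \<Longrightarrow> u z 0 = z"
    "\<And>z t. z \<in> ball z0 \<delta> \<Longrightarrow> \<bar>t\<bar> < \<epsilon> \<Longrightarrow> u z t \<in> ball z0 \<rho>"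
    "\<And>z t. z \<in> ball z0 \<delta> \<Longrightarrow> \<bar>t\<bar> < \<epsilon> \<Longrightarrow> (u z has_vector_derivative X (u z t)) (at t)"
    "\<And>b. b \<in> Basis \<Longrightarrow> Y b 0 = b"
    "\<And>b t. b \<in> Basis \<Longrightarrow> \<bar>t\<bar> < \<epsilon> \<Longrightarrow>
      (Y b has_vector_derivative frechet_derivative X (at (u z0 t)) (Y b t)) (at t)"
    "\<And>k t. \<bar>t\<bar> < \<epsilon> \<Longrightarrow>
      ((\<lambda>h. u (z0 + h *\<^sub>R k) t) has_vector_derivative (\<Sum>b\<in>Basis. (k \<bullet> b) *\<^sub>R Y b t)) (at 0)"
proof -
  let ?D = "\<lambda>x. frechet_derivative X (at x)"
  obtain \<rho> L M where b: "\<rho> > 0" "L \<ge> 0" "M \<ge> 0" "cball z0 \<rho> \<subseteq> S"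
    and Lip: "\<And>a b. a \<in> cball z0 \<rho> \<Longrightarrow> b \<in> cball z0 \<rho> \<Longrightarrow> norm (X a - X b) \<le> L * norm (a - b)"
    and rem: "\<And>a b. a \<in> cball z0 \<rho> \<Longrightarrow> b \<in> cball z0 \<rho> \<Longrightarrow> norm (X b - X a - ?D a (b - a)) \<le> M * (norm (b - a))\<^sup>2"
    and DL: "\<And>a h. a \<in> cball z0 \<rho> \<Longrightarrow> norm (?D a h) \<le> L * norm h"
    using Ck2_local_bounds[OF S] by blast
  have D: "(X has_derivative ?D x) (at x)" if "x \<in> S" for x
    using Ck_on_SucD[OF S(2) that] .
  have lin: "linear (?D x)" if "x \<in> S" for x using has_derivative_linear[OF D[OF that]] .
  obtain \<epsilon>1 where \<epsilon>1: "\<epsilon>1 > 0" "\<And>z. z \<in> ball z0 (\<rho>/2) \<Longrightarrow> \<exists>u. u 0 = z \<and>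
      (\<forall>t\<in>{-\<epsilon>1<..<\<epsilon>1}. u t \<in> ball z0 \<rho> \<and> (u has_vector_derivative X (u t)) (at t))"
    using picard_local[OF b(1,2) Lip] by blast
  then obtain u where u: "\<And>z. z \<in> ball z0 (\<rho>/2) \<Longrightarrow> u z 0 = z"
    "\<And>z t. z \<in> ball z0 (\<rho>/2) \<Longrightarrow> \<bar>t\<bar> < \<epsilon>1 \<Longrightarrow> u z t \<in> ball z0 \<rho> \<and> (u z has_vector_derivative X (u z t)) (at t)"
    by (metis abs_less_iff greaterThanLessThan_iff minus_less_iff)
  define \<epsilon>2 where "\<epsilon>2 = min \<epsilon>1 (1 / (4 * (L + 1)))"
  have \<epsilon>2: "\<epsilon>2 > 0" "\<epsilon>2 \<le> \<epsilon>1" using \<epsilon>1 b(2) by (auto simp: \<epsilon>2_def)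
  have \<epsilon>2L: "L * (2 * e) \<le> 1/2" if "e \<le> \<epsilon>2" "0 < e" for e
  proof -
    have "e * (L + 1) \<le> 1 / (4 * (L + 1)) * (L + 1)"
      using b(2) that by (intro mult_right_mono) (auto simp: \<epsilon>2_def)
    also have "\<dots> = 1/4" using b(2) by simp
    finally show ?thesis using that by (simp add: algebra_simps)
  qed
  \<comment> \<open>The second component is DX(x) y, expanded in the basis because regularity of DX
    is available for fixed directions.\<close>
  define W where "W = (\<lambda>p. (X (fst p), \<Sum>i\<in>Basis. (snd p \<bullet> i) *\<^sub>R ?D (fst p) i))"
  define S2 where "S2 = S \<times> (UNIV :: 'a set)"
  have oS2: "open S2" unfolding S2_def using S(1) by (simp add: open_Times)
  have W: "Ck_on (Suc 0) W S2"
    unfolding W_def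
  proof (intro Ck_on_Pair Ck_on_sum Ck_on_scaleR oS2)
    show "Ck_on (Suc 0) (\<lambda>p. X (fst p)) S2"
      by (rule Ck_on_compose_linear[OF S(1) Ck_on_Suc_imp[OF S(2)] bounded_linear_fst oS2])
        (auto simp: S2_def)
    show "Ck_on (Suc 0) (\<lambda>p. snd p \<bullet> i) S2" for i
      by (intro Ck_on_linear oS2 bounded_linear_intros)
    show "Ck_on (Suc 0) (\<lambda>p. ?D (fst p) i) S2" for i
      by (rule Ck_on_compose_linear[OF S(1) _ bounded_linear_fst oS2, of "Suc 0" "\<lambda>x. ?D x i"])
        (use S(2) in \<open>auto simp: S2_def\<close>)
  qed
  have "\<exists>e y. 0 < e \<and> e \<le> \<epsilon>2 \<and> y 0 = b \<and>
      (\<forall>t. \<bar>t\<bar> < e \<longrightarrow> (y has_vector_derivative ?D (u z0 t) (y t)) (at t))" for b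
  proof -
    obtain r K where rK: "r > 0" "K \<ge> 0"
      "\<And>p q. p \<in> cball (z0, b) r \<Longrightarrow> q \<in> cball (z0, b) r \<Longrightarrow> norm (W p - W q) \<le> K * norm (p - q)"
      by (rule Ck1_local_lipschitz[OF oS2 W, of "(z0, b)"]) (use S(3) in \<open>auto simp: S2_def\<close>)
    define r' where "r' = min r \<rho>"
    have r': "r' > 0" "\<And>p q. p \<in> cball (z0, b) r' \<Longrightarrow> q \<in> cball (z0, b) r' \<Longrightarrow> norm (W p - W q) \<le> K * norm (p - q)"
      using rK(1,3) b(1) by (auto simp: r'_def)
    obtain e1 where e1: "e1 > 0" "\<And>z. z \<in> ball (z0, b) (r'/2) \<Longrightarrow> \<exists>w. w 0 = z \<and>
        (\<forall>t\<in>{-e1<..<e1}. w t \<in> ball (z0, b) r' \<and> (w has_vector_derivative W (w t)) (at t))"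
      using picard_local[OF r'(1) rK(2) r'(2)] by blast
    obtain w where w: "w 0 = (z0, b)"
      "\<And>t. \<bar>t\<bar> < e1 \<Longrightarrow> w t \<in> ball (z0, b) r' \<and> (w has_vector_derivative W (w t)) (at t)"
      using e1(2)[of "(z0, b)"] r'(1) by (auto simp: abs_less_iff)
    define e where "e = min e1 \<epsilon>2"
    have e: "0 < e" "e \<le> \<epsilon>2" "e \<le> e1" using e1(1) \<epsilon>2 by (auto simp: e_def)
    have fstw: "((\<lambda>t. fst (w t)) has_vector_derivative X (fst (w t))) (at t)"
      and sndw: "((\<lambda>t. snd (w t)) has_vector_derivative (\<Sum>i\<in>Basis. (snd (w t) \<bullet> i) *\<^sub>R ?D (fst (w t)) i)) (at t)"
      and win: "fst (w t) \<in> ball z0 \<rho>" if "\<bar>t\<bar> < e" for t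
    proof -
      have wt: "w t \<in> ball (z0, b) r'" "(w has_vector_derivative W (w t)) (at t)"
        using w(2) that e(3) by auto
      show "((\<lambda>t. fst (w t)) has_vector_derivative X (fst (w t))) (at t)"
        using bounded_linear.has_vector_derivative[OF bounded_linear_fst wt(2)] by (simp add: W_def)
      show "((\<lambda>t. snd (w t)) has_vector_derivative (\<Sum>i\<in>Basis. (snd (w t) \<bullet> i) *\<^sub>R ?D (fst (w t)) i)) (at t)"
        using bounded_linear.has_vector_derivative[OF bounded_linear_snd wt(2)] by (simp add: W_def)
      have "dist z0 (fst (w t)) \<le> dist (z0, b) (w t)"
        by (metis dist_fst_le fst_conv)
      then show "fst (w t) \<in> ball z0 \<rho>" using wt(1) by (auto simp: r'_def)
    qed
    \<comment> \<open>The first component solves the original equation, so by uniqueness it is the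
      flow line of z0; this identifies the equation of the second component as the linearization
      along that line.\<close>
    have eq: "fst (w t) = u z0 t" if t: "\<bar>t\<bar> < e" for t
    proof -
      let ?a = "- \<bar>t\<bar>" and ?b = "\<bar>t\<bar>"
      have "norm (fst (w t) - u z0 t) \<le> 2 * norm (fst (w 0) - u z0 0)"
      proof (rule ode_dependence[where B = "cball z0 \<rho>" and X = X and L = L and a = "?a" and b = "?b"])
        show "L * (\<bar>t\<bar> - - \<bar>t\<bar>) \<le> 1 / 2"
          using \<epsilon>2L[of e] e t mult_left_mono[of "2 * \<bar>t\<bar>" "2 * e" L] b(2) by simp
        show "fst (w s) \<in> cball z0 \<rho> \<and> ((\<lambda>t. fst (w t)) has_vector_derivative X (fst (w s))) (at s within {?a..?b})"
          if "s \<in> {?a..?b}" for s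
        proof -
          have "\<bar>s\<bar> < e" using that t by auto
          then show ?thesis using win[of s] fstw[of s] has_vector_derivative_at_within by (auto simp: less_imp_le)
        qed
        show "u z0 s \<in> cball z0 \<rho> \<and> (u z0 has_vector_derivative X (u z0 s)) (at s within {?a..?b})"
          if "s \<in> {?a..?b}" for s
        proof -
          have "\<bar>s\<bar> < \<epsilon>1" using that t e \<epsilon>2 by auto
          then show ?thesis using u(2)[of z0 s] b(1) has_vector_derivative_at_within by (auto simp: less_imp_le)
        qed
      qed (use Lip b in auto)
      then show ?thesis using u(1)[of z0] b(1) w(1) by simp
    qed
    have "((\<lambda>t. snd (w t)) has_vector_derivative ?D (u z0 t) (snd (w t))) (at t)" if t: "\<bar>t\<bar> < e" for t
    proof -
      have "u z0 t \<in> S" using win[OF t] b(4) eq[OF t] by auto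
      then have "?D (u z0 t) (\<Sum>i\<in>Basis. (snd (w t) \<bullet> i) *\<^sub>R i) = (\<Sum>i\<in>Basis. (snd (w t) \<bullet> i) *\<^sub>R ?D (u z0 t) i)"
        by (simp add: linear_sum[OF lin] linear_scale[OF lin])
      then have "?D (u z0 t) (snd (w t)) = (\<Sum>i\<in>Basis. (snd (w t) \<bullet> i) *\<^sub>R ?D (u z0 t) i)"
        by (simp add: euclidean_representation)
      then show ?thesis using sndw[OF t] eq[OF t] by simp
    qed
    then show ?thesis using e w(1)
      by (intro exI[of _ e] exI[of _ "\<lambda>t. snd (w t)"]) auto
  qed
  then obtain e Y where eY: "\<And>b. 0 < e b" "\<And>b. e b \<le> \<epsilon>2" "\<And>b. Y b 0 = b"
    "\<And>b t. \<bar>t\<bar> < e b \<Longrightarrow> (Y b has_vector_derivative ?D (u z0 t) (Y b t)) (at t)"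
    by metis
  \<comment> \<open>A common time interval for the finitely many basis vectors.\<close>
  define \<epsilon> where "\<epsilon> = Min (insert \<epsilon>2 (e ` Basis))"
  have \<epsilon>: "\<epsilon> > 0" "\<epsilon> \<le> \<epsilon>2" "\<And>b. b \<in> Basis \<Longrightarrow> \<epsilon> \<le> e b"
    unfolding \<epsilon>_def using \<epsilon>2 eY(1) by (auto simp del: Min_insert)
  define \<delta> where "\<delta> = \<rho>/2"
  have \<delta>: "\<delta> > 0" using b(1) by (simp add: \<delta>_def)
  have uu: "u z t \<in> ball z0 \<rho>" "(u z has_vector_derivative X (u z t)) (at t)"
    if "z \<in> ball z0 \<delta>" "\<bar>t\<bar> < \<epsilon>" for z t
    using u(2)[of z t] that \<epsilon> \<epsilon>2 by (auto simp: \<delta>_def)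
  have var: "((\<lambda>h. u (z0 + h *\<^sub>R k) t) has_vector_derivative (\<Sum>b\<in>Basis. (k \<bullet> b) *\<^sub>R Y b t)) (at 0)"
    if t: "\<bar>t\<bar> < \<epsilon>" for k t
  proof -
    define y where "y s = (\<Sum>b\<in>Basis. (k \<bullet> b) *\<^sub>R Y b s)" for s
    have y0: "y 0 = k" by (simp add: y_def eY(3) euclidean_representation)
    have y': "(y has_vector_derivative ?D (u z0 s) (y s)) (at s)" if s: "\<bar>s\<bar> < \<epsilon>" for s
    proof -
      have "u z0 s \<in> S" using uu(1)[of z0 s] s b(4) \<delta> by auto
      then have "?D (u z0 s) (y s) = (\<Sum>b\<in>Basis. (k \<bullet> b) *\<^sub>R ?D (u z0 s) (Y b s))"
        unfolding y_def by (simp add: linear_sum[OF lin] linear_scale[OF lin])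
      moreover have "(y has_vector_derivative (\<Sum>b\<in>Basis. (k \<bullet> b) *\<^sub>R ?D (u z0 s) (Y b s))) (at s)"
        unfolding y_def
      proof (rule has_vector_derivative_sum)
        show "((\<lambda>s. (k \<bullet> b) *\<^sub>R Y b s) has_vector_derivative (k \<bullet> b) *\<^sub>R ?D (u z0 s) (Y b s)) (at s)"
          if "b \<in> Basis" for b
          using eY(4)[of s b] \<epsilon>(3)[OF that] s
          by (intro bounded_linear.has_vector_derivative[OF bounded_linear_scaleR_right]) auto
      qed
      ultimately show ?thesis by simp
    qed
    \<comment> \<open>The factor 2 and the length 2 |t| of the interval come from
      \<open>short_time_bound\<close>; the rest is the Taylor remainder M (2 |h| |k|)^2 divided by
      h^2.\<close>
    define C where "C = 2 * (\<bar>t\<bar> + \<bar>t\<bar>) * (M * 4 * (norm k)\<^sup>2)"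
    have key: "norm (u (z0 + h *\<^sub>R k) t - u z0 t - h *\<^sub>R y t) \<le> C * h\<^sup>2"
      if h: "\<bar>h\<bar> * norm k < \<delta>" for h
    proof -
      define z where "z = z0 + h *\<^sub>R k"
      have z: "z \<in> ball z0 \<delta>" "z0 \<in> ball z0 \<delta>" using h \<delta> by (auto simp: z_def dist_norm)
      let ?a = "- \<bar>t\<bar>" and ?b = "\<bar>t\<bar>"
      have Lt: "L * (?b - ?a) \<le> 1/2"
        using \<epsilon>2L[of \<epsilon>] \<epsilon> t mult_left_mono[of "2 * \<bar>t\<bar>" "2 * \<epsilon>" L] b(2) by simp
      have ab: "\<bar>s\<bar> < \<epsilon>" if "s \<in> {?a..?b}" for s using that t by auto
      have 1: "norm (u z s - u z0 s) \<le> 2 * (\<bar>h\<bar> * norm k)" if s: "s \<in> {?a..?b}" for s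
      proof -
        have "norm (u z s - u z0 s) \<le> 2 * norm (u z 0 - u z0 0)"
        proof (rule ode_dependence[where B = "cball z0 \<rho>" and X = X and L = L, OF Lip b(2) Lt _ s])
          have "u w r \<in> cball z0 \<rho> \<and> (u w has_vector_derivative X (u w r)) (at r within {?a..?b})"
            if "w \<in> ball z0 \<delta>" "r \<in> {?a..?b}" for w r
            using uu[OF that(1) ab[OF that(2)]] by (simp add: less_imp_le has_vector_derivative_at_within)
          then show "u z0 r \<in> cball z0 \<rho> \<and> (u z0 has_vector_derivative X (u z0 r)) (at r within {?a..?b})"
            "u z r \<in> cball z0 \<rho> \<and> (u z has_vector_derivative X (u z r)) (at r within {?a..?b})"
            if "r \<in> {?a..?b}" for r
            using that z by blast+
        qed auto
        also have "\<dots> = 2 * (\<bar>h\<bar> * norm k)" using u(1) z by (simp add: \<delta>_def[symmetric] z_def)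
        finally show ?thesis .
      qed
      let ?e = "\<lambda>s. u z s - u z0 s - h *\<^sub>R y s"
      have "norm (?e t) \<le> 2 * (norm (?e 0) + (?b - ?a) * (M * (2 * (\<bar>h\<bar> * norm k))\<^sup>2))"
      proof (rule short_time_bound[OF _ _ _ _ b(2) Lt,
          where e' = "\<lambda>s. X (u z s) - X (u z0 s) - h *\<^sub>R ?D (u z0 s) (y s)"])
        fix s assume s: "s \<in> {?a..?b}"
        show "(?e has_vector_derivative X (u z s) - X (u z0 s) - h *\<^sub>R ?D (u z0 s) (y s)) (at s within {?a..?b})"
          by (rule has_vector_derivative_at_within)
            (intro has_vector_derivative_diff uu(2) z ab[OF s]
              bounded_linear.has_vector_derivative[OF bounded_linear_scaleR_right] y')
        have in0: "u z0 s \<in> cball z0 \<rho>" "u z s \<in> cball z0 \<rho>"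
          using uu(1)[OF z(2) ab[OF s]] uu(1)[OF z(1) ab[OF s]] by auto
        have l: "linear (?D (u z0 s))" using lin in0 b(4) by auto
        \<comment> \<open>Taylor remainder of X at \<open>u z0 s\<close> plus the linearization
          applied to the error itself, the form that \<open>short_time_bound\<close> asks
          for.\<close>
        have "X (u z s) - X (u z0 s) - h *\<^sub>R ?D (u z0 s) (y s)
          = (X (u z s) - X (u z0 s) - ?D (u z0 s) (u z s - u z0 s)) + ?D (u z0 s) (?e s)"
          by (simp add: linear_diff[OF l] linear_scale[OF l])
        also have "norm \<dots> \<le> M * (norm (u z s - u z0 s))\<^sup>2 + L * norm (?e s)"
          by (intro norm_triangle_le add_mono rem DL in0)
        also have "\<dots> \<le> M * (2 * (\<bar>h\<bar> * norm k))\<^sup>2 + L * norm (?e s)"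
          by (intro add_right_mono mult_left_mono power_mono 1 s b) auto
        finally show "norm (X (u z s) - X (u z0 s) - h *\<^sub>R ?D (u z0 s) (y s))
          \<le> L * norm (?e s) + M * (2 * (\<bar>h\<bar> * norm k))\<^sup>2" by simp
      qed (use t in auto)
      also have "?e 0 = 0" using u(1) z by (simp add: \<delta>_def[symmetric] z_def y0)
      finally show ?thesis unfolding z_def C_def by (simp add: power2_eq_square algebra_simps)
    qed
    have "((\<lambda>h. u (z0 + h *\<^sub>R k) t) has_derivative (\<lambda>h. h *\<^sub>R y t)) (at 0)"
      unfolding has_derivative_iff_norm
    proof (intro conjI bounded_linear_scaleR_left)
      have ev: "\<forall>\<^sub>F h in at 0. norm (norm (u (z0 + h *\<^sub>R k) t - u (z0 + 0 *\<^sub>R k) t - (h - 0) *\<^sub>R y t) / norm (h - 0))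
        \<le> \<bar>C\<bar> * \<bar>h\<bar>"
      proof -
        have "((\<lambda>h. \<bar>h\<bar> * norm k) \<longlongrightarrow> 0) (at 0)" by (auto intro!: tendsto_eq_intros)
        then have "\<forall>\<^sub>F h in at 0. \<bar>h\<bar> * norm k < \<delta>" using \<delta> by (rule order_tendstoD)
        then show ?thesis
        proof (rule eventually_mono)
          fix h assume "\<bar>h\<bar> * norm k < \<delta>"
          from key[OF this] have "norm (u (z0 + h *\<^sub>R k) t - u z0 t - h *\<^sub>R y t) \<le> \<bar>C\<bar> * \<bar>h\<bar> * \<bar>h\<bar>"
            using mult_right_mono[OF abs_ge_self[of C], of "h\<^sup>2"] by (simp add: power2_eq_square mult.assoc)
          then show "norm (norm (u (z0 + h *\<^sub>R k) t - u (z0 + 0 *\<^sub>R k) t - (h - 0) *\<^sub>R y t) / norm (h - 0))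
            \<le> \<bar>C\<bar> * \<bar>h\<bar>"
            by (cases "h = 0") (auto simp: divide_le_eq)
        qed
      qed
      show "((\<lambda>h. norm (u (z0 + h *\<^sub>R k) t - u (z0 + 0 *\<^sub>R k) t - (h - 0) *\<^sub>R y t) / norm (h - 0)) \<longlongrightarrow> 0) (at 0)"
        by (rule Lim_null_comparison[OF ev]) (auto intro!: tendsto_eq_intros)
    qed
    then show ?thesis by (simp add: has_vector_derivative_def y_def)
  qed
  show ?thesis
  proof (rule that[OF \<epsilon>(1) \<delta> b(1,2) \<epsilon>2L[OF \<epsilon>(2,1)], of u Y])
    show "ball z0 \<rho> \<subseteq> S" using b(4) ball_subset_cball by blast
    show "norm (X a - X b) \<le> L * norm (a - b)" if "a \<in> ball z0 \<rho>" "b \<in> ball z0 \<rho>" for a b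
      using Lip that by auto
    show "u z 0 = z" if "z \<in> ball z0 \<delta>" for z using u(1) that by (simp add: \<delta>_def)
    show "(Y b has_vector_derivative ?D (u z0 t) (Y b t)) (at t)" if "b \<in> Basis" "\<bar>t\<bar> < \<epsilon>" for b t
      using eY(4)[of t b] \<epsilon>(3)[OF that(1)] that(2) by simp
  qed (use uu eY(3) var in auto)
qed

section \<open>Peano expansions\<close>

text \<open>The expansion f r = a 0 + ... + a k r^k + o(r^k) for r tending to 0 from the right; the
  value of f at 0 does not enter.\<close>

definition peano :: "nat \<Rightarrow> (nat \<Rightarrow> real) \<Rightarrow> (real \<Rightarrow> real) \<Rightarrow> bool" where
  "peano k a f \<longleftrightarrow> ((\<lambda>r. (f r - (\<Sum>j\<le>k. a j * r ^ j)) / r ^ k) \<longlongrightarrow> 0) (at_right 0)"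

lemma peano_cong:
  assumes "peano k a f" "eventually (\<lambda>r. f r = g r) (at_right 0)" "\<And>j. j \<le> k \<Longrightarrow> a j = b j"
  shows "peano k b g"
proof -
  have "(\<Sum>j\<le>k. a j * r ^ j) = (\<Sum>j\<le>k. b j * r ^ j)" for r using assms(3) by simp
  moreover have ev: "eventually (\<lambda>r. (f r - (\<Sum>j\<le>k. a j * r ^ j)) / r ^ k = (g r - (\<Sum>j\<le>k. a j * r ^ j)) / r ^ k) (at_right 0)"
    using assms(2) by eventually_elim simp
  ultimately show ?thesis using assms(1) tendsto_cong[OF ev, of 0] unfolding peano_def by simp
qed

lemma peano_0: "peano 0 a f \<longleftrightarrow> (f \<longlongrightarrow> a 0) (at_right 0)"
  unfolding peano_def by (simp add: LIM_zero_iff)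

lemma peano_Suc_imp:
  assumes "peano (Suc k) a f" shows "peano k a f"
proof -
  have "((\<lambda>r. (f r - (\<Sum>j\<le>Suc k. a j * r ^ j)) / r ^ Suc k * r + a (Suc k) * r) \<longlongrightarrow> 0 * 0 + a (Suc k) * 0) (at_right 0)"
    using assms unfolding peano_def by (intro tendsto_intros)
  moreover have "eventually (\<lambda>r. (f r - (\<Sum>j\<le>Suc k. a j * r ^ j)) / r ^ Suc k * r + a (Suc k) * r
      = (f r - (\<Sum>j\<le>k. a j * r ^ j)) / r ^ k) (at_right 0)"
  proof -
    have *: "(x - (s + c * r ^ Suc k)) / r ^ Suc k * r + c * r = (x - s) / r ^ k" if "r > 0" for x s c r :: real
      using that by (simp add: field_simps)
    show ?thesis using eventually_at_right_less[of "0::real"]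
      by eventually_elim (simp only: sum.atMost_Suc *)
  qed
  ultimately show ?thesis unfolding peano_def using tendsto_cong by fastforce
qed

lemma peano_le: "j \<le> k \<Longrightarrow> peano k a f \<Longrightarrow> peano j a f"
  by (induction rule: dec_induct) (use peano_Suc_imp in blast)+

text \<open>Truncated at order j both lists are still expansions. With the lower coefficients equal
  by strong induction, the difference of the two quotients is the constant a j - b j, which has to
  tend to 0.\<close>

lemma peano_unique:
  assumes "peano k a f" "peano k b f" "j \<le> k"
  shows "a j = b j"
  using assms(3)
proof (induction j rule: less_induct)
  case (less j)
  have 1: "peano j a f" "peano j b f" using peano_le less.prems assms by blast+
  have "((\<lambda>r. (f r - (\<Sum>i\<le>j. b i * r ^ i)) / r ^ j - (f r - (\<Sum>i\<le>j. a i * r ^ i)) / r ^ j) \<longlongrightarrow> 0 - 0) (at_right 0)"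
    using 1 unfolding peano_def by (intro tendsto_diff)
  moreover have "eventually (\<lambda>r. (f r - (\<Sum>i\<le>j. b i * r ^ i)) / r ^ j - (f r - (\<Sum>i\<le>j. a i * r ^ i)) / r ^ j
      = a j - b j) (at_right 0)"
    using eventually_at_right_less[of 0]
  proof eventually_elim
    case (elim r)
    have "(\<Sum>i<j. a i * r ^ i) = (\<Sum>i<j. b i * r ^ i)"
      using less by (intro sum.cong) auto
    then show ?case using elim by (simp add: lessThan_Suc_atMost[symmetric] divide_simps) (simp add: algebra_simps)
  qed
  ultimately have "((\<lambda>r::real. a j - b j) \<longlongrightarrow> 0) (at_right 0)" using tendsto_cong by fastforce
  then show ?case using tendsto_unique[OF trivial_limit_at_right_real tendsto_const] by force
qed

lemma peano_times_power:
  assumes "peano i a f"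
  shows "peano (m + i) (\<lambda>j. if j < m then 0 else a (j - m)) (\<lambda>r. r ^ m * f r)"
proof -
  have s: "(\<Sum>j\<le>m + i. (if j < m then 0 else a (j - m)) * r ^ j) = r ^ m * (\<Sum>j\<le>i. a j * r ^ j)" for r :: real
  proof -
    have "(\<Sum>j\<le>m + i. (if j < m then 0 else a (j - m)) * r ^ j) = (\<Sum>j\<in>{m..m + i}. a (j - m) * r ^ j)"
      by (rule sum.mono_neutral_cong_right) auto
    also have "\<dots> = (\<Sum>j\<le>i. a j * r ^ (j + m))"
      using sum.shift_bounds_cl_nat_ivl[of "\<lambda>j. a (j - m) * r ^ j" 0 m i] by (simp add: add.commute atMost_atLeast0)
    finally show ?thesis by (simp add: sum_distrib_left power_add mult_ac)
  qed
  have "eventually (\<lambda>r. (f r - (\<Sum>j\<le>i. a j * r ^ j)) / r ^ i =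
      (r ^ m * f r - (\<Sum>j\<le>m + i. (if j < m then 0 else a (j - m)) * r ^ j)) / r ^ (m + i)) (at_right 0)"
    using eventually_at_right_less[of 0] unfolding s
    by eventually_elim (simp add: power_add right_diff_distrib[symmetric])
  then show ?thesis using assms tendsto_cong unfolding peano_def by fastforce
qed

text \<open>A bound o(r^k) for the derivative of the remainder gives o(r^(k + 1)) for the remainder
  itself, by the mean value inequality. Second and third order expansions are built from first-order
  ones in this way.\<close>

lemma peano_integrate:
  assumes der: "eventually (\<lambda>r. (f has_real_derivative f' r) (at r)) (at_right 0)"
    and lim: "(f \<longlongrightarrow> a0) (at_right 0)" and p: "peano k b f'"
  shows "peano (Suc k) (\<lambda>j. if j = 0 then a0 else b (j - 1) / real j) f"
proof -
  let ?a = "\<lambda>j. if j = 0 then a0 else b (j - 1) / real j"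
  define R where "R r = f r - (\<Sum>j\<le>Suc k. ?a j * r ^ j)" for r
  define R' where "R' r = f' r - (\<Sum>j\<le>k. b j * r ^ j)" for r
  have s: "(\<Sum>j\<le>Suc k. ?a j * r ^ j) = a0 + (\<Sum>j\<le>k. b j / real (Suc j) * r ^ Suc j)" for r
    by (subst sum.atMost_Suc_shift) simp
  have Rlim: "(R \<longlongrightarrow> 0) (at_right 0)"
  proof -
    have "(R \<longlongrightarrow> a0 - (a0 + (\<Sum>j\<le>k. b j / real (Suc j) * 0 ^ Suc j))) (at_right 0)"
      unfolding R_def s by (intro tendsto_intros lim)
    then show ?thesis by simp
  qed
  have Rder: "(R has_real_derivative R' r) (at r)" if "(f has_real_derivative f' r) (at r)" for r
  proof -
    have "((\<lambda>r. b j / real (Suc j) * r ^ Suc j) has_real_derivative b j * r ^ j) (at r)" for j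
      using DERIV_cmult[OF DERIV_pow[of "Suc j" r UNIV], of "b j / real (Suc j)"] by (simp del: of_nat_Suc)
    then have "((\<lambda>r. a0 + (\<Sum>j\<le>k. b j / real (Suc j) * r ^ Suc j)) has_real_derivative
        0 + (\<Sum>j\<le>k. b j * r ^ j)) (at r)"
      by (intro DERIV_add DERIV_const DERIV_sum)
    then show ?thesis unfolding R_def R'_def s using DERIV_diff[OF that] by fastforce
  qed
  have "((\<lambda>r. R r / r ^ Suc k) \<longlongrightarrow> 0) (at_right 0)"
  proof (rule tendstoI)
    fix e :: real assume e: "e > 0"
    have "eventually (\<lambda>r. \<bar>R' r / r ^ k\<bar> < e/2) (at_right 0)"
      using tendstoD[OF p[unfolded peano_def], of "e/2"] e by (simp add: R'_def)
    with der have "eventually (\<lambda>r. (f has_real_derivative f' r) (at r) \<and> \<bar>R' r / r ^ k\<bar> < e/2) (at_right 0)"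
      by (rule eventually_conj)
    then obtain d where d: "d > 0" "\<And>r. 0 < r \<Longrightarrow> r < d \<Longrightarrow> (f has_real_derivative f' r) (at r)"
      "\<And>r. 0 < r \<Longrightarrow> r < d \<Longrightarrow> \<bar>R' r / r ^ k\<bar> < e/2"
      unfolding eventually_at_right_field by auto
    have "\<bar>R r\<bar> \<le> e/2 * r ^ Suc k" if r: "0 < r" "r < d" for r
    proof -
      have R'b: "\<bar>R' s\<bar> \<le> e/2 * r ^ k" if "0 < s" "s \<le> r" for s
      proof -
        have "\<bar>R' s\<bar> \<le> e/2 * s ^ k"
          using d(3)[of s] that r by (simp add: abs_divide divide_simps split: if_splits)
        also have "\<dots> \<le> e/2 * r ^ k" using that e by (intro mult_left_mono power_mono) auto
        finally show ?thesis .
      qed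
      \<comment> \<open>R is controlled for positive arguments only, so the estimate is made on
        {s..r}, and then s tends to 0, where R tends to 0.\<close>
      have "\<bar>R r - R s\<bar> \<le> e/2 * r ^ k * r" if s: "0 < s" "s < r" for s
      proof -
        have "norm (R r - R s) \<le> e/2 * r ^ k * \<bar>r - s\<bar>"
        proof (rule vector_mvt_bound[of "{s..r}"])
          show "(R has_vector_derivative R' q) (at q within {s..r})" if "q \<in> {s..r}" for q
            using Rder[OF d(2)[of q]] that s r
            by (auto simp: has_real_derivative_iff_has_vector_derivative intro: has_vector_derivative_at_within)
          show "norm (R' q) \<le> e/2 * r ^ k" if "q \<in> {s..r}" for q
            using R'b[of q] that s by auto
        qed (use s in auto)
        also have "\<dots> \<le> e/2 * r ^ k * r" using s e by (intro mult_left_mono) auto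
        finally show ?thesis by simp
      qed
      then have ev: "eventually (\<lambda>s. \<bar>R r - R s\<bar> \<le> e/2 * r ^ k * r) (at_right 0)"
        unfolding eventually_at_right_field using r(1) by blast
      have "((\<lambda>s. \<bar>R r - R s\<bar>) \<longlongrightarrow> \<bar>R r - 0\<bar>) (at_right 0)"
        by (intro tendsto_intros Rlim)
      from tendsto_upperbound[OF this ev] show ?thesis by (simp add: mult_ac)
    qed
    then have "\<bar>R r / r ^ Suc k\<bar> < e" if "0 < r" "r < d" for r
    proof -
      have "\<bar>R r / r ^ Suc k\<bar> \<le> e/2"
        using \<open>0 < r \<Longrightarrow> r < d \<Longrightarrow> \<bar>R r\<bar> \<le> e/2 * r ^ Suc k\<close> that by (simp add: abs_divide divide_simps)
      then show ?thesis using e by linarith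
    qed
    then show "eventually (\<lambda>r. dist (R r / r ^ Suc k) 0 < e) (at_right 0)"
      unfolding eventually_at_right_field using d(1) by (auto simp: dist_norm)
  qed
  then show ?thesis unfolding peano_def R_def .
qed

lemma peano_1_iff:
  "peano (Suc 0) a f \<longleftrightarrow> ((\<lambda>r. (f r - a 0) / r) \<longlongrightarrow> a 1) (at_right 0)"
proof -
  have "eventually (\<lambda>r. (f r - (\<Sum>j\<le>Suc 0. a j * r ^ j)) / r ^ Suc 0 = (f r - a 0) / r - a 1) (at_right 0)"
    using eventually_at_right_less[of 0] by eventually_elim (simp add: divide_simps)
  from tendsto_cong[OF this, of 0] show ?thesis
    unfolding peano_def by (simp add: LIM_zero_iff)
qed

lemma peano_1_derivative:
  assumes "(f has_real_derivative l) (at 0)"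
  shows "peano (Suc 0) (\<lambda>j. if j = 0 then f 0 else l) f"
proof -
  have "((\<lambda>r. (f r - f 0) / r) \<longlongrightarrow> l) (at 0)"
    using assms unfolding has_field_derivative_iff by simp
  then show ?thesis unfolding peano_1_iff
    by (simp add: filterlim_at_split)
qed

text \<open>The expansion of D 1 is known by induction and gets integrated. The induction starts at
  k = 1, where the expansion is the definition of the derivative at 0; for k = 0 nothing would link
  D 0 0 to the values of D 0 at positive arguments.\<close>

lemma peano_iterated_derivatives:
  assumes "\<epsilon> > 0" "k \<ge> 1"
    and "\<And>j r. j < k \<Longrightarrow> r \<in> {0..<\<epsilon>} \<Longrightarrow> (D j has_real_derivative D (Suc j) r) (at r within {0..<\<epsilon>})"
  shows "peano k (\<lambda>j. D j 0 / fact j) (D 0)"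
  using assms(2,3)
proof (induction k arbitrary: D rule: dec_induct)
  case base
  have at: "at_right 0 = at 0 within {0..<\<epsilon>}"
    by (rule at_within_nhd[of _ "{-\<epsilon><..<\<epsilon>}"]) (use assms(1) in auto)
  have "((\<lambda>r. (D 0 r - D 0 0) / r) \<longlongrightarrow> D 1 0) (at 0 within {0..<\<epsilon>})"
    using base[of 0 0] assms(1) unfolding has_field_derivative_iff by simp
  then have "((\<lambda>r. (D 0 r - D 0 0) / r) \<longlongrightarrow> D 1 0) (at_right 0)"
    unfolding at .
  then show ?case by (simp add: peano_1_iff)
next
  case (step k)
  have p: "peano k (\<lambda>j. D (Suc j) 0 / fact j) (D (Suc 0))"
    using step.IH[of "\<lambda>j. D (Suc j)"] step.prems by auto
  have at: "at_right 0 = at 0 within {0..<\<epsilon>}"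
    by (rule at_within_nhd[of _ "{-\<epsilon><..<\<epsilon>}"]) (use assms(1) in auto)
  have "continuous (at 0 within {0..<\<epsilon>}) (D 0)"
    using step.prems[of 0 0] assms(1) DERIV_continuous by auto
  then have lim: "(D 0 \<longlongrightarrow> D 0 0) (at_right 0)"
    unfolding at continuous_within .
  have der: "eventually (\<lambda>r. (D 0 has_real_derivative D (Suc 0) r) (at r)) (at_right 0)"
    unfolding eventually_at_right_field
  proof (intro exI[of _ \<epsilon>] conjI allI impI)
    fix r assume "0 < r" "r < \<epsilon>"
    then show "(D 0 has_real_derivative D (Suc 0) r) (at r)"
      using step.prems[of 0 r] at_within_interior[of r "{0..<\<epsilon>}"] by (auto simp: interior_atLeastLessThan)
  qed (use assms in auto)
  show ?case
  proof (rule peano_cong[OF peano_integrate[OF der lim p]])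
    show "(if j = 0 then D 0 0 else D (Suc (j - 1)) 0 / fact (j - 1) / real j) = D j 0 / fact j" for j
      by (cases j) (auto simp: mult.commute)
  qed auto
qed

lemma peano_Suc_limit:
  assumes "peano (Suc k) a f"
  shows "((\<lambda>r. (f r - (\<Sum>j\<le>k. a j * r ^ j)) / r ^ Suc k) \<longlongrightarrow> a (Suc k)) (at_right 0)"
proof -
  have "((\<lambda>r. (f r - (\<Sum>j\<le>Suc k. a j * r ^ j)) / r ^ Suc k + a (Suc k)) \<longlongrightarrow> 0 + a (Suc k)) (at_right 0)"
    using assms unfolding peano_def by (intro tendsto_intros)
  moreover have "eventually (\<lambda>r. (f r - (\<Sum>j\<le>Suc k. a j * r ^ j)) / r ^ Suc k + a (Suc k)
      = (f r - (\<Sum>j\<le>k. a j * r ^ j)) / r ^ Suc k) (at_right 0)"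
  proof -
    have *: "(x - (s + c * r ^ Suc k)) / r ^ Suc k + c = (x - s) / r ^ Suc k" if "r > 0" for x s c r :: real
      using that by (simp add: diff_divide_distrib add_divide_distrib)
    show ?thesis using eventually_at_right_less[of "0::real"]
      by eventually_elim (simp only: sum.atMost_Suc *)
  qed
  ultimately show ?thesis using tendsto_cong by fastforce
qed

lemma eventually_at_right_0I:
  fixes \<epsilon> :: real
  assumes "\<epsilon> > 0" "\<And>r. 0 < r \<Longrightarrow> r < \<epsilon> \<Longrightarrow> Q r" shows "eventually Q (at_right 0)"
  unfolding eventually_at_right_field using assms by blast

lemma has_radial_derivative_cong:
  assumes "has_radial_derivative k f l" "eventually (\<lambda>r. f r = g r) (at_right 0)"
  shows "has_radial_derivative k g l"
proof -
  obtain \<epsilon> D where D: "\<epsilon> > 0" "\<forall>r\<in>{0<..<\<epsilon>}. D 0 r = f r"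
    "\<forall>j<k. \<forall>r\<in>{0..<\<epsilon>}. (D j has_real_derivative D (Suc j) r) (at r within {0..<\<epsilon>})" "D k 0 = l"
    using assms(1) unfolding has_radial_derivative_def by blast
  obtain d where d: "d > 0" "\<And>r. 0 < r \<Longrightarrow> r < d \<Longrightarrow> f r = g r"
    using assms(2) unfolding eventually_at_right_field by auto
  show ?thesis unfolding has_radial_derivative_def
  proof (intro exI[of _ "min \<epsilon> d"] exI[of _ D] conjI ballI allI impI)
    fix j r assume "j < k" "r \<in> {0..<min \<epsilon> d}"
    then have "(D j has_real_derivative D (Suc j) r) (at r within {0..<\<epsilon>})" using D(3) by simp
    then show "(D j has_real_derivative D (Suc j) r) (at r within {0..<min \<epsilon> d})"
      by (rule DERIV_subset) auto
  qed (use D d in auto)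
qed

text \<open>The extension demanded by \<open>has_radial_derivative\<close> has its own Taylor
  coefficients at 0, and, being r^m f r for r > 0, also those of f shifted by m places. Uniqueness
  of expansions equates the two at place m + i.\<close>

lemma radial_derivative_times_power:
  assumes "has_radial_derivative (m + i) (\<lambda>r. r ^ m * f r) c" "peano i a f" "m \<ge> 1"
  shows "c = fact (m + i) * a i"
proof -
  obtain \<epsilon> D where D: "\<epsilon> > 0" "\<And>r. r \<in> {0<..<\<epsilon>} \<Longrightarrow> D 0 r = r ^ m * f r"
    "\<And>j r. j < m + i \<Longrightarrow> r \<in> {0..<\<epsilon>} \<Longrightarrow> (D j has_real_derivative D (Suc j) r) (at r within {0..<\<epsilon>})"
    "D (m + i) 0 = c"
    using assms(1) unfolding has_radial_derivative_def by blast
  have "peano (m + i) (\<lambda>j. D j 0 / fact j) (D 0)"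
    using peano_iterated_derivatives[OF D(1), of "m + i" D] D(3) assms(3) by auto
  moreover have "peano (m + i) (\<lambda>j. if j < m then 0 else a (j - m)) (D 0)"
  proof (rule peano_cong[OF peano_times_power[OF assms(2), of m]])
    show "\<forall>\<^sub>F r in at_right 0. r ^ m * f r = D 0 r"
      unfolding eventually_at_right_field using D(1,2) by (intro exI[of _ \<epsilon>]) auto
  qed auto
  ultimately have "D (m + i) 0 / fact (m + i) = (if m + i < m then 0 else a (m + i - m))"
    by (rule peano_unique) auto
  then show ?thesis using D(4) by (simp add: field_simps)
qed

text \<open>Two integrations of f' = f l, where l = \<alpha> + \<beta> r + o(r). The limit of f l
  gives the first order of f; this yields f l = f0 \<alpha> + f0 (\<alpha>^2 + \<beta>) r + o(r),
  and integrating again gives the second order.\<close>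

lemma peano_logarithmic_derivative:
  assumes der: "eventually (\<lambda>r. (f has_real_derivative f r * l r) (at r)) (at_right 0)"
    and f: "(f \<longlongrightarrow> f0) (at_right 0)" and l: "(l \<longlongrightarrow> \<alpha>) (at_right 0)"
    and l': "((\<lambda>r. (l r - \<alpha>) / r) \<longlongrightarrow> \<beta>) (at_right 0)"
  shows "peano 2 (\<lambda>j. if j = 0 then f0 else if j = 1 then f0 * \<alpha> else f0 * (\<beta> + \<alpha>\<^sup>2) / 2) f"
proof -
  have "peano 0 (\<lambda>j. f0 * \<alpha>) (\<lambda>r. f r * l r)"
    unfolding peano_0 by (intro tendsto_mult f l)
  from peano_integrate[OF der f this]
  have f1: "((\<lambda>r. (f r - f0) / r) \<longlongrightarrow> f0 * \<alpha>) (at_right 0)" by (simp add: peano_1_iff)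
  have "((\<lambda>r. (f r - f0) / r * l r + f0 * ((l r - \<alpha>) / r)) \<longlongrightarrow> f0 * \<alpha> * \<alpha> + f0 * \<beta>) (at_right 0)"
    by (intro tendsto_intros f1 l l')
  moreover have "eventually (\<lambda>r. (f r - f0) / r * l r + f0 * ((l r - \<alpha>) / r) = (f r * l r - f0 * \<alpha>) / r) (at_right 0)"
    using eventually_at_right_less[of 0] by eventually_elim (simp add: divide_simps, simp add: algebra_simps)
  ultimately have "((\<lambda>r. (f r * l r - f0 * \<alpha>) / r) \<longlongrightarrow> f0 * \<alpha> * \<alpha> + f0 * \<beta>) (at_right 0)"
    using tendsto_cong by fastforce
  then have "peano (Suc 0) (\<lambda>j. if j = 0 then f0 * \<alpha> else f0 * \<alpha> * \<alpha> + f0 * \<beta>) (\<lambda>r. f r * l r)"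
    by (simp add: peano_1_iff)
  from peano_integrate[OF der f this] show ?thesis
    unfolding numeral_2_eq_2
    by (rule peano_cong) (auto simp: le_Suc_eq power2_eq_square algebra_simps)
qed


section \<open>Determinants\<close>

lemma trace_eq_sum: "trace (A :: real^'n^'n) = (\<Sum>i\<in>UNIV. A $ i $ i)"
  by (simp add: trace_def)

text \<open>Jacobi's formula. The derivative is a sum over k of determinants in which row k of M is
  replaced by row k of K M. That row is a combination of the rows of M, of which only the multiple
  K_kk of row k itself contributes.\<close>

lemma has_real_derivative_det:
  fixes M :: "real \<Rightarrow> real^'n^'n"
  assumes M: "\<And>i j. ((\<lambda>t. M t $ i $ j) has_real_derivative M' $ i $ j) (at t)"
    and K: "M' = K ** M t"
  shows "((\<lambda>t. det (M t)) has_real_derivative trace K * det (M t)) (at t)"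
proof -
  let ?P = "{p. p permutes (UNIV :: 'n set)}"
  have "((\<lambda>t. det (M t)) has_real_derivative
      (\<Sum>p\<in>?P. of_int (sign p) * (\<Sum>i\<in>UNIV. M' $ i $ p i * (\<Prod>j\<in>UNIV - {i}. M t $ j $ p j)))) (at t)"
    unfolding det_def
    by (intro DERIV_sum DERIV_cmult has_field_derivative_prod) (use M in auto)
  moreover have "(\<Sum>p\<in>?P. of_int (sign p) * (\<Sum>i\<in>UNIV. M' $ i $ p i * (\<Prod>j\<in>UNIV - {i}. M t $ j $ p j)))
      = (\<Sum>k\<in>UNIV. det (\<chi> i. if i = k then row k M' else row i (M t)))"
  proof -
    have "(\<Prod>j\<in>UNIV. (\<chi> i. if i = k then row k M' else row i (M t)) $ j $ p j)
        = M' $ k $ p k * (\<Prod>j\<in>UNIV - {k}. M t $ j $ p j)" for k and p :: "'n \<Rightarrow> 'n"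
      by (subst prod.remove[of UNIV k]) (auto simp: row_def intro!: prod.cong)
    then show ?thesis unfolding det_def
      by (simp add: sum_distrib_left) (rule sum.swap)
  qed
  moreover have "det (\<chi> i. if i = k then row k M' else row i (M t)) = K $ k $ k * det (M t)" for k
  proof -
    have "row k M' = (\<Sum>i\<in>UNIV. K $ k $ i *s row i (M t))"
      unfolding K by (simp add: vec_eq_iff row_def matrix_matrix_mult_def)
    then show ?thesis using cramer_lemma_transpose[of k "K $ k" "M t"] by (simp cong: if_cong)
  qed
  ultimately show ?thesis by (simp add: trace_eq_sum sum_distrib_right)
qed

section \<open>Limits of matrices\<close>

lemma tendsto_matrixI:
  fixes M :: "'a \<Rightarrow> real^'n^'m"
  assumes "\<And>i j. ((\<lambda>t. M t $ i $ j) \<longlongrightarrow> B $ i $ j) F"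
  shows "(M \<longlongrightarrow> B) F"
  by (intro vec_tendstoI assms)

lemma tendsto_matrix_mult:
  fixes A :: "'a \<Rightarrow> real^'n^'m" and B :: "'a \<Rightarrow> real^'p^'n"
  assumes "(A \<longlongrightarrow> a) F" "(B \<longlongrightarrow> b) F"
  shows "((\<lambda>t. A t ** B t) \<longlongrightarrow> a ** b) F"
  by (rule tendsto_matrixI)
    (auto simp: matrix_matrix_mult_def intro!: tendsto_intros assms)

lemma tendsto_det:
  fixes A :: "'a \<Rightarrow> real^'n^'n"
  assumes "(A \<longlongrightarrow> a) F"
  shows "((\<lambda>t. det (A t)) \<longlongrightarrow> det a) F"
  unfolding det_def by (intro tendsto_intros assms)

lemma tendsto_trace:
  fixes A :: "'a \<Rightarrow> real^'n^'n"
  assumes "(A \<longlongrightarrow> a) F"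
  shows "((\<lambda>t. trace (A t)) \<longlongrightarrow> trace a) F"
  unfolding trace_eq_sum by (intro tendsto_intros assms)

text \<open>Near the identity the determinant is nonzero, and Cramer's rule expresses the inverse by
  determinants, which are continuous in the entries.\<close>

lemma tendsto_matrix_inv_mat_1:
  fixes M :: "'a \<Rightarrow> real^'n^'n"
  assumes "(M \<longlongrightarrow> mat 1) F"
  shows "((\<lambda>t. matrix_inv (M t)) \<longlongrightarrow> mat 1) F"
proof -
  have d: "((\<lambda>t. det (M t)) \<longlongrightarrow> 1) F" using tendsto_det[OF assms] by simp
  have nz: "eventually (\<lambda>t. det (M t) \<noteq> 0) F"
    using order_tendstoD(1)[OF d, of 0] by (auto elim: eventually_mono)
  have c: "((\<lambda>t. \<chi> k. det (\<chi> i j. if j = k then b $ i else M t $ i $ j) / det (M t)) \<longlongrightarrow> b) F" for b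
  proof (rule vec_tendstoI)
    fix k
    have "((\<lambda>t. det (\<chi> i j. if j = k then b $ i else M t $ i $ j)) \<longlongrightarrow>
        det (\<chi> i j. if j = k then b $ i else (mat 1 :: real^'n^'n) $ i $ j)) F"
      by (intro tendsto_det tendsto_matrixI) (use tendsto_vec_nth[OF tendsto_vec_nth[OF assms]] in auto)
    moreover have "det (\<chi> i j. if j = k then b $ i else (mat 1 :: real^'n^'n) $ i $ j) = b $ k"
      using cramer_lemma[of k "mat 1" b] by (simp cong: if_cong)
    ultimately show "((\<lambda>t. (\<chi> k. det (\<chi> i j. if j = k then b $ i else M t $ i $ j) / det (M t)) $ k) \<longlongrightarrow> b $ k) F"
      using tendsto_divide[OF _ d] by fastforce
  qed
  have e: "((\<lambda>t. matrix_inv (M t) *v b) \<longlongrightarrow> b) F" for b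
    by (rule tendsto_cong[THEN iffD1, OF _ c[of b]])
      (use nz in \<open>auto elim!: eventually_mono simp: matrix_inv_mult_vec\<close>)
  show ?thesis
  proof (rule tendsto_matrixI)
    fix i j
    have "X $ i $ j = (X *v axis j 1) $ i" for X :: "real^'n^'n"
      by (simp add: matrix_vector_mult_basis column_def)
    then show "((\<lambda>t. matrix_inv (M t) $ i $ j) \<longlongrightarrow> (mat 1 :: real^'n^'n) $ i $ j) F"
      using tendsto_vec_nth[OF e[of "axis j 1"], of i] by simp
  qed
qed

lemma matrix_mult_linear:
  fixes A B :: "real^'n^'m" and C D :: "real^'p^'n"
  shows "(k *\<^sub>R A) ** C = k *\<^sub>R (A ** C)" "A ** (k *\<^sub>R C) = k *\<^sub>R (A ** C)"
    "(A - B) ** C = A ** C - B ** C" "A ** (C - D) = A ** C - A ** D"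
  by (simp_all add: vec_eq_iff matrix_matrix_mult_def sum_distrib_left sum_subtractf algebra_simps)

text \<open>The proof expands \<open>Q(t) = P A\<^sup>-\<^sup>1 - 1/t\<close>: \<open>Q(0) = B\<^sub>1\<close>, \<open>Q'(0) = 2 B\<^sub>2 - B\<^sub>1\<^sup>2\<close>.\<close>

lemma trace_logarithmic_derivative:
  fixes A P :: "real \<Rightarrow> real^'n^'n"
  defines "N \<equiv> real CARD('n)"
  assumes A: "((\<lambda>t. (1/t\<^sup>2) *\<^sub>R ((1/t) *\<^sub>R A t - mat 1 - t *\<^sub>R B1)) \<longlongrightarrow> B2) (at_right 0)"
    and P: "((\<lambda>t. (1/t\<^sup>2) *\<^sub>R (P t - mat 1 - (2 * t) *\<^sub>R B1)) \<longlongrightarrow> 3 *\<^sub>R B2) (at_right 0)"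
  shows "eventually (\<lambda>t. det (A t) > 0) (at_right 0)"
    and "((\<lambda>t. det (A t) / t ^ CARD('n)) \<longlongrightarrow> 1) (at_right 0)"
    and "((\<lambda>t. trace (P t ** matrix_inv (A t)) - N / t) \<longlongrightarrow> trace B1) (at_right 0)"
    and "((\<lambda>t. (trace (P t ** matrix_inv (A t)) - N / t - trace B1) / t) \<longlongrightarrow> trace (2 *\<^sub>R B2 - B1 ** B1)) (at_right 0)"
proof -
  define M where "M t = (1/t) *\<^sub>R A t" for t
  have pos: "eventually (\<lambda>t::real. t > 0) (at_right 0)" by (rule eventually_at_right_less)
  have id: "((\<lambda>t::real. t) \<longlongrightarrow> 0) (at_right 0)" by (rule tendsto_ident_at)
  have M1: "((\<lambda>t. (1/t) *\<^sub>R (M t - mat 1)) \<longlongrightarrow> B1) (at_right 0)"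
  proof -
    have "((\<lambda>t. t *\<^sub>R ((1/t\<^sup>2) *\<^sub>R (M t - mat 1 - t *\<^sub>R B1)) + B1) \<longlongrightarrow> 0 *\<^sub>R B2 + B1) (at_right 0)"
      by (intro tendsto_intros A[folded M_def])
    moreover have "eventually (\<lambda>t. t *\<^sub>R ((1/t\<^sup>2) *\<^sub>R (M t - mat 1 - t *\<^sub>R B1)) + B1 = (1/t) *\<^sub>R (M t - mat 1)) (at_right 0)"
      using pos by eventually_elim (simp add: power2_eq_square algebra_simps)
    ultimately show ?thesis using tendsto_cong by fastforce
  qed
  have M0: "(M \<longlongrightarrow> mat 1) (at_right 0)"
  proof -
    have "((\<lambda>t. t *\<^sub>R ((1/t) *\<^sub>R (M t - mat 1)) + mat 1) \<longlongrightarrow> 0 *\<^sub>R B1 + mat 1) (at_right 0)"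
      by (intro tendsto_intros M1)
    moreover have "eventually (\<lambda>t. t *\<^sub>R ((1/t) *\<^sub>R (M t - mat 1)) + mat 1 = M t) (at_right 0)"
      using pos by eventually_elim simp
    ultimately show ?thesis using tendsto_cong by fastforce
  qed
  have dM: "((\<lambda>t. det (M t)) \<longlongrightarrow> 1) (at_right 0)" using tendsto_det[OF M0] by simp
  have dMA: "eventually (\<lambda>t. det (A t) = t ^ CARD('n) * det (M t)) (at_right 0)"
    using pos
  proof eventually_elim
    case (elim t)
    have "A t = (\<chi> i. t *s (M t $ i))" using elim by (simp add: M_def vec_eq_iff)
    then have "det (A t) = (\<Prod>i\<in>(UNIV::'n set). t) * det (\<chi> i. M t $ i)"
      using det_rows_mul[of "\<lambda>i. t" "\<lambda>i. M t $ i"] by simp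
    then show ?case by simp
  qed
  have dM0: "eventually (\<lambda>t. det (M t) > 0) (at_right 0)" using order_tendstoD(1)[OF dM, of 0] by simp
  show dA: "eventually (\<lambda>t. det (A t) > 0) (at_right 0)"
    using dMA dM0 pos by eventually_elim simp
  show "((\<lambda>t. det (A t) / t ^ CARD('n)) \<longlongrightarrow> 1) (at_right 0)"
    by (rule tendsto_cong[THEN iffD1, OF _ dM]) (use dMA pos in \<open>eventually_elim, simp\<close>)
  have inv: "((\<lambda>t. matrix_inv (M t)) \<longlongrightarrow> mat 1) (at_right 0)" by (rule tendsto_matrix_inv_mat_1[OF M0])
  have PM2: "((\<lambda>t. (1/t\<^sup>2) *\<^sub>R (P t - M t - t *\<^sub>R B1)) \<longlongrightarrow> 2 *\<^sub>R B2) (at_right 0)"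
  proof -
    have "((\<lambda>t. (1/t\<^sup>2) *\<^sub>R (P t - mat 1 - (2 * t) *\<^sub>R B1) - (1/t\<^sup>2) *\<^sub>R (M t - mat 1 - t *\<^sub>R B1))
        \<longlongrightarrow> 3 *\<^sub>R B2 - B2) (at_right 0)"
      by (intro tendsto_intros P A[folded M_def])
    moreover have "(1/t\<^sup>2) *\<^sub>R (P t - mat 1 - (2 * t) *\<^sub>R B1) - (1/t\<^sup>2) *\<^sub>R (M t - mat 1 - t *\<^sub>R B1)
        = (1/t\<^sup>2) *\<^sub>R (P t - M t - t *\<^sub>R B1)" for t
    proof -
      have "P t - mat 1 - (2 * t) *\<^sub>R B1 - (M t - mat 1 - t *\<^sub>R B1) = P t - M t - t *\<^sub>R B1"
        by (simp add: vec_eq_iff algebra_simps)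
      then show ?thesis by (metis scaleR_diff_right)
    qed
    moreover have "3 *\<^sub>R B2 - B2 = 2 *\<^sub>R B2" by (simp add: vec_eq_iff)
    ultimately show ?thesis by simp
  qed
  define Q where "Q t = P t ** matrix_inv (A t) - (1/t) *\<^sub>R mat 1" for t
  have trQ: "trace (Q t) = trace (P t ** matrix_inv (A t)) - N / t" for t
    by (simp add: Q_def trace_eq_sum sum_subtractf N_def mat_def)
  \<comment> \<open>With A = t M one has Q = (P - M) M^-1 / t, hence (Q - B1)/t = ((P - M - t
    B1)/t^2 - B1 (M - 1)/t) M^-1. V is the outer bracket.\<close>
  define V where "V t = (1/t\<^sup>2) *\<^sub>R (P t - M t - t *\<^sub>R B1) - B1 ** ((1/t) *\<^sub>R (M t - mat 1))" for t
  have V: "(V \<longlongrightarrow> 2 *\<^sub>R B2 - B1 ** B1) (at_right 0)"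
    unfolding V_def by (intro tendsto_diff PM2 tendsto_matrix_mult tendsto_const M1)
  have Q2: "eventually (\<lambda>t. V t ** matrix_inv (M t) = (1/t) *\<^sub>R (Q t - B1)) (at_right 0)"
    using pos dA dM0
  proof eventually_elim
    case (elim t)
    have Mi: "M t ** matrix_inv (M t) = mat 1"
      using elim(3) by (intro matrix_inv_mult) simp
    have Ai: "A t ** matrix_inv (A t) = mat 1" "matrix_inv (A t) ** A t = mat 1"
      using elim(2) by (intro matrix_inv_mult; simp)+
    have AM: "A t = t *\<^sub>R M t" using elim(1) by (simp add: M_def)
    have "matrix_inv (A t) = matrix_inv (A t) ** (M t ** matrix_inv (M t))" by (simp add: Mi)
    also have "\<dots> = (1/t) *\<^sub>R (matrix_inv (A t) ** A t ** matrix_inv (M t))"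
      unfolding AM using elim(1)
      by (simp add: matrix_mul_assoc matrix_mult_linear)
    finally have Ainv: "matrix_inv (A t) = (1/t) *\<^sub>R matrix_inv (M t)" by (simp add: Ai)
    have "V t ** matrix_inv (M t) = (1/t\<^sup>2) *\<^sub>R (P t ** matrix_inv (M t) - M t ** matrix_inv (M t) - t *\<^sub>R (B1 ** matrix_inv (M t)))
        - (1/t) *\<^sub>R (B1 ** (M t ** matrix_inv (M t)) - B1 ** matrix_inv (M t))"
      unfolding V_def by (simp add: matrix_mult_linear matrix_mul_assoc)
    also have "\<dots> = (1/t\<^sup>2) *\<^sub>R (P t ** matrix_inv (M t)) - (1/t\<^sup>2) *\<^sub>R mat 1 - (1/t) *\<^sub>R B1"
      using elim(1) by (simp add: Mi algebra_simps power2_eq_square)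
    also have "\<dots> = (1/t) *\<^sub>R (Q t - B1)"
      unfolding Q_def Ainv using elim(1) by (simp add: matrix_mult_linear algebra_simps power2_eq_square)
    finally show ?case .
  qed
  have Q2': "((\<lambda>t. (1/t) *\<^sub>R (Q t - B1)) \<longlongrightarrow> 2 *\<^sub>R B2 - B1 ** B1) (at_right 0)"
    using tendsto_cong[THEN iffD1, OF Q2 tendsto_matrix_mult[OF V inv]] by simp
  have tr: "trace ((1/t) *\<^sub>R (Q t - B1)) = (trace (Q t) - trace B1) / t" for t
    by (simp add: trace_eq_sum sum_subtractf sum_divide_distrib diff_divide_distrib)
  show l: "((\<lambda>t. (trace (P t ** matrix_inv (A t)) - N / t - trace B1) / t) \<longlongrightarrow> trace (2 *\<^sub>R B2 - B1 ** B1)) (at_right 0)"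
    using tendsto_trace[OF Q2'] unfolding tr trQ by simp
  have "((\<lambda>t. (trace (P t ** matrix_inv (A t)) - N / t - trace B1) / t * t + trace B1)
      \<longlongrightarrow> trace (2 *\<^sub>R B2 - B1 ** B1) * 0 + trace B1) (at_right 0)"
    by (intro tendsto_intros l)
  moreover have "eventually (\<lambda>t. (trace (P t ** matrix_inv (A t)) - N / t - trace B1) / t * t + trace B1
      = trace (P t ** matrix_inv (A t)) - N / t) (at_right 0)"
    using pos by eventually_elim simp
  ultimately show "((\<lambda>t. trace (P t ** matrix_inv (A t)) - N / t) \<longlongrightarrow> trace B1) (at_right 0)"
    using tendsto_cong by fastforce
qed

section \<open>Determinants of scaled, rank-one updated, positive definite and Gram matrices\<close>

lemma det_scaleR:
  fixes M :: "real^'n^'n"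
  shows "det (k *\<^sub>R M) = k ^ CARD('n) * det M"
proof -
  have "k *\<^sub>R M = (\<chi> i. k *s (M $ i))" by (simp add: vec_eq_iff)
  then show ?thesis using det_rows_mul[of "\<lambda>i. k" "\<lambda>i. M $ i"] by simp
qed

lemma matrix_mult_linear_map:
  fixes f :: "real^'n \<Rightarrow> real^'m"
  assumes "linear f" shows "matrix f *v x = f x"
  by (subst linear_axis_sum[OF assms]) (simp add: vec_eq_iff matrix_vector_mult_def matrix_def mult.commute)

text \<open>The matrix determinant lemma, by similarity: if entry k of u is nonzero, replacing
  column k of the identity by u gives an invertible T, and B T = T C for a matrix C that differs
  from the identity in row k only.\<close>

lemma det_rank_one_update:
  fixes u v :: "real^'n"
  shows "det (\<chi> i j. (if i = j then 1 else 0) + c * u $ i * v $ j) = 1 + c * (v \<bullet> u)"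
proof (cases "u = 0")
  case True
  then have "(\<chi> i j. (if i = j then 1 else 0) + c * u $ i * v $ j) = (mat 1 :: real^'n^'n)"
    by (simp add: vec_eq_iff mat_def)
  then show ?thesis using True by simp
next
  case False
  then obtain k where k: "u $ k \<noteq> 0" by (auto simp: vec_eq_iff)
  define T :: "real^'n^'n" where "T = (\<chi> i j. if j = k then u $ i else (mat 1 :: real^'n^'n) $ i $ j)"
  have Tk: "T $ i $ k = u $ i" for i by (simp add: T_def)
  have "det T = (mat 1 *v u) $ k"
    using cramer_lemma[of k "mat 1" u] by (simp add: T_def cong: if_cong)
  then have dT: "det T \<noteq> 0" using k by simp
  define B :: "real^'n^'n" where "B = (\<chi> i j. (if i = j then 1 else 0) + c * u $ i * v $ j)"
  \<comment> \<open>Row k of C, forced by B T = T C: here B T = T + c u (v T), and column k of T is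
    u, so row k of the identity has to be changed by c (v T).\<close>
  define x :: "real^'n" where "x = axis k 1 + c *\<^sub>R (v v* T)"
  define C :: "real^'n^'n" where "C = (\<chi> i. if i = k then (\<Sum>i\<in>UNIV. x $ i *s row i (mat 1)) else row i (mat 1))"
  have Ci: "C $ i $ j = (if i = j then 1 else 0) + (if i = k then c * (v v* T) $ j else 0)" for i j
  proof -
    have "(\<Sum>i\<in>UNIV. x $ i *s row i (mat 1)) = x"
      by (simp add: vec_eq_iff row_def mat_def if_distrib cong: if_cong)
    then have "C $ i $ j = (if i = k then x $ j else mat 1 $ i $ j)" by (simp add: C_def row_def)
    then show ?thesis by (auto simp: x_def mat_def axis_def)
  qed
  have "B ** T = T ** C"
  proof (simp add: vec_eq_iff, intro allI)
    fix i j
    have "(B ** T) $ i $ j = T $ i $ j + c * u $ i * (v v* T) $ j"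
    proof -
      have "B $ i $ l * T $ l $ j = (if l = i then T $ l $ j else 0) + c * u $ i * (v $ l * T $ l $ j)" for l
        by (simp add: B_def algebra_simps)
      then show ?thesis
        by (simp add: matrix_matrix_mult_def vector_matrix_mult_def sum.distrib sum_distrib_left[symmetric] mult.commute)
    qed
    also have "\<dots> = (T ** C) $ i $ j"
    proof -
      have "T $ i $ l * C $ l $ j = (if l = j then T $ i $ l else 0) + (if l = k then T $ i $ l * (c * (v v* T) $ j) else 0)" for l
        by (simp add: Ci distrib_left)
      then show ?thesis by (simp add: matrix_matrix_mult_def sum.distrib Tk mult_ac)
    qed
    finally show "(B ** T) $ i $ j = (T ** C) $ i $ j" .
  qed
  then have "det B * det T = det T * det C" using det_mul by metis
  then have "det B = det C" using dT by simp
  also have "det C = x $ k"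
    using cramer_lemma_transpose[of k x "mat 1"] unfolding C_def by simp
  also have "\<dots> = 1 + c * (v \<bullet> u)"
    by (simp add: x_def vector_matrix_mult_def Tk inner_vec_def mult_ac)
  finally show ?thesis unfolding B_def .
qed

text \<open>Positivity of the form is the only information about g, so the argument is a
  deformation: all matrices on the segment from the identity to g are positive definite, hence
  injective, and the determinant cannot reach 0 on the way.\<close>

lemma positive_definite_det_pos:
  fixes g :: "real^'n^'n"
  assumes "\<And>w. w \<noteq> 0 \<Longrightarrow> w \<bullet> (g *v w) > 0"
  shows "det g > 0"
proof (rule ccontr)
  assume neg: "\<not> det g > 0"
  define h where "h s = (1 - s) *\<^sub>R mat 1 + s *\<^sub>R g" for s
  have "continuous_on {0..1} (\<lambda>s. det (h s))"
    unfolding continuous_on_def h_def by (intro ballI tendsto_det tendsto_intros)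
  moreover have "det (h 1) \<le> 0" "0 \<le> det (h 0)" using neg by (auto simp: h_def)
  ultimately obtain s where s: "0 \<le> s" "s \<le> 1" "det (h s) = 0"
    using IVT2'[of "\<lambda>s. det (h s)" 1 0 0] by auto
  have "h s *v w \<noteq> 0" if w: "w \<noteq> 0" for w
  proof -
    have "w \<bullet> (h s *v w) = (1 - s) * (w \<bullet> w) + s * (w \<bullet> (g *v w))"
      by (simp add: h_def matrix_vector_mult_add_rdistrib scaleR_matrix_vector_assoc[symmetric] inner_add_right)
    also have "\<dots> > 0"
      using assms[OF w] w s by (cases "s = 1") (auto intro!: add_pos_nonneg)
    finally show ?thesis by auto
  qed
  then have "inj ((*v) (h s))"
    by (metis matrix_left_invertible_injective matrix_left_invertible_ker)
  then have "invertible (h s)"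
    using matrix_left_invertible_injective invertible_left_inverse by blast
  then show False using s(3) invertible_det_nz by blast
qed

lemma det_gram:
  fixes u :: "'n \<Rightarrow> real^'n"
  shows "det (\<chi> i j. u i \<bullet> (g *v u j)) = (det (\<chi> i. u i))\<^sup>2 * det g"
proof -
  have "(\<chi> i j. u i \<bullet> (g *v u j)) = (\<chi> i. u i) ** (g ** transpose (\<chi> i. u i))"
    by (simp add: vec_eq_iff matrix_matrix_mult_def transpose_def inner_vec_def matrix_vector_mult_def)
  then show ?thesis by (simp add: det_mul power2_eq_square)
qed

lemma det_rows_linear:
  fixes B :: "real^'n^'n"
  shows "det (\<chi> i. B *v u i) = det B * det (\<chi> i. u i)"
proof -
  have "(\<chi> i. B *v u i) = (\<chi> i. u i) ** transpose B"
    by (simp add: vec_eq_iff matrix_matrix_mult_def transpose_def matrix_vector_mult_def mult.commute)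
  then show ?thesis by (simp add: det_mul mult.commute)
qed

section \<open>Transformation of densities\<close>

text \<open>The change of variables theorem of the library requires a well-ordered index type; its results
  are transferred to an arbitrary finite index type by renumbering the coordinates.\<close>

typedef ('n::finite) numbered = "{..<CARD('n)}"
  by (rule exI[of _ 0]) simp

instantiation numbered :: (finite) linorder
begin
definition "a \<le> b \<longleftrightarrow> Rep_numbered a \<le> Rep_numbered b"
definition "a < b \<longleftrightarrow> Rep_numbered a < Rep_numbered b"
instance
  by standard (auto simp: less_eq_numbered_def less_numbered_def Rep_numbered_inject)
end

instance numbered :: (finite) wellorder
proof
  fix P :: "'a numbered \<Rightarrow> bool" and a
  assume *: "\<And>x. (\<And>y. y < x \<Longrightarrow> P y) \<Longrightarrow> P x"
  show "P a"
    by (induction a rule: measure_induct_rule[where f = Rep_numbered])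
      (use * in \<open>auto simp: less_numbered_def\<close>)
qed

lemma numbered_UNIV: "(UNIV :: 'n::finite numbered set) = Abs_numbered ` {..<CARD('n)}"
  using type_definition.Abs_image[OF type_definition_numbered] by auto

instance numbered :: (finite) finite
  by standard (simp add: numbered_UNIV)

lemma card_numbered: "CARD('n::finite numbered) = CARD('n)"
  using type_definition.card[OF type_definition_numbered] by simp

text \<open>By induction over transpositions: the conjugate of a transposition is a transposition,
  and the sign is multiplicative. The two permutations live on different types.\<close>

lemma sign_conjugate:
  fixes h :: "'a \<Rightarrow> 'b::finite"
  assumes h: "bij h" and p: "p permutes UNIV"
  shows "permutation (inv h \<circ> p \<circ> h) \<and> sign (inv h \<circ> p \<circ> h) = sign p"
  using p finite_class.finite_UNIV
proof (induction rule: permutes_induct)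
  case id
  have "inv h \<circ> id \<circ> h = id" using h by (auto simp: bij_is_inj)
  then show ?case by simp
next
  case (swap a b p)
  have i: "h (inv h x) = x" "inv h (h y) = y" for x y
    using h by (auto simp: bij_is_surj surj_f_inv_f bij_is_inj)
  have "inv h x = inv h y \<longleftrightarrow> x = y" for x y using i by metis
  then have e: "inv h \<circ> (Transposition.transpose a b \<circ> p) \<circ> h =
      Transposition.transpose (inv h a) (inv h b) \<circ> (inv h \<circ> p \<circ> h)"
    by (auto simp: fun_eq_iff Transposition.transpose_def)
  have "permutation p" using swap by (simp add: permutation_permutes) (metis finite_class.finite_UNIV)
  moreover have "inv h a \<noteq> inv h b" using swap i by metis
  moreover define q where "q = inv h \<circ> p \<circ> h"
  moreover have "permutation q" "sign q = sign p" using swap by (simp_all only: q_def)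
  ultimately show ?case unfolding e q_def[symmetric]
    using swap(3) permutation_compose[OF permutation_swap_id \<open>permutation q\<close>]
    by (simp only: sign_compose[OF permutation_swap_id] sign_swap_id)
qed

lemma det_reindex:
  fixes A :: "real^'n^'n" and h :: "'m::finite \<Rightarrow> 'n::finite"
  assumes h: "bij h"
  shows "det (\<chi> i j. A $ h i $ h j) = det A"
proof -
  have i: "h (inv h x) = x" "inv h (h y) = y" for x y
    using h by (auto simp: bij_is_surj surj_f_inv_f bij_is_inj)
  have bb: "bij_betw (\<lambda>p. inv h \<circ> p \<circ> h) {p. p permutes UNIV} {q. q permutes UNIV}"
  proof (rule bij_betw_byWitness[where f' = "\<lambda>q. h \<circ> q \<circ> inv h"])
    have hi: "bij (inv h)" using h by (rule bij_imp_bij_inv)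
    show "(\<lambda>p. inv h \<circ> p \<circ> h) ` {p. p permutes UNIV} \<subseteq> {q. q permutes UNIV}"
      using h hi by (auto simp: permutes_bij bij_comp intro!: bij_imp_permutes)
    show "(\<lambda>q. h \<circ> q \<circ> inv h) ` {q. q permutes UNIV} \<subseteq> {p. p permutes UNIV}"
      using h hi by (auto simp: permutes_bij bij_comp intro!: bij_imp_permutes)
  qed (auto simp: i fun_eq_iff)
  have "det (\<chi> i j. A $ h i $ h j) = (\<Sum>q | q permutes UNIV. of_int (sign q) * (\<Prod>i\<in>UNIV. A $ h i $ h (q i)))"
    by (simp add: det_def)
  also have "\<dots> = (\<Sum>p | p permutes UNIV. of_int (sign (inv h \<circ> p \<circ> h)) * (\<Prod>i\<in>UNIV. A $ h i $ h ((inv h \<circ> p \<circ> h) i)))"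
    by (rule sum.reindex_bij_betw[OF bb, symmetric])
  also have "\<dots> = (\<Sum>p | p permutes UNIV. of_int (sign p) * (\<Prod>i\<in>UNIV. A $ i $ p i))"
  proof (rule sum.cong[OF refl])
    fix p assume p: "p \<in> {p. p permutes (UNIV :: 'n set)}"
    have "(\<Prod>i\<in>UNIV. A $ h i $ h ((inv h \<circ> p \<circ> h) i)) = (\<Prod>i\<in>UNIV. A $ h i $ p (h i))"
      by (simp add: i)
    also have "\<dots> = (\<Prod>i\<in>UNIV. A $ i $ p i)"
      by (rule prod.reindex_bij_betw[OF h, of "\<lambda>i. A $ i $ p i"])
    finally show "of_int (sign (inv h \<circ> p \<circ> h)) * (\<Prod>i\<in>UNIV. A $ h i $ h ((inv h \<circ> p \<circ> h) i))
        = of_int (sign p) * (\<Prod>i\<in>UNIV. A $ i $ p i)"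
      using sign_conjugate[OF h] p by simp
  qed
  finally show ?thesis by (simp add: det_def)
qed

section \<open>Integrals over compact sets and change of variables\<close>

lemma compact_nn_integral:
  fixes f :: "'a::euclidean_space \<Rightarrow> real"
  assumes "compact S" "continuous_on S f" "\<And>x. x \<in> S \<Longrightarrow> f x \<ge> 0"
  shows "f absolutely_integrable_on S" "(\<integral>\<^sup>+x\<in>S. ennreal (f x) \<partial>lborel) = ennreal (integral S f)"
    "integral S f \<ge> 0"
proof -
  have int: "integrable lborel (\<lambda>x. indicator S x *\<^sub>R f x)"
    by (rule borel_integrable_compact[OF assms(1,2)])
  then have si: "set_integrable lborel S f" by (simp add: set_integrable_def)
  show "f absolutely_integrable_on S"
    using si integrable_completion[of "\<lambda>x. indicator S x *\<^sub>R f x" lborel] borel_measurable_integrable[OF int]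
    by (simp add: set_integrable_def)
  have "(\<integral>\<^sup>+x\<in>S. ennreal (f x) \<partial>lborel) = (\<integral>\<^sup>+x. ennreal (indicator S x *\<^sub>R f x) \<partial>lborel)"
    by (rule nn_integral_cong) (auto simp: indicator_def)
  also have "\<dots> = ennreal (LINT x:S|lborel. f x)"
    unfolding set_lebesgue_integral_def
    by (rule nn_integral_eq_integral[OF int]) (use assms(3) in \<open>auto simp: indicator_def\<close>)
  finally show "(\<integral>\<^sup>+x\<in>S. ennreal (f x) \<partial>lborel) = ennreal (integral S f)"
    using set_borel_integral_eq_integral(2)[OF si] by simp
  show "integral S f \<ge> 0"
    using assms(3) by (intro Henstock_Kurzweil_Integration.integral_nonneg set_borel_integral_eq_integral(1)[OF si]) auto
qed

text \<open>Change of variables turns the right-hand side of \<open>eq\<close> into the integral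
  over S of |det T'| times b o T. Two continuous functions with equal integrals over all compact
  sets agree: where one exceeded the other, it would do so by a definite amount on a small
  ball.\<close>

lemma density_transformation_wellorder:
  fixes T :: "real^'n::{finite,wellorder} \<Rightarrow> real^'n::_" and a b :: "real^'n::_ \<Rightarrow> real"
  assumes W: "open W" and T: "\<And>x. x \<in> W \<Longrightarrow> (T has_derivative T' x) (at x)" and inj: "inj_on T W"
    and T': "continuous_on W (\<lambda>x. det (matrix (T' x)))"
    and a: "continuous_on W a" "\<And>x. x \<in> W \<Longrightarrow> a x \<ge> 0"
    and b: "continuous_on (T ` W) b" "\<And>y. y \<in> T ` W \<Longrightarrow> b y \<ge> 0"
    and eq: "\<And>S. compact S \<Longrightarrow> S \<subseteq> W \<Longrightarrow>
      (\<integral>\<^sup>+x\<in>S. ennreal (a x) \<partial>lborel) = (\<integral>\<^sup>+y\<in>T ` S. ennreal (b y) \<partial>lborel)"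
    and x0: "x0 \<in> W"
  shows "a x0 = \<bar>det (matrix (T' x0))\<bar> * b (T x0)"
proof -
  define c where "c x = \<bar>det (matrix (T' x))\<bar> * b (T x)" for x
  have Tc: "continuous_on W T"
    using T by (auto simp: continuous_on_eq_continuous_within intro: has_derivative_continuous has_derivative_at_withinI)
  have cc: "continuous_on W c"
    unfolding c_def by (intro continuous_intros T' continuous_on_compose2[OF b(1) Tc]) auto
  have int: "integral S a = integral S c" and ai: "a integrable_on S" and ci: "c integrable_on S"
    if S: "compact S" "S \<subseteq> W" for S
  proof -
    have TS: "compact (T ` S)" using S Tc by (meson compact_continuous_image continuous_on_subset)
    have a0: "\<And>x. x \<in> S \<Longrightarrow> 0 \<le> a x" and b0: "\<And>y. y \<in> T ` S \<Longrightarrow> 0 \<le> b y"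
      using a(2) b(2) S(2) by blast+
    note A = compact_nn_integral[OF S(1) continuous_on_subset[OF a(1) S(2)] a0]
    have bT: "continuous_on (T ` S) b" using b(1) S(2) by (meson continuous_on_subset image_mono)
    note B = compact_nn_integral[OF TS bT b0]
    note C = compact_nn_integral[OF S(1) continuous_on_subset[OF cc S(2)]]
    show "a integrable_on S" using A S set_lebesgue_integral_eq_integral(1) by blast
    have c0: "\<And>x. x \<in> S \<Longrightarrow> 0 \<le> c x" using b(2) S by (auto simp: c_def intro!: mult_nonneg_nonneg)
    show "c integrable_on S" using C c0 set_lebesgue_integral_eq_integral(1) by blast
    have "ennreal (integral S a) = ennreal (integral (T ` S) b)"
      using A(2) B(2) eq[OF S] by simp
    then have 1: "integral S a = integral (T ` S) b"
      using A(3) B(3) by simp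
    \<comment> \<open>\<open>integral_change_of_variables\<close> concerns vector-valued integrands,
      so b is read as a map into real^1.\<close>
    let ?f = "\<lambda>y. vec (b y) :: real^1"
    have "integral (T ` S) ?f = integral S (\<lambda>x. \<bar>det (matrix (T' x))\<bar> *\<^sub>R ?f (T x))"
    proof (rule integral_change_of_variables)
      show "S \<in> sets lebesgue" using S(1) by (simp add: lmeasurable_compact fmeasurableD)
      show "(T has_derivative T' x) (at x within S)" if "x \<in> S" for x
        using T that S(2) has_derivative_at_withinI by blast
      show "inj_on T S" using inj S(2) inj_on_subset by blast
      have "b absolutely_integrable_on T ` S" using B(1) .
      then show "?f absolutely_integrable_on T ` S \<or> (\<lambda>x. \<bar>det (matrix (T' x))\<bar> *\<^sub>R ?f (T x)) absolutely_integrable_on S"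
        by (simp add: absolutely_integrable_on_1_iff)
    qed
    then have "integral (T ` S) b = integral S c"
      unfolding integral_on_1_eq by (simp add: vec_eq_iff c_def[abs_def])
    then show "integral S a = integral S c" using 1 by simp
  qed
  \<comment> \<open>The sign s treats a x0 > c x0 and a x0 < c x0 at once.\<close>
  have False if s: "s = 1 \<or> s = -1" and pos: "s * (a x0 - c x0) > 0" for s :: real
  proof -
    define h where "h x = s * (a x - c x)" for x
    have "continuous_on W h" unfolding h_def by (intro continuous_intros a cc)
    then have "continuous (at x0) h" using W x0 by (simp add: continuous_on_eq_continuous_at)
    then have "eventually (\<lambda>x. h x > h x0 / 2) (at x0)"
      using pos order_tendstoD(1)[of h "h x0" "at x0" "h x0 / 2"] by (simp add: h_def continuous_within)
    then obtain d where d: "d > 0" "\<And>x. x \<noteq> x0 \<Longrightarrow> dist x x0 < d \<Longrightarrow> h x > h x0 / 2"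
      unfolding eventually_at by auto
    obtain e where e: "e > 0" "cball x0 e \<subseteq> W" using W x0 open_contains_cball by blast
    define r where "r = min e (d/2)"
    have r: "r > 0" using e d by (simp add: r_def)
    have S: "compact (cball x0 r)" "cball x0 r \<subseteq> W" using e by (auto simp: r_def)
    have hp: "h x \<ge> h x0 / 2" if "x \<in> cball x0 r" for x
      using d(2)[of x] that d(1) pos by (cases "x = x0") (auto simp: r_def h_def dist_commute)
    have hi: "h integrable_on cball x0 r"
      unfolding h_def using integrable_on_cmult_left[OF integrable_diff[OF ai[OF S] ci[OF S]], of s] by simp
    have "integral (cball x0 r) h = s * (integral (cball x0 r) a - integral (cball x0 r) c)"
      unfolding h_def by (simp add: integral_mult_right integral_diff[OF ai[OF S] ci[OF S]])
    also have "\<dots> = 0" using int[OF S] by simp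
    finally have z: "integral (cball x0 r) h = 0" .
    have "integral (cball x0 r) (\<lambda>x. h x0 / 2) \<le> integral (cball x0 r) h"
      by (rule integral_le[OF _ hi hp]) (auto intro: integrable_on_const)
    moreover have "integral (cball x0 r) (\<lambda>x. h x0 / 2) = h x0 / 2 * measure lebesgue (cball x0 r)"
      by (subst lmeasure_integral) (auto simp: integral_mult_right[symmetric])
    moreover have "measure lebesgue (cball x0 r) > 0"
      using r by (simp add: content_cball_pos)
    moreover have "h x0 > 0" using pos by (simp add: h_def)
    ultimately show False using z mult_pos_pos[of "h x0 / 2" "measure lebesgue (cball x0 r)"] by linarith
  qed
  from this[of 1] this[of "-1"] have "a x0 = c x0" by fastforce
  then show ?thesis by (simp add: c_def)
qed

text \<open>Renumbering the coordinates is linear, preserves Lebesgue measure and conjugates the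
  Jacobian matrix by a permutation, so each premise of
  \<open>density_transformation_wellorder\<close> can be transported.\<close>

lemma density_transformation:
  fixes T :: "real^'n::finite \<Rightarrow> real^'n" and a b :: "real^'n \<Rightarrow> real"
  assumes W: "open W" and T: "\<And>x. x \<in> W \<Longrightarrow> (T has_derivative T' x) (at x)" and inj: "inj_on T W"
    and T': "continuous_on W (\<lambda>x. det (matrix (T' x)))"
    and a: "continuous_on W a" "\<And>x. x \<in> W \<Longrightarrow> a x \<ge> 0"
    and b: "continuous_on (T ` W) b" "\<And>y. y \<in> T ` W \<Longrightarrow> b y \<ge> 0"
    and eq: "\<And>S. compact S \<Longrightarrow> S \<subseteq> W \<Longrightarrow>
      (\<integral>\<^sup>+x\<in>S. ennreal (a x) \<partial>lborel) = (\<integral>\<^sup>+y\<in>T ` S. ennreal (b y) \<partial>lborel)"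
    and x0: "x0 \<in> W"
  shows "a x0 = \<bar>det (matrix (T' x0))\<bar> * b (T x0)"
proof -
  obtain h :: "'n numbered \<Rightarrow> 'n" where h: "bij h"
    using finite_same_card_bij[of "UNIV :: 'n numbered set" "UNIV :: 'n set"] by (auto simp: card_numbered)
  have hi: "h (inv h x) = x" "inv h (h y) = y" for x y
    using h by (auto simp: bij_is_surj surj_f_inv_f bij_is_inj)
  define \<Phi> :: "real^'n \<Rightarrow> real^'n numbered" where "\<Phi> x = (\<chi> i. x $ h i)" for x
  define \<Psi> :: "real^'n numbered \<Rightarrow> real^'n" where "\<Psi> x = (\<chi> i. x $ inv h i)" for x
  have inv: "\<Psi> (\<Phi> x) = x" "\<Phi> (\<Psi> y) = y" for x y by (simp_all add: \<Phi>_def \<Psi>_def hi)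
  have lin: "bounded_linear \<Phi>" "bounded_linear \<Psi>"
    by (auto simp: linear_conv_bounded_linear[symmetric] linear_iff vec_eq_iff \<Phi>_def \<Psi>_def)
  have cont: "continuous_on X \<Phi>" "continuous_on Y \<Psi>" for X Y
    using lin linear_continuous_on by blast+
  have meas: "\<Phi> \<in> borel_measurable borel" "\<Psi> \<in> borel_measurable borel"
    by (intro borel_measurable_continuous_onI cont)+
  \<comment> \<open>Lebesgue measure is determined by its values on boxes, and the preimage of a box
    is a box with permuted side lengths.\<close>
  have lb: "distr lborel borel \<Phi> = lborel"
  proof (rule lborel_eqI[symmetric])
    fix l u :: "real^'n numbered" assume lu: "\<And>b. b \<in> Basis \<Longrightarrow> l \<bullet> b \<le> u \<bullet> b"
    have "\<Phi> -` box l u = box (\<Psi> l) (\<Psi> u)"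
      unfolding \<Phi>_def \<Psi>_def by (auto simp: mem_box_cart) (metis hi)+
    moreover have "\<Psi> l \<bullet> b \<le> \<Psi> u \<bullet> b" if b: "b \<in> Basis" for b
    proof -
      obtain i where "b = axis i 1" using b by (auto simp: Basis_vec_def)
      then show ?thesis using lu[of "axis (inv h i) 1"] by (simp add: \<Psi>_def inner_axis)
    qed
    ultimately have "emeasure (distr lborel borel \<Phi>) (box l u) = (\<Prod>b\<in>Basis. (\<Psi> u - \<Psi> l) \<bullet> b)"
      using meas by (simp add: emeasure_distr emeasure_lborel_box)
    also have "(\<Prod>b\<in>Basis. (\<Psi> u - \<Psi> l) \<bullet> b) = (\<Prod>i\<in>UNIV. (\<Psi> u - \<Psi> l) $ i)"
      by (simp add: Basis_vec_def inner_axis prod.UNION_disjoint axis_eq_axis prod.reindex inj_on_def)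
    also have "\<dots> = (\<Prod>i\<in>UNIV. (u - l) $ inv h i)" by (simp add: \<Psi>_def)
    also have "\<dots> = (\<Prod>i\<in>UNIV. (u - l) $ i)"
      by (rule prod.reindex_bij_betw[OF bij_imp_bij_inv[OF h], of "\<lambda>i. (u - l) $ i"])
    also have "\<dots> = (\<Prod>b\<in>Basis. (u - l) \<bullet> b)"
      by (simp add: Basis_vec_def inner_axis prod.UNION_disjoint axis_eq_axis prod.reindex inj_on_def)
    finally show "emeasure (distr lborel borel \<Phi>) (box l u) = (\<Prod>b\<in>Basis. (u - l) \<bullet> b)" .
  qed simp
  have nn: "(\<integral>\<^sup>+y\<in>S. ennreal (f (\<Psi> y)) \<partial>lborel) = (\<integral>\<^sup>+x\<in>\<Psi> ` S. ennreal (f x) \<partial>lborel)"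
    if S: "compact S" and f: "continuous_on (\<Psi> ` S) f" for S and f :: "real^'n \<Rightarrow> real"
  proof -
    have "(\<lambda>y. indicator S y *\<^sub>R f (\<Psi> y)) \<in> borel_measurable borel"
      by (intro borel_measurable_continuous_on_indicator borel_compact S continuous_on_compose2[OF f cont(2)]) auto
    then have m: "(\<lambda>y. ennreal (indicator S y *\<^sub>R f (\<Psi> y))) \<in> borel_measurable borel" by simp
    have ind: "indicator S (\<Phi> x) = indicator (\<Psi> ` S) x" for x
      using inv by (auto simp: indicator_def image_iff)
    have "(\<integral>\<^sup>+y\<in>S. ennreal (f (\<Psi> y)) \<partial>lborel) = (\<integral>\<^sup>+y. ennreal (indicator S y *\<^sub>R f (\<Psi> y)) \<partial>distr lborel borel \<Phi>)"
      unfolding lb by (rule nn_integral_cong) (auto simp: indicator_def)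
    also have "\<dots> = (\<integral>\<^sup>+x. ennreal (indicator S (\<Phi> x) *\<^sub>R f (\<Psi> (\<Phi> x))) \<partial>lborel)"
      using m meas(1) by (subst nn_integral_distr) auto
    also have "\<dots> = (\<integral>\<^sup>+x\<in>\<Psi> ` S. ennreal (f x) \<partial>lborel)"
      unfolding inv ind by (rule nn_integral_cong) (auto simp: indicator_def)
    finally show ?thesis .
  qed
  have imW: "\<Psi> ` \<Phi> ` X = X" for X using inv by (auto simp: image_iff)
  have dt: "det (matrix (\<lambda>v. \<Phi> (L (\<Psi> v)))) = det (matrix L)" for L :: "real^'n \<Rightarrow> real^'n"
  proof -
    have "\<Psi> (axis j 1) = axis (h j) 1" for j
      by (auto simp: \<Psi>_def axis_def vec_eq_iff) (metis hi)+
    then have "matrix (\<lambda>v. \<Phi> (L (\<Psi> v))) = (\<chi> i j. matrix L $ h i $ h j)"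
      by (simp add: matrix_def \<Phi>_def)
    then show ?thesis by (simp add: det_reindex[OF h])
  qed
  have "(a \<circ> \<Psi>) (\<Phi> x0) = \<bar>det (matrix (\<lambda>v. \<Phi> (T' (\<Psi> (\<Phi> x0)) (\<Psi> v))))\<bar> * (b \<circ> \<Psi>) ((\<lambda>y. \<Phi> (T (\<Psi> y))) (\<Phi> x0))"
  proof (rule density_transformation_wellorder[where W = "\<Phi> ` W" and T = "\<lambda>y. \<Phi> (T (\<Psi> y))"
        and T' = "\<lambda>y v. \<Phi> (T' (\<Psi> y) (\<Psi> v))"])
    have "\<Phi> ` W = \<Psi> -` W" using inv by (auto simp: image_iff) (metis inv)
    then show "open (\<Phi> ` W)" using W cont(2)[of UNIV] by (simp add: continuous_on_open_vimage)
    show "((\<lambda>y. \<Phi> (T (\<Psi> y))) has_derivative (\<lambda>v. \<Phi> (T' (\<Psi> y) (\<Psi> v)))) (at y)" if "y \<in> \<Phi> ` W" for y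
    proof -
      have "\<Psi> y \<in> W" using that inv by auto
      then show ?thesis
        by (intro bounded_linear.has_derivative[OF lin(1)]
            has_derivative_compose[OF bounded_linear_imp_has_derivative[OF lin(2)] T])
    qed
    show "inj_on (\<lambda>y. \<Phi> (T (\<Psi> y))) (\<Phi> ` W)"
      using inj inv unfolding inj_on_def by (metis imageE)
    show "continuous_on (\<Phi> ` W) (\<lambda>y. det (matrix (\<lambda>v. \<Phi> (T' (\<Psi> y) (\<Psi> v)))))"
      unfolding dt by (rule continuous_on_compose2[OF T' cont(2)]) (auto simp: inv)
    show "continuous_on (\<Phi> ` W) (a \<circ> \<Psi>)"
      unfolding o_def by (rule continuous_on_compose2[OF a(1) cont(2)]) (auto simp: inv)
    show "continuous_on ((\<lambda>y. \<Phi> (T (\<Psi> y))) ` \<Phi> ` W) (b \<circ> \<Psi>)"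
      unfolding o_def by (rule continuous_on_compose2[OF b(1) cont(2)]) (auto simp: inv)
    show "(a \<circ> \<Psi>) y \<ge> 0" if "y \<in> \<Phi> ` W" for y using that a(2) by (auto simp: inv)
    show "(b \<circ> \<Psi>) y \<ge> 0" if "y \<in> (\<lambda>y. \<Phi> (T (\<Psi> y))) ` \<Phi> ` W" for y using that b(2) by (auto simp: inv)
    show "\<Phi> x0 \<in> \<Phi> ` W" using x0 by simp
    fix S assume S: "compact S" "S \<subseteq> \<Phi> ` W"
    have SW: "\<Psi> ` S \<subseteq> W" using S(2) imW by (metis image_mono)
    have Sc: "compact (\<Psi> ` S)" using S(1) cont(2) by (rule compact_continuous_image[rotated])
    have Tc: "continuous_on W T"
      using T by (auto simp: continuous_on_eq_continuous_within intro: has_derivative_continuous has_derivative_at_withinI)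
    have im: "(\<lambda>y. \<Phi> (T (\<Psi> y))) ` S = \<Phi> ` T ` \<Psi> ` S" by (auto simp: image_iff)
    have "compact (T ` \<Psi> ` S)" using Sc SW Tc by (meson compact_continuous_image continuous_on_subset)
    then have "compact (\<Phi> ` T ` \<Psi> ` S)" using cont(1) by (rule compact_continuous_image[rotated])
    moreover have "continuous_on (T ` \<Psi> ` S) b" using b(1) SW by (meson continuous_on_subset image_mono)
    ultimately show "(\<integral>\<^sup>+x\<in>S. ennreal ((a \<circ> \<Psi>) x) \<partial>lborel) = (\<integral>\<^sup>+y\<in>(\<lambda>y. \<Phi> (T (\<Psi> y))) ` S. ennreal ((b \<circ> \<Psi>) y) \<partial>lborel)"
      using nn[OF S(1), of a] nn[of "\<Phi> ` T ` \<Psi> ` S" b] eq[OF Sc SW] continuous_on_subset[OF a(1) SW]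
      unfolding im imW o_def by simp
  qed
  then show ?thesis by (simp add: inv dt)
qed

section \<open>Homogeneous functions\<close>

lemma sum_axis_mult: "(\<Sum>j\<in>UNIV. axis i (1::real) $ j * h j) = h (i::'n::finite)"
  by (simp add: axis_def if_distrib if_distribR cong: if_cong)

text \<open>Differentiation of f x (a \<eta>) = a^k f x \<eta> in \<eta>. The chain rule produces
  the factor a on the left, where it is kept so that exponents stay natural numbers.\<close>

lemma homogeneous_pdy:
  fixes f :: "real^'n::finite \<Rightarrow> real^'n \<Rightarrow> real"
  assumes hom: "\<And>\<eta>. \<eta> \<noteq> 0 \<Longrightarrow> f x (a *\<^sub>R \<eta>) = a ^ k * f x \<eta>" and \<xi>: "\<xi> \<noteq> 0"
    and d: "f x differentiable (at \<xi>)" "f x differentiable (at (a *\<^sub>R \<xi>))"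
  shows "a * pdy i f x (a *\<^sub>R \<xi>) = a ^ k * pdy i f x \<xi>"
proof -
  let ?D = "frechet_derivative (f x) (at (a *\<^sub>R \<xi>))" and ?E = "frechet_derivative (f x) (at \<xi>)"
  have D: "(f x has_derivative ?D) (at (a *\<^sub>R \<xi>))" and E: "(f x has_derivative ?E) (at \<xi>)"
    using d frechet_derivative_works by blast+
  have "((\<lambda>\<eta>. f x (a *\<^sub>R \<eta>)) has_derivative (\<lambda>v. ?D (a *\<^sub>R v))) (at \<xi>)"
    by (rule has_derivative_compose[where f = "\<lambda>\<eta>. a *\<^sub>R \<eta>" and g = "f x"])
      (use D in \<open>auto intro!: derivative_eq_intros\<close>)
  moreover have "((\<lambda>\<eta>. f x (a *\<^sub>R \<eta>)) has_derivative (\<lambda>v. a ^ k * ?E v)) (at \<xi>)"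
    by (rule has_derivative_transform_within_open[of "\<lambda>\<eta>. a ^ k * f x \<eta>" _ _ _ "- {0}"])
      (use \<xi> hom in \<open>auto intro!: derivative_eq_intros E\<close>)
  ultimately have "?D (a *\<^sub>R axis i 1) = a ^ k * ?E (axis i 1)"
    using has_derivative_unique by metis
  then show ?thesis
    using linear_scale[OF has_derivative_linear[OF D]] by (simp add: pdy_def)
qed

lemma homogeneous_pdx:
  fixes f :: "real^'n::finite \<Rightarrow> real^'n \<Rightarrow> real"
  assumes U: "open U" "x \<in> U" and hom: "\<And>z. z \<in> U \<Longrightarrow> f z (a *\<^sub>R \<xi>) = c * f z \<xi>"
    and d: "(\<lambda>z. f z \<xi>) differentiable (at x)"
  shows "pdx i f x (a *\<^sub>R \<xi>) = c * pdx i f x \<xi>"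
proof -
  let ?E = "frechet_derivative (\<lambda>z. f z \<xi>) (at x)"
  have E: "((\<lambda>z. f z \<xi>) has_derivative ?E) (at x)" using d frechet_derivative_works by blast
  have "((\<lambda>z. f z (a *\<^sub>R \<xi>)) has_derivative (\<lambda>v. c * ?E v)) (at x)"
    by (rule has_derivative_transform_within_open[of "\<lambda>z. c * f z \<xi>" _ _ _ U])
      (use U hom in \<open>auto intro!: derivative_eq_intros E\<close>)
  then show ?thesis unfolding pdx_def by (simp add: frechet_derivative_at[symmetric])
qed

text \<open>The function a |-> f x (a \<xi>) is differentiated at a = 1, once by the chain rule and
  once from homogeneity.\<close>

lemma euler_homogeneous:
  fixes f :: "real^'n::finite \<Rightarrow> real^'n \<Rightarrow> real"
  assumes hom: "\<And>a. a > 0 \<Longrightarrow> f x (a *\<^sub>R \<xi>) = a ^ k * f x \<xi>" and d: "f x differentiable (at \<xi>)"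
  shows "(\<Sum>i\<in>UNIV. \<xi> $ i * pdy i f x \<xi>) = k * f x \<xi>"
proof -
  let ?D = "frechet_derivative (f x) (at \<xi>)"
  have D: "(f x has_derivative ?D) (at (1 *\<^sub>R \<xi>))" using d frechet_derivative_works by (metis scaleR_one)
  have l: "linear ?D" using has_derivative_linear[OF D] .
  have "((\<lambda>a. f x (a *\<^sub>R \<xi>)) has_derivative (\<lambda>h. ?D (h *\<^sub>R \<xi>))) (at 1)"
    by (rule has_derivative_compose[where f = "\<lambda>a. a *\<^sub>R \<xi>" and g = "f x"])
      (use D in \<open>auto intro!: derivative_eq_intros\<close>)
  then have "((\<lambda>a. f x (a *\<^sub>R \<xi>)) has_real_derivative ?D \<xi>) (at 1)"
    unfolding has_field_derivative_def by (rule has_derivative_eq_rhs) (simp add: fun_eq_iff linear_scale[OF l])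
  moreover have "((\<lambda>a. f x (a *\<^sub>R \<xi>)) has_real_derivative k * f x \<xi>) (at 1)"
    by (rule has_field_derivative_transform_within_open[of "\<lambda>a. a ^ k * f x \<xi>" _ _ "{0<..}"])
      (use hom in \<open>auto intro!: derivative_eq_intros\<close>)
  ultimately have "?D \<xi> = k * f x \<xi>" using DERIV_unique by blast
  then show ?thesis using linear_axis_sum[OF l, of \<xi>] by (simp add: pdy_def)
qed


section \<open>Charts and tangent vectors\<close>

definition cimg :: "('m, 'n) chart \<Rightarrow> (real^'n) set" where
  "cimg c = cmap c ` cdom c"

definition jac :: "('m, 'n::finite) chart \<Rightarrow> ('m, 'n) chart \<Rightarrow> 'm \<Rightarrow> real^'n \<Rightarrow> real^'n" where
  "jac c d p = frechet_derivative (transition c d) (at (cmap c p))"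

text \<open>Hausdorff separation of the type enters through uniqueness of limits in
  \<open>geodesic_unique_in_chart\<close> and through closedness of compact sets in
  \<open>\<sigma>_transform\<close>.\<close>

locale smooth_manifold =
  fixes A :: "('m::t2_space, 'n::finite) chart set"
  assumes atlas: "smooth_atlas A"
begin

lemma charts_at_iff: "c \<in> charts_at A p \<longleftrightarrow> c \<in> A \<and> p \<in> cdom c"
  by (simp add: charts_at_def)

lemma chart_at_in: "chart_at A p \<in> charts_at A p"
proof -
  have "p \<in> (\<Union>c\<in>A. cdom c)" using atlas by (simp add: smooth_atlas_def)
  then have "\<exists>c. c \<in> charts_at A p" unfolding charts_at_def by blast
  then show ?thesis unfolding chart_at_def by (rule someI_ex)
qed

lemma chart:
  assumes "c \<in> A"
  shows "open (cdom c)" "open (cimg c)" "continuous_on (cdom c) (cmap c)" "continuous_on (cimg c) (cinv c)"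
    "\<And>p. p \<in> cdom c \<Longrightarrow> cinv c (cmap c p) = p" "\<And>p. p \<in> cdom c \<Longrightarrow> cmap c p \<in> cimg c"
    "\<And>x. x \<in> cimg c \<Longrightarrow> cmap c (cinv c x) = x" "\<And>x. x \<in> cimg c \<Longrightarrow> cinv c x \<in> cdom c"
proof -
  have "is_chart c" using atlas assms by (auto simp: smooth_atlas_def)
  then show "open (cdom c)" "open (cimg c)" "continuous_on (cdom c) (cmap c)" "continuous_on (cimg c) (cinv c)"
    "\<And>p. p \<in> cdom c \<Longrightarrow> cinv c (cmap c p) = p" "\<And>p. p \<in> cdom c \<Longrightarrow> cmap c p \<in> cimg c"
    "\<And>x. x \<in> cimg c \<Longrightarrow> cmap c (cinv c x) = x" "\<And>x. x \<in> cimg c \<Longrightarrow> cinv c x \<in> cdom c"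
    unfolding is_chart_def cimg_def homeomorphism_def by auto
qed

lemma overlap_iff:
  assumes "c \<in> A"
  shows "x \<in> cmap c ` (cdom c \<inter> cdom d) \<longleftrightarrow> x \<in> cimg c \<and> cinv c x \<in> cdom d"
proof
  assume "x \<in> cmap c ` (cdom c \<inter> cdom d)"
  then obtain p where "p \<in> cdom c" "p \<in> cdom d" "x = cmap c p" by blast
  then show "x \<in> cimg c \<and> cinv c x \<in> cdom d" using chart(5,6)[OF assms] by simp
next
  assume "x \<in> cimg c \<and> cinv c x \<in> cdom d"
  then show "x \<in> cmap c ` (cdom c \<inter> cdom d)"
    using chart(7,8)[OF assms, of x] by (intro image_eqI[of _ _ "cinv c x"]) simp_all
qed

lemma open_overlap:
  assumes "c \<in> A" "d \<in> A" shows "open (cmap c ` (cdom c \<inter> cdom d))"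
proof -
  have "cmap c ` (cdom c \<inter> cdom d) = cinv c -` cdom d \<inter> cimg c" using overlap_iff[OF assms(1)] by blast
  then show ?thesis
    using continuous_on_open_vimage[OF chart(2)[OF assms(1)], of "cinv c"] chart(4)[OF assms(1)] chart(1)[OF assms(2)]
    by simp
qed

lemma transition_smooth:
  assumes "c \<in> A" "d \<in> A"
  shows "smooth_on (cmap c ` (cdom c \<inter> cdom d)) (transition c d)"
  using atlas assms by (auto simp: smooth_atlas_def smoothly_compatible_def)

lemma jac:
  assumes "c \<in> charts_at A p" "d \<in> charts_at A p"
  shows "(transition c d has_derivative jac c d p) (at (cmap c p))"
  unfolding jac_def
  by (rule smooth_onD[OF transition_smooth]) (use assms in \<open>auto simp: charts_at_iff\<close>)

lemma jac_linear:
  assumes "c \<in> charts_at A p" "d \<in> charts_at A p" shows "linear (jac c d p)"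
  using jac[OF assms] has_derivative_linear by blast

lemma transition_cmap:
  assumes "c \<in> charts_at A p" shows "transition c d (cmap c p) = cmap d p"
  using assms chart(5) by (simp add: transition_def charts_at_iff)

lemma jac_id:
  assumes "c \<in> charts_at A p" shows "jac c c p = id"
proof -
  have c: "c \<in> A" "p \<in> cdom c" using assms by (auto simp: charts_at_iff)
  have "(transition c c has_derivative id) (at (cmap c p))"
    by (rule has_derivative_transform_within_open[of id _ _ _ "cimg c"])
      (use chart[OF c(1)] c in \<open>auto simp: transition_def id_def intro: has_derivative_ident\<close>)
  then show ?thesis using jac[OF assms assms] has_derivative_unique by blast
qed

text \<open>The cocycle rule of the Jacobians: transition c e is transition d e after transition c d
  on the overlap of c and d, which is open.\<close>

lemma jac_chain:
  assumes "c \<in> charts_at A p" "d \<in> charts_at A p" "e \<in> charts_at A p"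
  shows "jac c e p v = jac d e p (jac c d p v)"
proof -
  have c: "c \<in> A" "d \<in> A" "e \<in> A" "p \<in> cdom c" "p \<in> cdom d" using assms by (auto simp: charts_at_iff)
  have "((\<lambda>x. transition d e (transition c d x)) has_derivative (\<lambda>v. jac d e p (jac c d p v))) (at (cmap c p))"
    by (rule has_derivative_compose[OF jac[OF assms(1,2)]])
      (use jac[OF assms(2,3)] transition_cmap[OF assms(1)] in simp)
  then have "(transition c e has_derivative (\<lambda>v. jac d e p (jac c d p v))) (at (cmap c p))"
  proof (rule has_derivative_transform_within_open[OF _ open_overlap[OF c(1,2)]])
    show "cmap c p \<in> cmap c ` (cdom c \<inter> cdom d)" using c by auto
    show "transition d e (transition c d x) = transition c e x" if "x \<in> cmap c ` (cdom c \<inter> cdom d)" for x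
      using that chart(5)[OF c(1)] chart(5)[OF c(2)] by (auto simp: transition_def)
  qed
  then show ?thesis using jac[OF assms(1,3)] has_derivative_unique by metis
qed

lemma tvec_of_apply: "d \<in> charts_at A p \<Longrightarrow> tvec_of A c p \<xi> d = jac c d p \<xi>"
  by (simp add: tvec_of_def jac_def)

lemma tvec_of_self: "c \<in> charts_at A p \<Longrightarrow> tvec_of A c p \<xi> c = \<xi>"
  by (simp add: tvec_of_apply jac_id)

lemma tvec_of_tangent: "c \<in> charts_at A p \<Longrightarrow> tvec_of A c p \<xi> \<in> tangent_space A p"
proof (unfold tangent_space_def, intro CollectI conjI ballI allI impI)
  fix d e assume c: "c \<in> charts_at A p" "d \<in> charts_at A p" "e \<in> charts_at A p"
  show "tvec_of A c p \<xi> e = frechet_derivative (transition d e) (at (cmap d p)) (tvec_of A c p \<xi> d)"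
    unfolding tvec_of_apply[OF c(2)] tvec_of_apply[OF c(3)] jac_chain[OF c] by (simp add: jac_def)
next
  show "tvec_of A c p \<xi> d = 0" if "d \<notin> charts_at A p" for d
    using that by (simp add: tvec_of_def)
qed

lemma tangent_jac:
  assumes "v \<in> tangent_space A p" "c \<in> charts_at A p" "d \<in> charts_at A p"
  shows "v d = jac c d p (v c)"
  using assms unfolding tangent_space_def jac_def by blast

lemma tvec_of_tangent_self:
  assumes "v \<in> tangent_space A p" "c \<in> charts_at A p"
  shows "tvec_of A c p (v c) = v"
proof
  show "tvec_of A c p (v c) d = v d" for d
  proof (cases "d \<in> charts_at A p")
    case True then show ?thesis using tangent_jac[OF assms True] by (simp add: tvec_of_apply)
  next
    case False
    then have "v d = 0" using assms(1) unfolding tangent_space_def by blast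
    then show ?thesis using False by (simp add: tvec_of_def)
  qed
qed

lemma tangent_eqI:
  assumes "v \<in> tangent_space A p" "w \<in> tangent_space A p" "c \<in> charts_at A p" "v c = w c"
  shows "v = w"
  using tvec_of_tangent_self assms by metis

lemma tvec_of_linear:
  assumes "c \<in> charts_at A p"
  shows "tlin a (tvec_of A c p v) b (tvec_of A c p w) = tvec_of A c p (a *\<^sub>R v + b *\<^sub>R w)"
    "tscale a (tvec_of A c p v) = tvec_of A c p (a *\<^sub>R v)"
proof -
  have l: "linear (jac c d p)" if "d \<in> charts_at A p" for d using jac_linear assms that by blast
  show "tlin a (tvec_of A c p v) b (tvec_of A c p w) = tvec_of A c p (a *\<^sub>R v + b *\<^sub>R w)"
    by (auto simp: fun_eq_iff tlin_def tvec_of_def jac_def[symmetric] linear_add[OF l] linear_scale[OF l])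
  show "tscale a (tvec_of A c p v) = tvec_of A c p (a *\<^sub>R v)"
    by (auto simp: fun_eq_iff tscale_def tvec_of_def jac_def[symmetric] linear_scale[OF l])
qed

lemma tangent_tlin:
  assumes "v \<in> tangent_space A p" "w \<in> tangent_space A p"
  shows "tlin a v b w \<in> tangent_space A p" "tscale a v \<in> tangent_space A p"
proof -
  let ?c = "chart_at A p"
  note c = chart_at_in[of p]
  show "tlin a v b w \<in> tangent_space A p" "tscale a v \<in> tangent_space A p"
    using tvec_of_tangent_self[OF assms(1) c] tvec_of_tangent_self[OF assms(2) c]
      tvec_of_linear[OF c] tvec_of_tangent[OF c] by metis+
qed

lemma jac_det_nonzero:
  assumes "c \<in> charts_at A p" "d \<in> charts_at A p"
  shows "det (matrix (jac c d p)) \<noteq> 0"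
proof -
  have "matrix (jac d c p \<circ> jac c d p) = matrix (jac d c p) ** matrix (jac c d p)"
    by (rule matrix_compose) (use jac_linear assms in auto)
  moreover have "jac d c p \<circ> jac c d p = id"
    using jac_chain[OF assms(1,2,1)] jac_id[OF assms(1)] by (auto simp: fun_eq_iff)
  ultimately have "det (matrix (jac d c p)) * det (matrix (jac c d p)) = det (mat 1 :: real^'n^'n)"
    by (metis det_mul matrix_id_mat_1)
  then show ?thesis by auto
qed

end


section \<open>Finsler structures in a chart\<close>

locale finsler_manifold = smooth_manifold A for A :: "('m::t2_space, 'n::finite) chart set" +
  fixes F :: "'m \<Rightarrow> ('m, 'n) tvec \<Rightarrow> real"
  assumes finsler: "finsler_structure A F"
begin

text \<open>The slit tangent bundle over the chart, where F is smooth; on the zero section F^2 need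
  not be twice differentiable.\<close>

definition slit :: "('m, 'n) chart \<Rightarrow> ((real^'n) \<times> (real^'n)) set" where
  "slit c = cimg c \<times> - {0}"

abbreviation "Fl \<equiv> F_loc A F"
abbreviation "F2 \<equiv> F2_loc A F"
abbreviation "gl \<equiv> g_loc A F"
abbreviation "Gl c i \<equiv> (\<lambda>x \<xi>. spray A F c x \<xi> $ i)"

lemma slit_iff: "(x, \<xi>) \<in> slit c \<longleftrightarrow> x \<in> cimg c \<and> \<xi> \<noteq> 0"
  by (simp add: slit_def)

lemma open_slit: "c \<in> A \<Longrightarrow> open (slit c)"
  unfolding slit_def using chart(2) by (intro open_Times) auto

lemma charts_at_cinv: "c \<in> A \<Longrightarrow> x \<in> cimg c \<Longrightarrow> c \<in> charts_at A (cinv c x)"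
  using chart(8) by (simp add: charts_at_iff)

lemma F_eq_Fl:
  assumes "v \<in> tangent_space A p" "c \<in> charts_at A p"
  shows "F p v = Fl c (cmap c p) (v c)"
  using assms chart(5) tvec_of_tangent_self[OF assms] by (simp add: F_loc_def charts_at_iff)

lemma Fl_nonneg: "c \<in> A \<Longrightarrow> x \<in> cimg c \<Longrightarrow> Fl c x \<xi> \<ge> 0"
  using finsler tvec_of_tangent[OF charts_at_cinv] by (auto simp: finsler_structure_def F_loc_def)

lemma Fl_homogeneous:
  assumes "c \<in> A" "x \<in> cimg c" "a > 0" shows "Fl c x (a *\<^sub>R \<xi>) = a * Fl c x \<xi>"
  using finsler tvec_of_tangent[OF charts_at_cinv[OF assms(1,2)]] assms(3)
    tvec_of_linear(2)[OF charts_at_cinv[OF assms(1,2)], symmetric]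
  by (simp add: finsler_structure_def F_loc_def)

lemma F2_homogeneous:
  assumes "c \<in> A" "x \<in> cimg c" "a > 0" shows "F2 c x (a *\<^sub>R \<xi>) = a ^ 2 * F2 c x \<xi>"
  using Fl_homogeneous[OF assms] by (simp add: power_mult_distrib)

lemma smooth_Fl: "c \<in> A \<Longrightarrow> smooth_on (slit c) (case_prod (Fl c))"
  using finsler by (simp add: finsler_structure_def slit_def cimg_def)

lemma smooth_F2:
  assumes "c \<in> A" shows "smooth_on (slit c) (case_prod (F2 c))"
proof -
  have "Ck_on k (\<lambda>z. case_prod (Fl c) z * case_prod (Fl c) z) (slit c)" for k
    using smooth_Fl[OF assms] unfolding smooth_on_def by (intro Ck_on_mult open_slit assms) auto
  moreover have "(\<lambda>z. case_prod (Fl c) z * case_prod (Fl c) z) = case_prod (F2 c)"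
    by (auto simp: power2_eq_square)
  ultimately show ?thesis by (simp add: smooth_on_def)
qed

lemma smooth_differentiable:
  fixes f :: "real^'n \<Rightarrow> real^'n \<Rightarrow> real"
  assumes "smooth_on (slit c) (case_prod f)" "x \<in> cimg c" "\<xi> \<noteq> 0"
  shows "(case_prod f has_derivative frechet_derivative (case_prod f) (at (x, \<xi>))) (at (x, \<xi>))"
    "f x differentiable (at \<xi>)" "(\<lambda>z. f z \<xi>) differentiable (at x)"
proof -
  show D: "(case_prod f has_derivative frechet_derivative (case_prod f) (at (x, \<xi>))) (at (x, \<xi>))"
    by (rule smooth_onD[OF assms(1)]) (use assms in \<open>simp add: slit_iff\<close>)
  show "f x differentiable (at \<xi>)" "(\<lambda>z. f z \<xi>) differentiable (at x)"
    using pdx_eq(1)[OF D] pdy_eq(1)[OF D] by (auto simp: differentiable_def)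
qed

lemma smooth_pdy_F2: "c \<in> A \<Longrightarrow> smooth_on (slit c) (case_prod (pdy i (F2 c)))"
  by (rule smooth_on_pd(2)[OF open_slit smooth_F2])

lemma pdy_F2_homogeneous:
  assumes "c \<in> A" "x \<in> cimg c" "a > 0" "\<xi> \<noteq> 0"
  shows "pdy i (F2 c) x (a *\<^sub>R \<xi>) = a * pdy i (F2 c) x \<xi>"
proof -
  have "a * pdy i (F2 c) x (a *\<^sub>R \<xi>) = a ^ 2 * pdy i (F2 c) x \<xi>"
    by (rule homogeneous_pdy)
      (use assms F2_homogeneous smooth_differentiable(2)[OF smooth_F2] in auto)
  then show ?thesis using assms(3) by (simp add: power2_eq_square)
qed

lemma pdy_pdy_F2_homogeneous:
  assumes "c \<in> A" "x \<in> cimg c" "a > 0" "\<xi> \<noteq> 0"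
  shows "pdy i (pdy j (F2 c)) x (a *\<^sub>R \<xi>) = pdy i (pdy j (F2 c)) x \<xi>"
proof -
  have "a * pdy i (pdy j (F2 c)) x (a *\<^sub>R \<xi>) = a ^ 1 * pdy i (pdy j (F2 c)) x \<xi>"
    by (rule homogeneous_pdy)
      (use assms pdy_F2_homogeneous smooth_differentiable(2)[OF smooth_pdy_F2] in auto)
  then show ?thesis using assms(3) by simp
qed

section \<open>The fundamental tensor and its contractions with the fibre coordinate\<close>

lemma gl_homogeneous:
  assumes "c \<in> A" "x \<in> cimg c" "a > 0" "\<xi> \<noteq> 0"
  shows "gl c x (a *\<^sub>R \<xi>) = gl c x \<xi>"
  using pdy_pdy_F2_homogeneous[OF assms] by (simp add: g_loc_def)

lemma gl_pos:
  assumes "c \<in> A" "x \<in> cimg c" "\<xi> \<noteq> 0" "w \<noteq> 0"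
  shows "w \<bullet> (gl c x \<xi> *v w) > 0"
  using finsler assms by (auto simp: finsler_structure_def cimg_def)

lemma gl_det_pos:
  assumes "c \<in> A" "x \<in> cimg c" "\<xi> \<noteq> 0" shows "det (gl c x \<xi>) > 0"
  by (rule positive_definite_det_pos) (use gl_pos assms in blast)

lemma euler_F2:
  assumes "c \<in> A" "x \<in> cimg c" "\<xi> \<noteq> 0"
  shows "(\<Sum>j\<in>UNIV. \<xi> $ j * pdy j (F2 c) x \<xi>) = 2 * F2 c x \<xi>"
  using euler_homogeneous[of "F2 c" x \<xi> 2] F2_homogeneous[OF assms(1,2)]
    smooth_differentiable(2)[OF smooth_F2[OF assms(1)] assms(2,3)] by simp

lemma euler_pdy_F2:
  assumes "c \<in> A" "x \<in> cimg c" "\<xi> \<noteq> 0"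
  shows "(\<Sum>i\<in>UNIV. \<xi> $ i * pdy i (pdy j (F2 c)) x \<xi>) = pdy j (F2 c) x \<xi>"
  using euler_homogeneous[of "pdy j (F2 c)" x \<xi> 1] pdy_F2_homogeneous[OF assms(1,2) _ assms(3)]
    smooth_differentiable(2)[OF smooth_pdy_F2[OF assms(1)] assms(2,3)] by simp

text \<open>Differentiating Euler's relation replaces an appeal to the symmetry of second derivatives.\<close>

lemma euler_pdy_F2':
  assumes "c \<in> A" "x \<in> cimg c" "\<xi> \<noteq> 0"
  shows "(\<Sum>j\<in>UNIV. \<xi> $ j * pdy i (pdy j (F2 c)) x \<xi>) = pdy i (F2 c) x \<xi>"
proof -
  let ?D = "\<lambda>j. frechet_derivative (pdy j (F2 c) x) (at \<xi>)" and ?E = "frechet_derivative (F2 c x) (at \<xi>)"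
  have D: "(pdy j (F2 c) x has_derivative ?D j) (at \<xi>)" for j
    using smooth_differentiable(2)[OF smooth_pdy_F2[OF assms(1)] assms(2,3)] frechet_derivative_works by blast
  have E: "(F2 c x has_derivative ?E) (at \<xi>)"
    using smooth_differentiable(2)[OF smooth_F2[OF assms(1)] assms(2,3)] frechet_derivative_works by blast
  have "((\<lambda>\<eta>. \<Sum>j\<in>UNIV. \<eta> $ j * pdy j (F2 c) x \<eta>) has_derivative
      (\<lambda>v. \<Sum>j\<in>UNIV. \<xi> $ j * ?D j v + v $ j * pdy j (F2 c) x \<xi>)) (at \<xi>)"
    by (intro has_derivative_sum has_derivative_mult D bounded_linear_imp_has_derivative bounded_linear_vec_nth)
  moreover have "((\<lambda>\<eta>. \<Sum>j\<in>UNIV. \<eta> $ j * pdy j (F2 c) x \<eta>) has_derivative (\<lambda>v. 2 * ?E v)) (at \<xi>)"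
    by (rule has_derivative_transform_within_open[of "\<lambda>\<eta>. 2 * F2 c x \<eta>" _ _ _ "- {0}"])
      (use assms euler_F2[OF assms(1,2)] in \<open>auto intro!: has_derivative_mult_right E\<close>)
  ultimately have "(\<lambda>v. \<Sum>j\<in>UNIV. \<xi> $ j * ?D j v + v $ j * pdy j (F2 c) x \<xi>) = (\<lambda>v. 2 * ?E v)"
    by (rule has_derivative_unique)
  from fun_cong[OF this, of "axis i 1"]
  have "(\<Sum>j\<in>UNIV. \<xi> $ j * ?D j (axis i 1)) + (\<Sum>j\<in>UNIV. axis i 1 $ j * pdy j (F2 c) x \<xi>) = 2 * ?E (axis i 1)"
    by (simp only: sum.distrib)
  then have "(\<Sum>j\<in>UNIV. \<xi> $ j * pdy i (pdy j (F2 c)) x \<xi>) + pdy i (F2 c) x \<xi> = 2 * pdy i (F2 c) x \<xi>"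
    unfolding sum_axis_mult by (simp add: pdy_def)
  then show ?thesis by simp
qed

text \<open>By Euler's relation, contraction with \<xi> lowers the Hessian of F^2 to the gradient,
  and a second contraction lowers this to F^2. Left and right contraction differ in the order of the
  derivatives and rest on \<open>euler_pdy_F2\<close> and \<open>euler_pdy_F2'\<close>
  respectively.\<close>

lemma gl_radial:
  assumes "c \<in> A" "x \<in> cimg c" "\<xi> \<noteq> 0"
  shows "(gl c x \<xi> *v \<xi>) $ i = pdy i (F2 c) x \<xi> / 2"
    "\<xi> \<bullet> (gl c x \<xi> *v w) = (\<Sum>j\<in>UNIV. pdy j (F2 c) x \<xi> * w $ j) / 2"
    "w \<bullet> (gl c x \<xi> *v \<xi>) = (\<Sum>j\<in>UNIV. pdy j (F2 c) x \<xi> * w $ j) / 2"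
    "\<xi> \<bullet> (gl c x \<xi> *v \<xi>) = F2 c x \<xi>"
proof -
  show 1: "(gl c x \<xi> *v \<xi>) $ i = pdy i (F2 c) x \<xi> / 2" for i
    using euler_pdy_F2'[OF assms, of i]
    by (simp add: matrix_vector_mult_def g_loc_def sum_divide_distrib[symmetric] mult.commute)
  show 3: "w \<bullet> (gl c x \<xi> *v \<xi>) = (\<Sum>j\<in>UNIV. pdy j (F2 c) x \<xi> * w $ j) / 2" for w
    by (simp add: inner_vec_def 1 sum_divide_distrib mult.commute)
  have "\<xi> \<bullet> (gl c x \<xi> *v w) = (\<Sum>i\<in>UNIV. \<Sum>j\<in>UNIV. \<xi> $ i * (pdy i (pdy j (F2 c)) x \<xi> / 2 * w $ j))"
    by (simp add: inner_vec_def matrix_vector_mult_def g_loc_def sum_distrib_left)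
  also have "\<dots> = (\<Sum>j\<in>UNIV. (\<Sum>i\<in>UNIV. \<xi> $ i * pdy i (pdy j (F2 c)) x \<xi>) * w $ j / 2)"
    by (subst sum.swap) (intro sum.cong refl, simp add: sum_distrib_left sum_distrib_right sum_divide_distrib mult_ac)
  finally show "\<xi> \<bullet> (gl c x \<xi> *v w) = (\<Sum>j\<in>UNIV. pdy j (F2 c) x \<xi> * w $ j) / 2"
    by (simp add: euler_pdy_F2[OF assms] sum_divide_distrib)
  show "\<xi> \<bullet> (gl c x \<xi> *v \<xi>) = F2 c x \<xi>"
    using euler_F2[OF assms] by (simp add: 3 mult.commute)
qed

lemma Fl_pos:
  assumes "c \<in> A" "x \<in> cimg c" "\<xi> \<noteq> 0" shows "Fl c x \<xi> > 0"
  using gl_pos[OF assms assms(3)] gl_radial(4)[OF assms] Fl_nonneg[OF assms(1,2), of \<xi>]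
  by (metis less_eq_real_def zero_power2 less_irrefl)

lemma Ck_on_gl: "c \<in> A \<Longrightarrow> Ck_on k (\<lambda>z. gl c (fst z) (snd z) $ i $ j) (slit c)"
proof -
  assume c: "c \<in> A"
  have "Ck_on k (case_prod (pdy i (pdy j (F2 c)))) (slit c)"
    using smooth_on_pd(2)[OF open_slit[OF c] smooth_pdy_F2[OF c]] by (simp add: smooth_on_def)
  then have "Ck_on k (\<lambda>z. 1/2 * case_prod (pdy i (pdy j (F2 c))) z) (slit c)"
    by (intro Ck_on_mult Ck_on_const open_slit c)
  then show ?thesis by (rule Ck_on_cong[OF open_slit[OF c], rotated]) (simp add: g_loc_def case_prod_beta)
qed

text \<open>The Euler-Lagrange expression of F^2 without its acceleration term; by
  \<open>gl_spray\<close> it is the covector 4 g G.\<close>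

definition euler_lagrange :: "('m, 'n) chart \<Rightarrow> real^'n \<Rightarrow> real^'n \<Rightarrow> real^'n" where
  "euler_lagrange c x \<xi> = (\<chi> l. (\<Sum>k\<in>UNIV. pdx k (pdy l (F2 c)) x \<xi> * \<xi> $ k) - pdx l (F2 c) x \<xi>)"

lemma spray_euler_lagrange: "\<xi> \<noteq> 0 \<Longrightarrow> spray A F c x \<xi> = (1/4) *\<^sub>R (matrix_inv (gl c x \<xi>) *v euler_lagrange c x \<xi>)"
  by (simp add: spray_def euler_lagrange_def)

lemma gl_spray:
  assumes "c \<in> A" "x \<in> cimg c" "\<xi> \<noteq> 0"
  shows "gl c x \<xi> *v spray A F c x \<xi> = (1/4) *\<^sub>R euler_lagrange c x \<xi>"
  using matrix_inv_mult_vec(1)[of "gl c x \<xi>" "euler_lagrange c x \<xi>"] gl_det_pos[OF assms] assms(3)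
  by (simp add: spray_euler_lagrange matrix_vector_mult_scaleR)

lemma smooth_spray:
  assumes c: "c \<in> A" shows "smooth_on (slit c) (\<lambda>z. spray A F c (fst z) (snd z))"
  unfolding smooth_on_def
proof
  fix k
  note o = open_slit[OF c]
  have "Ck_on k (\<lambda>z. euler_lagrange c (fst z) (snd z) $ l) (slit c)" for l
  proof -
    have "Ck_on k (case_prod (pdx i (pdy l (F2 c)))) (slit c)" "Ck_on k (case_prod (pdx l (F2 c))) (slit c)" for i
      using smooth_on_pd(1)[OF o smooth_pdy_F2[OF c]] smooth_on_pd(1)[OF o smooth_F2[OF c]] by (auto simp: smooth_on_def)
    then have "Ck_on k (\<lambda>z. (\<Sum>i\<in>UNIV. case_prod (pdx i (pdy l (F2 c))) z * snd z $ i) - case_prod (pdx l (F2 c)) z) (slit c)"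
      by (intro Ck_on_diff Ck_on_sum Ck_on_mult o
          Ck_on_linear[OF bounded_linear_compose[OF bounded_linear_vec_nth bounded_linear_snd]])
    then show ?thesis
      by (rule Ck_on_cong[OF o, rotated]) (simp add: euler_lagrange_def case_prod_beta)
  qed
  then have "Ck_on k (\<lambda>z. (1/4) *\<^sub>R (matrix_inv (gl c (fst z) (snd z)) *v euler_lagrange c (fst z) (snd z))) (slit c)"
    using gl_det_pos[OF c] by (intro Ck_on_scaleR Ck_on_const Ck_on_matrix_inv_mult Ck_on_gl c o)
      (force simp: slit_def)+
  then show "Ck_on k (\<lambda>z. spray A F c (fst z) (snd z)) (slit c)"
    by (rule Ck_on_cong[OF o, rotated]) (simp add: slit_def mem_Times_iff spray_euler_lagrange)
qed

lemma smooth_Gl: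
  assumes c: "c \<in> A" shows "smooth_on (slit c) (case_prod (Gl c i))"
proof -
  have "Ck_on k (\<lambda>z. spray A F c (fst z) (snd z) $ i) (slit c)" for k
    using smooth_spray[OF c] unfolding smooth_on_def
    by (intro Ck_on_linear_compose[OF open_slit[OF c] _ bounded_linear_vec_nth]) auto
  then show ?thesis by (simp add: smooth_on_def case_prod_beta')
qed

text \<open>g has degree 0 and the Euler-Lagrange term degree 2 in \<xi>. The resulting degree 2 is
  what lets geodesics run at another constant speed be geodesics.\<close>

lemma spray_homogeneous:
  assumes "c \<in> A" "x \<in> cimg c" "a > 0"
  shows "spray A F c x (a *\<^sub>R \<xi>) = a\<^sup>2 *\<^sub>R spray A F c x \<xi>"
proof (cases "\<xi> = 0")
  case True then show ?thesis by (simp add: spray_def)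
next
  case False
  have 1: "pdx k (pdy l (F2 c)) x (a *\<^sub>R \<xi>) = a * pdx k (pdy l (F2 c)) x \<xi>" for k l
    by (rule homogeneous_pdx[OF chart(2)[OF assms(1)] assms(2)])
      (use assms False pdy_F2_homogeneous smooth_differentiable(3)[OF smooth_pdy_F2] in auto)
  have 2: "pdx l (F2 c) x (a *\<^sub>R \<xi>) = a\<^sup>2 * pdx l (F2 c) x \<xi>" for l
    by (rule homogeneous_pdx[OF chart(2)[OF assms(1)] assms(2)])
      (use assms False F2_homogeneous smooth_differentiable(3)[OF smooth_F2] in auto)
  have "euler_lagrange c x (a *\<^sub>R \<xi>) = a\<^sup>2 *\<^sub>R euler_lagrange c x \<xi>"
    by (simp add: euler_lagrange_def vec_eq_iff 1 2 right_diff_distrib sum_distrib_left power2_eq_square[of a] mult_ac)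
  then show ?thesis
    using assms(3) False gl_homogeneous[OF assms False] by (simp add: spray_euler_lagrange matrix_vector_mult_scaleR)
qed

text \<open>Conservation of energy. The right-hand side is 4 g(\<xi>, G), that is \<xi> contracted
  with the Euler-Lagrange expression; the mixed derivatives contribute twice the left-hand side, and
  the other term takes it away once.\<close>

lemma F2_conserved:
  assumes "c \<in> A" "x \<in> cimg c" "\<xi> \<noteq> 0"
  shows "(\<Sum>k\<in>UNIV. pdx k (F2 c) x \<xi> * \<xi> $ k) = 2 * (\<Sum>k\<in>UNIV. pdy k (F2 c) x \<xi> * spray A F c x \<xi> $ k)"
proof -
  \<comment> \<open>Euler's relation for F^2, differentiated in the position x.\<close>
  have xk: "(\<Sum>l\<in>UNIV. \<xi> $ l * pdx k (pdy l (F2 c)) x \<xi>) = 2 * pdx k (F2 c) x \<xi>" for k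
  proof -
    let ?D = "\<lambda>l. frechet_derivative (\<lambda>z. pdy l (F2 c) z \<xi>) (at x)" and ?E = "frechet_derivative (\<lambda>z. F2 c z \<xi>) (at x)"
    have D: "((\<lambda>z. pdy l (F2 c) z \<xi>) has_derivative ?D l) (at x)" for l
      using smooth_differentiable(3)[OF smooth_pdy_F2[OF assms(1)] assms(2,3)] frechet_derivative_works by blast
    have E: "((\<lambda>z. F2 c z \<xi>) has_derivative ?E) (at x)"
      using smooth_differentiable(3)[OF smooth_F2[OF assms(1)] assms(2,3)] frechet_derivative_works by blast
    have "((\<lambda>z. \<Sum>l\<in>UNIV. \<xi> $ l * pdy l (F2 c) z \<xi>) has_derivative (\<lambda>v. \<Sum>l\<in>UNIV. \<xi> $ l * ?D l v)) (at x)"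
      by (intro has_derivative_sum has_derivative_mult_right D)
    moreover have "((\<lambda>z. \<Sum>l\<in>UNIV. \<xi> $ l * pdy l (F2 c) z \<xi>) has_derivative (\<lambda>v. 2 * ?E v)) (at x)"
      by (rule has_derivative_transform_within_open[of "\<lambda>z. 2 * F2 c z \<xi>" _ _ _ "cimg c"])
        (use assms chart(2) euler_F2[OF assms(1) _ assms(3)] in \<open>auto intro!: has_derivative_mult_right E\<close>)
    ultimately have "(\<lambda>v. \<Sum>l\<in>UNIV. \<xi> $ l * ?D l v) = (\<lambda>v. 2 * ?E v)" by (rule has_derivative_unique)
    from fun_cong[OF this, of "axis k 1"] show ?thesis by (simp add: pdx_def)
  qed
  have "2 * (\<Sum>k\<in>UNIV. pdy k (F2 c) x \<xi> * spray A F c x \<xi> $ k) = 4 * (\<xi> \<bullet> (gl c x \<xi> *v spray A F c x \<xi>))"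
    by (simp add: gl_radial(2)[OF assms])
  also have "\<dots> = \<xi> \<bullet> euler_lagrange c x \<xi>" by (simp add: gl_spray[OF assms])
  also have "\<dots> = (\<Sum>l\<in>UNIV. \<Sum>k\<in>UNIV. \<xi> $ l * pdx k (pdy l (F2 c)) x \<xi> * \<xi> $ k) - (\<Sum>l\<in>UNIV. \<xi> $ l * pdx l (F2 c) x \<xi>)"
    by (simp add: inner_vec_def euler_lagrange_def right_diff_distrib sum_subtractf sum_distrib_left mult.assoc)
  also have "(\<Sum>l\<in>UNIV. \<Sum>k\<in>UNIV. \<xi> $ l * pdx k (pdy l (F2 c)) x \<xi> * \<xi> $ k) = (\<Sum>k\<in>UNIV. 2 * pdx k (F2 c) x \<xi> * \<xi> $ k)"
    by (subst sum.swap) (simp add: sum_distrib_right[symmetric] xk)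
  finally show ?thesis by (simp add: sum_distrib_left mult_ac)
qed

text \<open>At a unit vector F = 1, so dF is half of dF^2, and half the fibre derivative of F^2 is
  contraction of g with y. The tangent space of the indicatrix is thus the g-orthogonal complement
  of y.\<close>

lemma indicatrix_tangent_iff:
  assumes "y \<in> indicatrix A F p" "c \<in> charts_at A p"
  shows "w \<in> indicatrix_tangent A F p y \<longleftrightarrow> w \<in> tangent_space A p \<and> y c \<bullet> (gl c (cmap c p) (y c) *v w c) = 0"
    and "y c \<noteq> 0"
proof -
  have y: "y \<in> tangent_space A p" "F p y = 1" using assms by (auto simp: indicatrix_def)
  have c: "c \<in> A" "cmap c p \<in> cimg c" using assms chart(6) by (auto simp: charts_at_iff)
  let ?x = "cmap c p"
  have F1: "Fl c ?x (y c) = 1" using F_eq_Fl[OF y(1) assms(2)] y(2) by simp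
  \<comment> \<open>At the zero vector homogeneity with a = 2 would give F = 2 F, against F =
    1.\<close>
  show nz: "y c \<noteq> 0"
    using F1 Fl_homogeneous[OF c, of 2 "y c"] by auto
  have "((\<lambda>t. F p (tlin 1 y t w)) has_real_derivative 0) (at 0) \<longleftrightarrow> y c \<bullet> (gl c ?x (y c) *v w c) = 0"
    if w: "w \<in> tangent_space A p"
  proof -
    let ?D = "frechet_derivative (Fl c ?x) (at (y c))"
    have D: "(Fl c ?x has_derivative ?D) (at (y c))"
      using smooth_differentiable(2)[OF smooth_Fl[OF c(1)] c(2) nz] frechet_derivative_works by blast
    have E: "(F2 c ?x has_derivative (\<lambda>v. 2 * ?D v)) (at (y c))"
      using has_derivative_power[OF D, of 2] F1 by (simp add: mult.commute)
    have "(\<Sum>j\<in>UNIV. pdy j (F2 c) ?x (y c) * w c $ j) = 2 * ?D (w c)"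
      using linear_axis_sum[OF has_derivative_linear[OF E], of "w c"]
      unfolding pdy_def frechet_derivative_at[OF E, symmetric] by (simp add: mult.commute sum_distrib_left mult.left_commute)
    then have g: "y c \<bullet> (gl c ?x (y c) *v w c) = ?D (w c)"
      by (simp add: gl_radial(2)[OF c nz])
    have "((\<lambda>t. Fl c ?x (y c + t *\<^sub>R w c)) has_derivative (\<lambda>h. ?D (h *\<^sub>R w c))) (at 0)"
      by (rule has_derivative_compose[where g = "Fl c ?x"])
        (use D in \<open>auto intro!: derivative_eq_intros\<close>)
    moreover have "F p (tlin 1 y t w) = Fl c ?x (y c + t *\<^sub>R w c)" for t
      using F_eq_Fl[OF tangent_tlin(1)[OF y(1) w, of 1 t] assms(2)] by (simp add: tlin_def)
    ultimately have "((\<lambda>t. F p (tlin 1 y t w)) has_real_derivative ?D (w c)) (at 0)"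
      unfolding has_field_derivative_def
      by (simp add: linear_scale[OF has_derivative_linear[OF D]] mult_commute_abs)
    then show ?thesis unfolding g using DERIV_unique by fastforce
  qed
  then show "w \<in> indicatrix_tangent A F p y \<longleftrightarrow> w \<in> tangent_space A p \<and> y c \<bullet> (gl c ?x (y c) *v w c) = 0"
    unfolding indicatrix_tangent_def by blast
qed

end

section \<open>Geodesics and the exponential map\<close>

context finsler_manifold
begin

definition geodesic_field :: "('m, 'n) chart \<Rightarrow> (real^'n) \<times> (real^'n) \<Rightarrow> (real^'n) \<times> (real^'n)" where
  "geodesic_field c z = (snd z, (-2) *\<^sub>R spray A F c (fst z) (snd z))"

lemma smooth_geodesic_field: "c \<in> A \<Longrightarrow> Ck_on k (geodesic_field c) (slit c)"
  unfolding geodesic_field_def using smooth_spray unfolding smooth_on_def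
  by (intro Ck_on_Pair Ck_on_linear[OF bounded_linear_snd] Ck_on_scaleR Ck_on_const open_slit) auto

lemma geodesic_on_geodesic_field:
  assumes "geodesic_on A F I \<eta>" "t \<in> I" "d \<in> charts_at A (\<eta> t)"
  shows "((\<lambda>s. (cmap d (\<eta> s), velocity A I \<eta> s d)) has_vector_derivative
    geodesic_field d (cmap d (\<eta> t), velocity A I \<eta> t d)) (at t within I)"
  using assms unfolding geodesic_on_def geodesic_field_def by (auto intro!: has_vector_derivative_Pair)

text \<open>The acceleration is multiplied by b^2, and so is the spray by homogeneity of degree 2.
  Nontriviality of \<open>at s within J\<close> makes one-sided derivatives unique, so that
  \<open>velocity\<close>, a \<open>vector_derivative\<close>, has the expected value at end
  points.\<close>

lemma geodesic_reparam:
  assumes g: "geodesic_on A F I \<eta>" and b: "b > 0"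
    and J: "\<And>s. s \<in> J \<Longrightarrow> a + b * s \<in> I" "\<And>s. s \<in> J \<Longrightarrow> at s within J \<noteq> bot"
  defines "\<zeta> \<equiv> \<lambda>s. \<eta> (a + b * s)"
  shows "geodesic_on A F J \<zeta>" "\<And>s. s \<in> J \<Longrightarrow> velocity A J \<zeta> s = tscale b (velocity A I \<eta> (a + b * s))"
proof -
  let ?f = "\<lambda>s. a + b * s"
  have chain: "((\<lambda>s. h (?f s)) has_vector_derivative b *\<^sub>R h') (at s within J)"
    if "s \<in> J" "(h has_vector_derivative h') (at (?f s) within I)" for h :: "real \<Rightarrow> real^'n" and h' s
  proof -
    have "(?f has_vector_derivative b) (at s within J)" by (auto intro!: derivative_eq_intros)
    moreover have "(h has_vector_derivative h') (at (?f s) within ?f ` J)"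
      using that(2) J(1) by (auto intro: has_vector_derivative_within_subset)
    ultimately show ?thesis using vector_diff_chain_within[of ?f b s J h h'] by (simp add: o_def)
  qed
  have 1: "((\<lambda>s. cmap d (\<zeta> s)) has_vector_derivative b *\<^sub>R velocity A I \<eta> (?f s) d) (at s within J)"
    if "s \<in> J" "d \<in> charts_at A (\<zeta> s)" for s d
    using chain[of s "\<lambda>s. cmap d (\<eta> s)"] g J(1)[OF that(1)] that unfolding geodesic_on_def \<zeta>_def by blast
  have 2: "velocity A J \<zeta> s d = b *\<^sub>R velocity A I \<eta> (?f s) d" if "s \<in> J" for s d
  proof (cases "d \<in> charts_at A (\<zeta> s)")
    case True
    have "velocity A J \<zeta> s d = vector_derivative (\<lambda>s. cmap d (\<zeta> s)) (at s within J)"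
      using True by (simp add: velocity_def)
    then show ?thesis
      using vector_derivative_within[OF J(2)[OF that] 1[OF that True]] by simp
  next
    case False then show ?thesis by (simp add: velocity_def \<zeta>_def)
  qed
  show "velocity A J \<zeta> s = tscale b (velocity A I \<eta> (?f s))" if "s \<in> J" for s
    using 2[OF that] by (simp add: tscale_def fun_eq_iff)
  show "geodesic_on A F J \<zeta>"
    unfolding geodesic_on_def
  proof (intro conjI ballI)
    have "continuous_on I \<eta>" using g by (simp add: geodesic_on_def)
    then show "continuous_on J \<zeta>" unfolding \<zeta>_def
      by (rule continuous_on_compose2) (use J(1) in \<open>auto intro!: continuous_intros\<close>)
    fix s d assume s: "s \<in> J" and d: "d \<in> charts_at A (\<zeta> s)"
    show "((\<lambda>s. cmap d (\<zeta> s)) has_vector_derivative velocity A J \<zeta> s d) (at s within J)"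
      using 1[OF s d] 2[OF s] by simp
    let ?v = "velocity A I \<eta> (?f s) d"
    have d': "d \<in> A" "cmap d (\<zeta> s) \<in> cimg d" using d chart(6) by (auto simp: charts_at_iff)
    have "((\<lambda>s. velocity A I \<eta> s d) has_vector_derivative (-2) *\<^sub>R spray A F d (cmap d (\<zeta> s)) ?v) (at (?f s) within I)"
      using g J(1)[OF s] d unfolding geodesic_on_def \<zeta>_def by blast
    from bounded_linear.has_vector_derivative[OF bounded_linear_scaleR_right chain[OF s this], of b]
    have "((\<lambda>s. b *\<^sub>R velocity A I \<eta> (?f s) d) has_vector_derivative
        (-2) *\<^sub>R spray A F d (cmap d (\<zeta> s)) (b *\<^sub>R ?v)) (at s within J)"
      by (simp add: spray_homogeneous[OF d' b] power2_eq_square mult_ac)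
    then show "((\<lambda>s. velocity A J \<zeta> s d) has_vector_derivative
        (-2) *\<^sub>R spray A F d (cmap d (\<zeta> s)) (velocity A J \<zeta> s d)) (at s within J)"
      unfolding 2[OF s] by (rule has_vector_derivative_transform[OF s, rotated]) (use 2 in auto)
  qed
qed

text \<open>Near t the curve stays in the domain of c by continuity, so the chain rule for the
  transition map applies to its coordinates.\<close>

lemma velocity_tangent:
  assumes g: "geodesic_on A F I \<eta>" and t: "t \<in> I" "at t within I \<noteq> bot"
  shows "velocity A I \<eta> t \<in> tangent_space A (\<eta> t)"
  unfolding tangent_space_def jac_def[symmetric]
proof (intro CollectI conjI ballI allI impI)
  fix c d assume c: "c \<in> charts_at A (\<eta> t)" and d: "d \<in> charts_at A (\<eta> t)"
  have cA: "c \<in> A" "\<eta> t \<in> cdom c" using c by (auto simp: charts_at_iff)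
  have "((\<lambda>s. cmap c (\<eta> s)) has_vector_derivative velocity A I \<eta> t c) (at t within I)"
    using g t c by (auto simp: geodesic_on_def)
  then have "((\<lambda>s. cmap c (\<eta> s)) has_derivative (\<lambda>h. h *\<^sub>R velocity A I \<eta> t c)) (at t within I)"
    by (simp add: has_vector_derivative_def)
  from has_derivative_compose[OF this jac[OF c d]]
  have "((\<lambda>s. transition c d (cmap c (\<eta> s))) has_vector_derivative jac c d (\<eta> t) (velocity A I \<eta> t c)) (at t within I)"
    by (simp add: has_vector_derivative_def linear_scale[OF jac_linear[OF c d]])
  moreover have "eventually (\<lambda>s. transition c d (cmap c (\<eta> s)) = cmap d (\<eta> s)) (at t within I)"
  proof -
    have "(\<eta> \<longlongrightarrow> \<eta> t) (at t within I)" using g t(1) by (auto simp: geodesic_on_def continuous_on_def)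
    then have "eventually (\<lambda>s. \<eta> s \<in> cdom c) (at t within I)"
      using chart(1)[OF cA(1)] cA(2) by (rule topological_tendstoD)
    then show ?thesis by eventually_elim (use chart(5)[OF cA(1)] in \<open>simp add: transition_def\<close>)
  qed
  ultimately have "((\<lambda>s. cmap d (\<eta> s)) has_vector_derivative jac c d (\<eta> t) (velocity A I \<eta> t c)) (at t within I)"
    unfolding has_vector_derivative_def
    by (rule has_derivative_transform_eventually) (use t(1) transition_cmap[OF c] in auto)
  then have "vector_derivative (\<lambda>s. cmap d (\<eta> s)) (at t within I) = jac c d (\<eta> t) (velocity A I \<eta> t c)"
    by (rule vector_derivative_within[OF t(2)])
  then show "velocity A I \<eta> t d = jac c d (\<eta> t) (velocity A I \<eta> t c)"
    using d by (simp add: velocity_def)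
next
  show "velocity A I \<eta> t c = 0" if "c \<notin> charts_at A (\<eta> t)" for c
    using that by (simp add: velocity_def)
qed

text \<open>Nothing says beforehand that \<zeta> stays in the chart. The times at which it does and
  coincides with the chart solution u form a nonempty, open and closed subset of the interval, which
  is connected.\<close>

lemma geodesic_unique_in_chart:
  assumes c: "c \<in> A" and T: "T > 0" and g: "geodesic_on A F {0..T} \<zeta>"
    and B: "open B" "B \<subseteq> slit c"
    and Lip: "\<And>a b. a \<in> B \<Longrightarrow> b \<in> B \<Longrightarrow> norm (geodesic_field c a - geodesic_field c b) \<le> L * norm (a - b)"
    and L: "L \<ge> 0" "L * T \<le> 1/2"
    and u: "\<And>s. s \<in> {0..T} \<Longrightarrow> u s \<in> B"
      "\<And>s. s \<in> {0..T} \<Longrightarrow> (u has_vector_derivative geodesic_field c (u s)) (at s within {0..T})"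
    and init: "\<zeta> 0 = cinv c (fst (u 0))" "velocity A {0..T} \<zeta> 0 c = snd (u 0)"
    and s: "s \<in> {0..T}"
  shows "\<zeta> s = cinv c (fst (u s))" "velocity A {0..T} \<zeta> s c = snd (u s)"
proof -
  let ?I = "{0..T}"
  define w where "w s = (cmap c (\<zeta> s), velocity A ?I \<zeta> s c)" for s
  define E where "E = {s \<in> ?I. \<zeta> s \<in> cdom c \<and> w s = u s}"
  have img: "fst (u s) \<in> cimg c" if "s \<in> ?I" for s
    using u(1)[OF that] B(2) by (auto simp: slit_def mem_Times_iff)
  have \<zeta>c: "continuous_on ?I \<zeta>" using g by (simp add: geodesic_on_def)
  have uc: "continuous_on ?I u" by (rule continuous_on_vector_derivative[OF u(2)])
  have w': "(w has_vector_derivative geodesic_field c (w s)) (at s within ?I)" if "s \<in> ?I" "\<zeta> s \<in> cdom c" for s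
    using geodesic_on_geodesic_field[OF g that(1), of c] that(2) c unfolding w_def[abs_def] by (simp add: charts_at_iff)
  have E0: "0 \<in> E"
    using init T img[of 0] chart(7,8)[OF c] by (auto simp: E_def w_def)
  \<comment> \<open>Near a time of agreement both curves lie in the Lipschitz region B, and
    \<open>ode_dependence\<close> with equal values at s0 keeps them equal.\<close>
  have op: "openin (top_of_set ?I) E"
    unfolding openin_contains_ball
  proof (intro conjI ballI)
    show "E \<subseteq> ?I" by (auto simp: E_def)
    fix s0 assume "s0 \<in> E"
    then have s0: "s0 \<in> ?I" "\<zeta> s0 \<in> cdom c" "w s0 = u s0" by (auto simp: E_def)
    have "(\<zeta> \<longlongrightarrow> \<zeta> s0) (at s0 within ?I)" using \<zeta>c s0(1) by (auto simp: continuous_on_def)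
    then have e1: "eventually (\<lambda>s. \<zeta> s \<in> cdom c) (at s0 within ?I)"
      using chart(1)[OF c] s0(2) by (rule topological_tendstoD)
    have "(w \<longlongrightarrow> w s0) (at s0 within ?I)"
      using has_vector_derivative_continuous[OF w'[OF s0(1,2)]] by (simp add: continuous_within)
    then have e2: "eventually (\<lambda>s. w s \<in> B) (at s0 within ?I)"
      using B(1) u(1)[OF s0(1)] s0(3) by (intro topological_tendstoD) auto
    obtain e where e: "e > 0" "\<And>s. s \<in> ?I \<Longrightarrow> s \<noteq> s0 \<Longrightarrow> dist s s0 < e \<Longrightarrow> \<zeta> s \<in> cdom c \<and> w s \<in> B"
      using eventually_conj[OF e1 e2] unfolding eventually_at by auto
    have e': "\<zeta> s \<in> cdom c \<and> w s \<in> B" if "s \<in> ?I" "dist s s0 < e" for s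
      using e(2)[of s] that s0 u(1)[OF s0(1)] by (cases "s = s0") auto
    show "\<exists>e>0. ball s0 e \<inter> ?I \<subseteq> E"
    proof (intro exI[of _ e] conjI subsetI e(1))
      fix s assume s: "s \<in> ball s0 e \<inter> ?I"
      let ?a = "min s s0" and ?b = "max s s0"
      have sub: "{?a..?b} \<subseteq> ?I" using s s0(1) by auto
      have near: "dist r s0 < e" if "r \<in> {?a..?b}" for r
        using that s by (auto simp: dist_real_def)
      have "norm (w s - u s) \<le> 2 * norm (w s0 - u s0)"
      proof (rule ode_dependence[where B = B and X = "geodesic_field c" and L = L and a = ?a and b = ?b, OF Lip L(1)])
        have "?b - ?a \<le> T" using s s0(1) by auto
        then show "L * (?b - ?a) \<le> 1/2" using mult_left_mono[OF _ L(1)] L(2) by force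
        show "w r \<in> B \<and> (w has_vector_derivative geodesic_field c (w r)) (at r within {?a..?b})" if "r \<in> {?a..?b}" for r
          using e'[of r] near[OF that] that sub w'[of r] has_vector_derivative_within_subset[OF _ sub] by blast
        show "u r \<in> B \<and> (u has_vector_derivative geodesic_field c (u r)) (at r within {?a..?b})" if "r \<in> {?a..?b}" for r
          using that sub u[of r] has_vector_derivative_within_subset[OF _ sub] by blast
      qed auto
      then have "w s = u s" using s0(3) by simp
      then show "s \<in> E" using e'[of s] s by (auto simp: E_def dist_commute)
    qed
  qed
  \<comment> \<open>At a limit time the point of \<zeta> is the limit of the points of u, which lies
    in the chart because u takes values in the slit bundle; with that the coordinates of \<zeta> are
    continuous there and can be compared.\<close>
  have cl: "closedin (top_of_set ?I) E"
    unfolding closedin_limpt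
  proof (intro conjI allI impI)
    show "E \<subseteq> ?I" by (auto simp: E_def)
    fix l assume "l islimpt E \<and> l \<in> ?I"
    then obtain x where "\<And>n. x n \<in> E" "l \<in> ?I" "x \<longlonglongrightarrow> l"
      unfolding islimpt_sequential by blast
    then have xI: "\<And>n. x n \<in> ?I" "\<And>n. \<zeta> (x n) \<in> cdom c" "\<And>n. w (x n) = u (x n)" and l: "l \<in> ?I" and lim: "x \<longlonglongrightarrow> l"
      by (auto simp: E_def)
    have xe: "\<forall>\<^sub>F n in sequentially. x n \<in> ?I" using xI(1) by simp
    have gc: "continuous_on ?I (\<lambda>s. cinv c (fst (u s)))"
      by (rule continuous_on_compose2[OF chart(4)[OF c] continuous_on_fst[OF uc]]) (use img in auto)
    have "(\<lambda>n. \<zeta> (x n)) \<longlonglongrightarrow> \<zeta> l" by (rule continuous_on_tendsto_compose[OF \<zeta>c lim l xe])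
    moreover have "(\<lambda>n. cinv c (fst (u (x n)))) \<longlonglongrightarrow> cinv c (fst (u l))"
      by (rule continuous_on_tendsto_compose[OF gc lim l xe])
    moreover have "\<zeta> (x n) = cinv c (fst (u (x n)))" for n
      unfolding xI(3)[symmetric] w_def using chart(5)[OF c xI(2)] by simp
    ultimately have "\<zeta> l = cinv c (fst (u l))" using LIMSEQ_unique by fastforce
    then have ld: "\<zeta> l \<in> cdom c" using chart(8)[OF c img[OF l]] by simp
    have "(w \<longlongrightarrow> w l) (at l within ?I)"
      using has_vector_derivative_continuous[OF w'[OF l ld]] by (simp add: continuous_within)
    then have "continuous (at l within ?I) w" by (simp add: continuous_within)
    then have "(\<lambda>n. w (x n)) \<longlonglongrightarrow> w l"
      using lim xI(1) l by (simp add: continuous_within_sequentially o_def)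
    moreover have "(\<lambda>n. u (x n)) \<longlonglongrightarrow> u l" by (rule continuous_on_tendsto_compose[OF uc lim l xe])
    ultimately have "w l = u l" using xI(3) LIMSEQ_unique by fastforce
    then show "l \<in> E" using l ld by (simp add: E_def)
  qed
  have "E = ?I"
  proof -
    have "\<forall>E. openin (top_of_set ?I) E \<and> closedin (top_of_set ?I) E \<longrightarrow> E = {} \<or> E = ?I"
      using connected_Icc[of 0 T] by (simp only: connected_clopen)
    from spec[OF this, of E] show ?thesis using op cl E0 by auto
  qed
  then have "s \<in> E" using s by blast
  then have "\<zeta> s \<in> cdom c" "w s = u s" by (simp_all add: E_def)
  then show "\<zeta> s = cinv c (fst (u s))" "velocity A ?I \<zeta> s c = snd (u s)"
    using chart(5)[OF c] by (metis fst_conv w_def, metis snd_conv w_def)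
qed

text \<open>Everything is read off one flow in the chart: the geodesic on [0, 1] with initial
  velocity r w is the flow line of w run for time r. Uniqueness against arbitrary geodesics makes
  the definite description in \<open>finsler_exp\<close> meaningful. The Z i are, with their
  derivatives, the Jacobi fields vanishing at 0.\<close>

lemma exp_chart:
  assumes fc: "forward_complete A F" and c: "c \<in> charts_at A p" and \<xi>0: "\<xi>0 \<noteq> 0"
  obtains \<epsilon> u Z where "\<epsilon> > 0" "u 0 = (cmap c p, \<xi>0)"
    "\<And>t. \<bar>t\<bar> < \<epsilon> \<Longrightarrow> u t \<in> slit c"
    "\<And>t. \<bar>t\<bar> < \<epsilon> \<Longrightarrow> (u has_vector_derivative geodesic_field c (u t)) (at t)"
    "\<And>i. Z i 0 = (0, axis i 1)"
    "\<And>i t. \<bar>t\<bar> < \<epsilon> \<Longrightarrow> (Z i has_vector_derivative frechet_derivative (geodesic_field c) (at (u t)) (Z i t)) (at t)"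
    "\<And>r. 0 < r \<Longrightarrow> r < \<epsilon> \<Longrightarrow> finsler_exp A F p (tvec_of A c p (r *\<^sub>R \<xi>0)) = cinv c (fst (u r))"
    "\<And>r v. 0 < r \<Longrightarrow> r < \<epsilon> \<Longrightarrow> dexp A F p (tvec_of A c p (r *\<^sub>R \<xi>0)) (tvec_of A c p v) =
      tvec_of A c (cinv c (fst (u r))) ((1/r) *\<^sub>R (\<Sum>i\<in>UNIV. v $ i *\<^sub>R fst (Z i r)))"
    "\<exists>e>0. \<exists>\<eta>. geodesic_from A F {-e<..<e} p (tvec_of A c p \<xi>0) \<eta>"
proof -
  have cA: "c \<in> A" "p \<in> cdom c" "cmap c p \<in> cimg c" using c chart(6) by (auto simp: charts_at_iff)
  let ?x0 = "cmap c p"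
  define z0 where "z0 = (?x0, \<xi>0)"
  have z0: "z0 \<in> slit c" using \<xi>0 cA by (simp add: z0_def slit_iff)
  obtain \<epsilon> \<delta> \<rho> L U Y where pos: "\<epsilon> > 0" "\<delta> > 0" "\<rho> > 0" "L \<ge> 0" "L * (2 * \<epsilon>) \<le> 1/2" "ball z0 \<rho> \<subseteq> slit c"
    and Lip: "\<And>a b. a \<in> ball z0 \<rho> \<Longrightarrow> b \<in> ball z0 \<rho> \<Longrightarrow> norm (geodesic_field c a - geodesic_field c b) \<le> L * norm (a - b)"
    and U0: "\<And>z. z \<in> ball z0 \<delta> \<Longrightarrow> U z 0 = z"
    and UB: "\<And>z t. z \<in> ball z0 \<delta> \<Longrightarrow> \<bar>t\<bar> < \<epsilon> \<Longrightarrow> U z t \<in> ball z0 \<rho>"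
    and U': "\<And>z t. z \<in> ball z0 \<delta> \<Longrightarrow> \<bar>t\<bar> < \<epsilon> \<Longrightarrow> (U z has_vector_derivative geodesic_field c (U z t)) (at t)"
    and Y0: "\<And>b. b \<in> Basis \<Longrightarrow> Y b 0 = b"
    and Y': "\<And>b t. b \<in> Basis \<Longrightarrow> \<bar>t\<bar> < \<epsilon> \<Longrightarrow>
      (Y b has_vector_derivative frechet_derivative (geodesic_field c) (at (U z0 t)) (Y b t)) (at t)"
    and var: "\<And>k t. \<bar>t\<bar> < \<epsilon> \<Longrightarrow>
      ((\<lambda>h. U (z0 + h *\<^sub>R k) t) has_vector_derivative (\<Sum>b\<in>Basis. (k \<bullet> b) *\<^sub>R Y b t)) (at 0)"
    using flow_variation[OF open_slit[OF cA(1)] smooth_geodesic_field[OF cA(1)] z0] by blast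
  have z0b: "z0 \<in> ball z0 \<delta>" using pos by simp
  have LT: "L * T \<le> 1/2" if "T \<le> 2 * \<epsilon>" for T
    using mult_left_mono[OF that pos(4)] pos(5) by linarith
  have expU: "finsler_exp A F p (tvec_of A c p (r *\<^sub>R w)) = cinv c (fst (U (?x0, w) r))"
    if w: "(?x0, w) \<in> ball z0 \<delta>" and r: "0 < r" "r < \<epsilon>" for w r
  proof -
    have key: "\<eta> 1 = cinv c (fst (U (?x0, w) r))"
      if "geodesic_from A F {0..1} p (tvec_of A c p (r *\<^sub>R w)) \<eta>" for \<eta>
    proof -
      have g: "geodesic_on A F {0..1} \<eta>" "\<eta> 0 = p" "velocity A {0..1} \<eta> 0 = tvec_of A c p (r *\<^sub>R w)"
        using that by (auto simp: geodesic_from_def)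
      have J: "at s within {0..r} \<noteq> bot" if "s \<in> {0..r}" for s
        using at_within_interval_nontrivial[of "{0..r}" s 0] at_within_interval_nontrivial[of "{0..r}" s r] that r
        by (cases "s = 0") auto
      \<comment> \<open>Slowing down by the factor 1/r moves the geodesic from [0, 1] to [0, r] and
        turns its initial velocity r w into w.\<close>
      note rp = geodesic_reparam[OF g(1), of "1/r" "{0..r}" 0]
      have g2: "geodesic_on A F {0..r} (\<lambda>s. \<eta> (0 + 1/r * s))"
        and v2: "velocity A {0..r} (\<lambda>s. \<eta> (0 + 1/r * s)) 0 = tscale (1/r) (velocity A {0..1} \<eta> (0 + 1/r * 0))"
        using rp(1) rp(2)[of 0] r J by (simp_all add: divide_simps)
      have "(\<lambda>s. \<eta> (0 + 1/r * s)) r = cinv c (fst (U (?x0, w) r))"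
      proof (rule geodesic_unique_in_chart(1)[OF cA(1) r(1) g2 open_ball pos(6) Lip pos(4) LT])
        show "U (?x0, w) s \<in> ball z0 \<rho>" if "s \<in> {0..r}" for s
          using UB[OF w, of s] that r by auto
        show "(U (?x0, w) has_vector_derivative geodesic_field c (U (?x0, w) s)) (at s within {0..r})" if "s \<in> {0..r}" for s
          using U'[OF w, of s] that r by (auto intro: has_vector_derivative_at_within)
        show "\<eta> (0 + 1/r * 0) = cinv c (fst (U (?x0, w) 0))"
          using g(2) U0[OF w] chart(5)[OF cA(1,2)] by simp
        show "velocity A {0..r} (\<lambda>s. \<eta> (0 + 1/r * s)) 0 c = snd (U (?x0, w) 0)"
          unfolding v2 using U0[OF w] r tvec_of_linear(2)[OF c] by (simp add: g(3) tvec_of_self[OF c])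
      qed (use r in auto)
      then show ?thesis using r by simp
    qed
    obtain \<eta> where "geodesic_from A F {0..1} p (tvec_of A c p (r *\<^sub>R w)) \<eta>"
      using fc tvec_of_tangent[OF c] unfolding forward_complete_def by blast
    then show ?thesis unfolding finsler_exp_def
      by (intro the_equality) (use key in blast)+
  qed
  define u where "u = U z0"
  define Z where "Z i = Y (0, axis i 1)" for i
  have us: "u t \<in> slit c" if "\<bar>t\<bar> < \<epsilon>" for t
    using UB[OF z0b that] pos(6) by (auto simp: u_def)
  have uexp: "finsler_exp A F p (tvec_of A c p (r *\<^sub>R \<xi>0)) = cinv c (fst (u r))" if "0 < r" "r < \<epsilon>" for r
    using expU[of \<xi>0 r] that z0b by (simp add: u_def z0_def)
  have dexp: "dexp A F p (tvec_of A c p (r *\<^sub>R \<xi>0)) (tvec_of A c p v) =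
      tvec_of A c (cinv c (fst (u r))) ((1/r) *\<^sub>R (\<Sum>i\<in>UNIV. v $ i *\<^sub>R fst (Z i r)))"
    if r: "0 < r" "r < \<epsilon>" for r v
  proof -
    define q where "q = cinv c (fst (u r))"
    define \<gamma> where "\<gamma> t = finsler_exp A F p (tlin 1 (tvec_of A c p (r *\<^sub>R \<xi>0)) t (tvec_of A c p v))" for t
    define J where "J = (1/r) *\<^sub>R (\<Sum>i\<in>UNIV. v $ i *\<^sub>R fst (Z i r))"
    have rc: "fst (u r) \<in> cimg c" using us[of r] r by (auto simp: slit_def mem_Times_iff)
    have qc: "c \<in> charts_at A q" using charts_at_cinv[OF cA(1) rc] by (simp add: q_def)
    have qx: "cmap c q = fst (u r)" using chart(7)[OF cA(1) rc] by (simp add: q_def)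
    have \<gamma>0: "\<gamma> 0 = q"
      using uexp[OF r] by (simp add: \<gamma>_def tvec_of_linear[OF c] q_def)
    have ev: "eventually (\<lambda>t. z0 + (t/r) *\<^sub>R (0, v) \<in> ball z0 \<delta>) (at 0)"
    proof -
      have "((\<lambda>t. z0 + (t/r) *\<^sub>R (0, v)) \<longlongrightarrow> z0 + (0/r) *\<^sub>R (0, v)) (at 0)" by (intro tendsto_intros) (use r in auto)
      then show ?thesis using z0b by (intro topological_tendstoD) (auto simp: zero_prod_def[symmetric])
    qed
    \<comment> \<open>Moving r \<xi>0 by t v moves the initial velocity \<xi>0 of the flow line by
      (t/r) v; this is the origin of the factor 1/r in the differential.\<close>
    have \<gamma>U: "\<gamma> t = cinv c (fst (U (z0 + (t/r) *\<^sub>R (0, v)) r))" if "z0 + (t/r) *\<^sub>R (0, v) \<in> ball z0 \<delta>" for t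
    proof -
      have "r *\<^sub>R \<xi>0 + t *\<^sub>R v = r *\<^sub>R (\<xi>0 + (t/r) *\<^sub>R v)" using r by (simp add: scaleR_add_right)
      then have "\<gamma> t = finsler_exp A F p (tvec_of A c p (r *\<^sub>R (\<xi>0 + (t/r) *\<^sub>R v)))"
        by (simp add: \<gamma>_def tvec_of_linear[OF c])
      then show ?thesis using expU[of "\<xi>0 + (t/r) *\<^sub>R v" r] that r by (simp add: z0_def)
    qed
    have sumY: "fst ((1/r) *\<^sub>R (\<Sum>b\<in>Basis. ((0, v) \<bullet> b) *\<^sub>R Y b r)) = J"
    proof -
      have "(\<Sum>b\<in>Basis. ((0::real^'n, v) \<bullet> b) *\<^sub>R Y b r) = (\<Sum>b\<in>Basis. (v \<bullet> b) *\<^sub>R Y (0, b) r)"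
        by (simp add: sum_Basis_prod_eq)
      also have "\<dots> = (\<Sum>i\<in>UNIV. v $ i *\<^sub>R Z i r)"
        by (simp add: Basis_vec_def Z_def UNION_singleton_eq_range sum.reindex inj_on_def axis_eq_axis inner_axis)
      finally show ?thesis by (simp add: J_def fst_sum)
    qed
    have dU: "((\<lambda>t. fst (U (z0 + (t/r) *\<^sub>R (0, v)) r)) has_vector_derivative J) (at 0)"
    proof -
      have rr: "\<bar>r\<bar> < \<epsilon>" using r by simp
      have "((\<lambda>t. t/r) has_vector_derivative (1/r)) (at 0)" by (auto intro!: derivative_eq_intros)
      moreover have "((\<lambda>h. U (z0 + h *\<^sub>R (0, v)) r) has_vector_derivative (\<Sum>b\<in>Basis. ((0, v) \<bullet> b) *\<^sub>R Y b r)) (at (0/r))"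
        using var[OF rr, of "(0, v)"] by simp
      ultimately have "((\<lambda>t. U (z0 + (t/r) *\<^sub>R (0, v)) r) has_vector_derivative (1/r) *\<^sub>R (\<Sum>b\<in>Basis. ((0, v) \<bullet> b) *\<^sub>R Y b r)) (at 0)"
        using vector_diff_chain_at[of "\<lambda>t. t/r" "1/r" 0] by (simp add: o_def)
      from bounded_linear.has_vector_derivative[OF bounded_linear_fst this] show ?thesis unfolding sumY .
    qed
    have dd: "vector_derivative (\<lambda>s. cmap d (\<gamma> s)) (at 0) = jac c d q J" if d: "d \<in> charts_at A q" for d
    proof -
      have U0r: "fst (U (z0 + (0/r) *\<^sub>R (0, v)) r) = cmap c q" by (simp add: qx u_def zero_prod_def[symmetric])
      have "((\<lambda>t. transition c d (fst (U (z0 + (t/r) *\<^sub>R (0, v)) r))) has_derivative (\<lambda>h. jac c d q (h *\<^sub>R J))) (at 0)"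
        by (rule has_derivative_compose[OF dU[unfolded has_vector_derivative_def]])
          (use jac[OF qc d] U0r in simp)
      then have "((\<lambda>t. transition c d (fst (U (z0 + (t/r) *\<^sub>R (0, v)) r))) has_derivative (\<lambda>h. h *\<^sub>R jac c d q J)) (at 0)"
        by (simp add: linear_scale[OF jac_linear[OF qc d]])
      moreover have "eventually (\<lambda>t. transition c d (fst (U (z0 + (t/r) *\<^sub>R (0, v)) r)) = cmap d (\<gamma> t)) (at 0)"
        using ev by eventually_elim (simp add: \<gamma>U transition_def)
      ultimately have "((\<lambda>t. cmap d (\<gamma> t)) has_derivative (\<lambda>h. h *\<^sub>R jac c d q J)) (at 0)"
        by (rule has_derivative_transform_eventually)
          (use \<gamma>U[of 0] z0b in \<open>auto simp: transition_def zero_prod_def[symmetric]\<close>)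
      then show ?thesis
        by (intro vector_derivative_at) (simp add: has_vector_derivative_def)
    qed
    show ?thesis
      unfolding dexp_def \<gamma>_def[symmetric] q_def[symmetric] J_def[symmetric]
    proof
      show "velocity A UNIV \<gamma> 0 d = tvec_of A c q J d" for d
        by (cases "d \<in> charts_at A q") (simp_all add: velocity_def tvec_of_def \<gamma>0 dd jac_def[symmetric])
    qed
  qed
  \<comment> \<open>Completeness gives geodesics forward in time only. One is started at the earlier
    point u (-e) of the flow line, identified with the flow line for time T = 2 e, and shifted so
    that its middle lies at p.\<close>
  have two: "\<exists>e>0. \<exists>\<eta>. geodesic_from A F {-e<..<e} p (tvec_of A c p \<xi>0) \<eta>"
  proof -
    define e where "e = \<epsilon>/2"
    define T where "T = 2 * e"
    have e: "0 < e" "e < \<epsilon>" "0 < T" "T \<le> 2 * \<epsilon>" using pos(1) by (auto simp: e_def T_def)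
    define q where "q = cinv c (fst (u (-e)))"
    let ?\<xi> = "snd (u (-e))"
    have rc: "fst (u (-e)) \<in> cimg c" using us[of "-e"] e by (auto simp: slit_def mem_Times_iff)
    have qc: "c \<in> charts_at A q" using charts_at_cinv[OF cA(1) rc] by (simp add: q_def)
    obtain \<eta> where \<eta>: "geodesic_from A F {0..1} q (tvec_of A c q (T *\<^sub>R ?\<xi>)) \<eta>"
      using fc tvec_of_tangent[OF qc] unfolding forward_complete_def by blast
    then have g: "geodesic_on A F {0..1} \<eta>" "\<eta> 0 = q" "velocity A {0..1} \<eta> 0 = tvec_of A c q (T *\<^sub>R ?\<xi>)"
      by (auto simp: geodesic_from_def)
    have J: "at s within {0..T} \<noteq> bot" if "s \<in> {0..T}" for s
      using at_within_interval_nontrivial[of "{0..T}" s 0] at_within_interval_nontrivial[of "{0..T}" s T] that e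
      by (cases "s = 0") auto
    define \<zeta> where "\<zeta> = (\<lambda>s. \<eta> (0 + 1/T * s))"
    note rp = geodesic_reparam[OF g(1), of "1/T" "{0..T}" 0, folded \<zeta>_def]
    have g2: "geodesic_on A F {0..T} \<zeta>"
      and v2: "velocity A {0..T} \<zeta> 0 = tscale (1/T) (velocity A {0..1} \<eta> (0 + 1/T * 0))"
      using rp(1) rp(2)[of 0] e J by (simp_all add: divide_simps)
    have eq: "\<zeta> e = cinv c (fst (u (e - e)))" "velocity A {0..T} \<zeta> e c = snd (u (e - e))"
    proof -
      note un = geodesic_unique_in_chart[OF cA(1) e(3) g2 open_ball pos(6) Lip pos(4) LT[OF e(4)], of "\<lambda>s. u (s - e)" e]
      have a: "u (s - e) \<in> ball z0 \<rho>" if "s \<in> {0..T}" for s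
        using UB[OF z0b, of "s - e"] that e by (auto simp: u_def T_def)
      have b: "((\<lambda>s. u (s - e)) has_vector_derivative geodesic_field c (u (s - e))) (at s within {0..T})" if "s \<in> {0..T}" for s
      proof -
        have "(u has_vector_derivative geodesic_field c (u (s - e))) (at (s - e))"
          using U'[OF z0b, of "s - e"] that e by (auto simp: u_def T_def)
        moreover have "((\<lambda>s. s - e) has_vector_derivative 1) (at s)" by (auto intro!: derivative_eq_intros)
        ultimately have "((\<lambda>s. u (s - e)) has_vector_derivative geodesic_field c (u (s - e))) (at s)"
          using vector_diff_chain_at[of "\<lambda>s. s - e" 1 s u] by (simp add: o_def)
        then show ?thesis by (rule has_vector_derivative_at_within)
      qed
      have i1: "\<zeta> 0 = cinv c (fst (u (0 - e)))" using g(2) by (simp add: \<zeta>_def q_def)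
      have i2: "velocity A {0..T} \<zeta> 0 c = snd (u (0 - e))"
        unfolding v2 using e tvec_of_linear(2)[OF qc] by (simp add: g(3) tvec_of_self[OF qc])
      have eT: "e \<in> {0..T}" using e by (simp add: T_def)
      show "\<zeta> e = cinv c (fst (u (e - e)))" "velocity A {0..T} \<zeta> e c = snd (u (e - e))"
        using un[OF _ _ a b i1 i2 eT] by auto
    qed
    let ?K = "{-e<..<e}"
    define \<theta> where "\<theta> = (\<lambda>s. \<zeta> (e + 1 * s))"
    have K: "at s within ?K \<noteq> bot" if "s \<in> ?K" for s
      using that by (simp add: at_within_open[of s ?K])
    note rp2 = geodesic_reparam[OF g2, of 1 ?K e, folded \<theta>_def]
    have g3: "geodesic_on A F ?K \<theta>" and v3: "velocity A ?K \<theta> 0 = tscale 1 (velocity A {0..T} \<zeta> (e + 1 * 0))"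
      using rp2(1) rp2(2)[of 0] e K by (simp_all add: T_def)
    have u0: "u 0 = (?x0, \<xi>0)" using U0[OF z0b] by (simp add: u_def z0_def)
    have \<theta>0: "\<theta> 0 = p" using eq(1) u0 chart(5)[OF cA(1,2)] by (simp add: \<theta>_def)
    have "velocity A ?K \<theta> 0 = tvec_of A c p \<xi>0"
    proof (rule tangent_eqI[OF _ tvec_of_tangent[OF c] c])
      show "velocity A ?K \<theta> 0 \<in> tangent_space A p"
        using velocity_tangent[OF g3, of 0] K e \<theta>0 by simp
      show "velocity A ?K \<theta> 0 c = tvec_of A c p \<xi>0 c"
        using eq(2) u0 by (simp add: v3 tscale_def tvec_of_self[OF c])
    qed
    then show ?thesis using g3 \<theta>0 e(1) by (auto simp: geodesic_from_def)
  qed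
  show ?thesis
  proof (rule that[OF pos(1), of u Z])
    show "u 0 = (?x0, \<xi>0)" using U0[OF z0b] by (simp add: u_def z0_def)
    show "(u has_vector_derivative geodesic_field c (u t)) (at t)" if "\<bar>t\<bar> < \<epsilon>" for t
      using U'[OF z0b that] by (simp add: u_def)
    have ax: "(0, axis i 1) \<in> (Basis :: ((real^'n) \<times> (real^'n)) set)" for i
      by (simp add: Basis_prod_def axis_in_Basis_iff)
    show "Z i 0 = (0, axis i 1)" for i using Y0[OF ax] by (simp add: Z_def)
    show "(Z i has_vector_derivative frechet_derivative (geodesic_field c) (at (u t)) (Z i t)) (at t)" if "\<bar>t\<bar> < \<epsilon>" for i t
      using Y'[OF ax that] by (simp add: Z_def u_def)
  qed (use us uexp dexp two in auto)
qed

end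

section \<open>The density in polar coordinates\<close>

locale finsler_measure = finsler_manifold A F for A :: "('m::t2_space, 'n::finite) chart set" and F +
  fixes \<mu> :: "'m measure" and \<sigma> :: "('m, 'n) chart \<Rightarrow> real^'n \<Rightarrow> real"
  assumes measure: "volume_measure A \<mu> \<sigma>"
begin

lemma smooth_\<sigma>: "c \<in> A \<Longrightarrow> smooth_on (cimg c) (\<sigma> c)"
  and \<sigma>_pos: "c \<in> A \<Longrightarrow> x \<in> cimg c \<Longrightarrow> \<sigma> c x > 0"
  using measure by (auto simp: volume_measure_def cimg_def)

text \<open>A compact set in the overlap has one measure, computed in c and in d;
  \<open>density_transformation\<close> turns this equality of integrals into a relation between the
  densities.\<close>

lemma \<sigma>_transform:
  assumes c: "c \<in> charts_at A q" and d: "d \<in> charts_at A q"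
  shows "\<sigma> c (cmap c q) = \<bar>det (matrix (jac c d q))\<bar> * \<sigma> d (cmap d q)"
proof -
  have cA: "c \<in> A" "q \<in> cdom c" and dA: "d \<in> A" "q \<in> cdom d" using c d by (auto simp: charts_at_iff)
  let ?T = "transition c d" and ?W = "cmap c ` (cdom c \<inter> cdom d)"
  let ?T' = "\<lambda>x. frechet_derivative ?T (at x)"
  have W: "open ?W" by (rule open_overlap[OF cA(1) dA(1)])
  have WI: "x \<in> cimg c" "cinv c x \<in> cdom c" "cinv c x \<in> cdom d" if "x \<in> ?W" for x
    using that overlap_iff[OF cA(1)] chart(8)[OF cA(1)] by blast+
  have TW: "?T ` ?W \<subseteq> cimg d" using WI(3) chart(6)[OF dA(1)] by (auto simp: transition_def)
  have "\<sigma> c (cmap c q) = \<bar>det (matrix (?T' (cmap c q)))\<bar> * \<sigma> d (?T (cmap c q))"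
  proof (rule density_transformation[where T = ?T and T' = ?T', OF W])
    show "(?T has_derivative ?T' x) (at x)" if "x \<in> ?W" for x
      by (rule smooth_onD[OF transition_smooth[OF cA(1) dA(1)] that])
    show "inj_on ?T ?W"
    proof (rule inj_onI)
      fix x y assume xy: "x \<in> ?W" "y \<in> ?W" "?T x = ?T y"
      from xy(3) have "cmap d (cinv c x) = cmap d (cinv c y)" unfolding transition_def o_def .
      from arg_cong[OF this, of "cinv d"] have "cinv c x = cinv c y"
        unfolding chart(5)[OF dA(1) WI(3)[OF xy(1)]] chart(5)[OF dA(1) WI(3)[OF xy(2)]] .
      from arg_cong[OF this, of "cmap c"] show "x = y"
        unfolding chart(7)[OF cA(1) WI(1)[OF xy(1)]] chart(7)[OF cA(1) WI(1)[OF xy(2)]] .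
    qed
    have "Ck_on 0 (\<lambda>x. det (matrix (?T' x))) ?W"
    proof (intro Ck_on_det W)
      fix i j
      have "Ck_on 0 (\<lambda>x. ?T' x (axis j 1)) ?W"
        using smooth_on_frechet_derivative[OF transition_smooth[OF cA(1) dA(1)]] unfolding smooth_on_def by blast
      from Ck_on_linear_compose[OF W this bounded_linear_vec_nth[of i]]
      show "Ck_on 0 (\<lambda>x. matrix (?T' x) $ i $ j) ?W" by (simp add: matrix_def)
    qed
    then show "continuous_on ?W (\<lambda>x. det (matrix (?T' x)))" by simp
    show "continuous_on ?W (\<sigma> c)"
      using smooth_on_imp_continuous_on[OF smooth_\<sigma>[OF cA(1)]] WI(1) by (meson continuous_on_subset subsetI)
    show "continuous_on (?T ` ?W) (\<sigma> d)"
      using smooth_on_imp_continuous_on[OF smooth_\<sigma>[OF dA(1)]] TW by (rule continuous_on_subset)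
    show "\<sigma> c x \<ge> 0" if "x \<in> ?W" for x using \<sigma>_pos[OF cA(1) WI(1)[OF that]] by simp
    show "\<sigma> d x \<ge> 0" if "x \<in> ?T ` ?W" for x 
      using less_imp_le[OF \<sigma>_pos[OF dA(1) subsetD[OF TW that]]] .
    show "cmap c q \<in> ?W" using cA dA by blast
    fix S assume S: "compact S" "S \<subseteq> ?W"
    let ?S = "cinv c ` S"
    have SC: "?S \<subseteq> cdom c" "?S \<subseteq> cdom d" using S(2) WI by blast+
    have "compact ?S"
      using S WI(1) by (intro compact_continuous_image continuous_on_subset[OF chart(4)[OF cA(1)]]) auto
    then have Sb: "?S \<in> sets borel" by (intro borel_closed compact_imp_closed)
    have im: "cmap c ` ?S = S" "cmap d ` ?S = ?T ` S"
    proof -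
      have "cmap c (cinv c x) = x" if "x \<in> S" for x using chart(7)[OF cA(1)] WI(1) S(2) that by blast
      then show "cmap c ` ?S = S" by (simp add: image_comp)
      show "cmap d ` ?S = ?T ` S" by (simp add: image_comp transition_def)
    qed
    have "emeasure \<mu> ?S = (\<integral>\<^sup>+x\<in>cmap c ` ?S. ennreal (\<sigma> c x) \<partial>lborel)"
      "emeasure \<mu> ?S = (\<integral>\<^sup>+x\<in>cmap d ` ?S. ennreal (\<sigma> d x) \<partial>lborel)"
      using measure cA(1) dA(1) Sb SC unfolding volume_measure_def by blast+
    then show "(\<integral>\<^sup>+x\<in>S. ennreal (\<sigma> c x) \<partial>lborel) = (\<integral>\<^sup>+y\<in>?T ` S. ennreal (\<sigma> d y) \<partial>lborel)"
      unfolding im by simp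
  qed
  then show ?thesis using transition_cmap[OF c] by (simp add: jac_def)
qed

text \<open>\<open>vol\<close> is evaluated in the chart picked by \<open>chart_at\<close>. Passing
  to c changes the determinant and the density by reciprocal Jacobian factors.\<close>

lemma vol_tvec_of:
  assumes c: "c \<in> charts_at A q"
  shows "vol A \<sigma> q (\<lambda>i. tvec_of A c q (m i)) = \<sigma> c (cmap c q) * \<bar>det (\<chi> i. m i)\<bar>"
proof -
  let ?d = "chart_at A q"
  note d = chart_at_in[of q]
  have "det (\<chi> i. tvec_of A c q (m i) ?d) = det (\<chi> i. matrix (jac c ?d q) *v m i)"
    by (simp add: tvec_of_apply[OF d] matrix_mult_linear_map[OF jac_linear[OF c d]])
  also have "\<dots> = det (matrix (jac c ?d q)) * det (\<chi> i. m i)" by (rule det_rows_linear)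
  finally show ?thesis
    unfolding vol_def Let_def \<sigma>_transform[OF c d] by (simp add: abs_mult mult_ac)
qed

text \<open>The Jacobian enters because \<open>g_form\<close> is evaluated in \<open>chart_at A p\<close> and not in \<open>c\<close>.\<close>

definition polar_factor :: "('m, 'n) chart \<Rightarrow> 'm \<Rightarrow> ('m, 'n) tvec \<Rightarrow> real" where
  "polar_factor c p y = (let d = chart_at A p in
     \<bar>det (matrix (jac d c p))\<bar> / sqrt (det (gl d (cmap d p) (y d))))"

text \<open>A pair (a, e) is encoded by w = a y + e. The polar map applies d exp to a y + r e = B w,
  where B is 1 on y and r on the tangent space of the indicatrix, so det B = r^(n - 1). The product
  metric becomes g_y, as y is a unit vector orthogonal to e. Both sides of the defining equation are
  therefore multiples of |det W|, where W has the rows w i.\<close>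

lemma polar_density_formula:
  assumes y: "y \<in> indicatrix A F p" and c: "c \<in> charts_at A p" and r: "r > 0"
    and q: "finsler_exp A F p (tvec_of A c p (r *\<^sub>R y c)) = q" "c \<in> charts_at A q"
    and L: "\<And>v. dexp A F p (tvec_of A c p (r *\<^sub>R y c)) (tvec_of A c p v) = tvec_of A c q ((1/r) *\<^sub>R (M *v v))"
  shows "polar_density A F \<sigma> p r y =
    r ^ (CARD('n) - 1) * (polar_factor c p y * \<sigma> c (cmap c q) * \<bar>det M\<bar> / r ^ CARD('n))"
proof -
  define d where "d = chart_at A p"
  have d: "d \<in> charts_at A p" unfolding d_def by (rule chart_at_in)
  have yt: "y \<in> tangent_space A p" "F p y = 1" using y by (auto simp: indicatrix_def)
  have dA: "d \<in> A" "cmap d p \<in> cimg d" using d chart(6) by (auto simp: charts_at_iff)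
  let ?y = "y d"
  define g where "g = gl d (cmap d p) ?y"
  have nz: "?y \<noteq> 0" by (rule indicatrix_tangent_iff(2)[OF y d])
  have gpos: "det g > 0" unfolding g_def by (rule gl_det_pos[OF dA nz])
  \<comment> \<open>The covector g(y, .), which is dF at y: its kernel is the tangent space of the
    indicatrix, and l(y) = 1.\<close>
  define l :: "real^'n" where "l = (\<chi> j. pdy j (F2 d) (cmap d p) ?y / 2)"
  have lg: "?y \<bullet> (g *v w) = l \<bullet> w" "w \<bullet> (g *v ?y) = l \<bullet> w" for w
    unfolding g_def gl_radial(2,3)[OF dA nz] by (simp_all add: l_def inner_vec_def sum_divide_distrib)
  have ly: "l \<bullet> ?y = 1"
    using gl_radial(4)[OF dA nz] F_eq_Fl[OF yt(1) d] yt(2) by (simp add: lg(1)[symmetric] g_def)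
  define K where "K = matrix (jac d c p)"
  have K: "K *v w d = w c" if "w \<in> tangent_space A p" for w
    using tangent_jac[OF that d c] matrix_mult_linear_map[OF jac_linear[OF d c]] by (simp add: K_def)
  \<comment> \<open>r on the kernel of l and 1 on y, written as a rank-one update so that
    \<open>det_rank_one_update\<close> gives its determinant.\<close>
  define B where "B = r *\<^sub>R (\<chi> i j. (if i = j then 1 else 0) + ((1 - r)/r) * ?y $ i * l $ j)"
  have B: "B *v w = r *\<^sub>R w + ((1 - r) * (l \<bullet> w)) *\<^sub>R ?y" for w
  proof (simp add: vec_eq_iff, intro allI)
    fix i
    have "B $ i $ j * w $ j = (if j = i then r * w $ j else 0) + (1 - r) * ?y $ i * (l $ j * w $ j)" for j
      using r by (simp add: B_def distrib_left distrib_right)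
    then have "(B *v w) $ i = r * w $ i + (1 - r) * ?y $ i * (\<Sum>j\<in>UNIV. l $ j * w $ j)"
      by (simp add: matrix_vector_mult_def sum.distrib sum_distrib_left[symmetric])
    then show "(B *v w) $ i = r * w $ i + (1 - r) * (l \<bullet> w) * ?y $ i"
      by (simp add: inner_vec_def mult_ac)
  qed
  have "det B = r ^ CARD('n) * (1 + (1 - r)/r * (l \<bullet> ?y))"
    unfolding B_def det_scaleR det_rank_one_update ..
  also have "\<dots> = r ^ CARD('n) / r" using r by (simp add: ly field_simps)
  also have "\<dots> = r ^ (CARD('n) - 1)"
    using r by (subst power_diff) (simp_all add: Suc_leI)
  finally have dB: "det B = r ^ (CARD('n) - 1)" .
  define s where "s = r ^ (CARD('n) - 1) * (polar_factor c p y * \<sigma> c (cmap c q) * \<bar>det M\<bar> / r ^ CARD('n))"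
  have pf: "polar_factor c p y = \<bar>det K\<bar> / sqrt (det g)"
    by (simp add: polar_factor_def Let_def d_def[symmetric] K_def g_def)
  have ry: "tscale r y = tvec_of A c p (r *\<^sub>R y c)"
    using tvec_of_linear(2)[OF c] tvec_of_tangent_self[OF yt(1) c] by metis
  have main: "vol A \<sigma> q (\<lambda>i. dexp A F p (tscale r y) (tlin (a i) y r (e i))) = s * \<bar>det W\<bar> * sqrt (det g)"
    "det (\<chi> i j. a i * a j + g_form A F p y (e i) (e j)) = (det W)\<^sup>2 * det g"
    if e: "\<And>i. e i \<in> indicatrix_tangent A F p y" and W: "W = (\<chi> i. a i *\<^sub>R ?y + e i d)" for a e W
  proof -
    have et: "e i \<in> tangent_space A p" "l \<bullet> e i d = 0" for i
      using e[of i] unfolding indicatrix_tangent_iff(1)[OF y d] lg(1)[unfolded g_def] by auto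
    define w where "w i = a i *\<^sub>R ?y + e i d" for i
    have lw: "l \<bullet> w i = a i" for i by (simp add: w_def inner_add_right ly et(2))
    have Bw: "B *v w i = a i *\<^sub>R ?y + r *\<^sub>R e i d" for i
      unfolding B lw by (simp add: w_def algebra_simps)
    have t: "tlin (a i) y r (e i) = tvec_of A c p (K *v (B *v w i))" for i
    proof -
      have "tlin (a i) y r (e i) \<in> tangent_space A p" using tangent_tlin yt(1) et(1) by blast
      from tvec_of_tangent_self[OF this c] K[OF this] show ?thesis by (simp add: tlin_def Bw)
    qed
    have "vol A \<sigma> q (\<lambda>i. dexp A F p (tscale r y) (tlin (a i) y r (e i)))
        = \<sigma> c (cmap c q) * \<bar>det (\<chi> i. (1/r) *\<^sub>R (M *v (K *v (B *v w i))))\<bar>"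
      unfolding t ry L by (rule vol_tvec_of[OF q(2)])
    also have "(\<chi> i. (1/r) *\<^sub>R (M *v (K *v (B *v w i)))) = (\<chi> i. ((1/r) *\<^sub>R (M ** K ** B)) *v w i)"
      by (simp add: scaleR_matrix_vector_assoc[symmetric] matrix_vector_mul_assoc matrix_mul_assoc)
    also have "det \<dots> = (1/r) ^ CARD('n) * (det M * det K * r ^ (CARD('n) - 1)) * det W"
      unfolding det_rows_linear det_scaleR det_mul dB W w_def ..
    also have "\<sigma> c (cmap c q) * \<bar>\<dots>\<bar> = s * \<bar>det W\<bar> * sqrt (det g)"
      unfolding s_def pf using r gpos by (simp add: abs_mult power_one_over field_simps)
    finally show "vol A \<sigma> q (\<lambda>i. dexp A F p (tscale r y) (tlin (a i) y r (e i))) = s * \<bar>det W\<bar> * sqrt (det g)" .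
    have "a i * a j + g_form A F p y (e i) (e j) = w i \<bullet> (g *v w j)" for i j
    proof -
      have "g_form A F p y (e i) (e j) = e i d \<bullet> (g *v e j d)"
        by (simp add: g_form_def Let_def d_def[symmetric] g_def)
      moreover have "w i \<bullet> (g *v w j) = a i * a j + e i d \<bullet> (g *v e j d)"
        by (simp add: w_def inner_add_left inner_add_right matrix_vector_right_distrib
            matrix_vector_mult_scaleR lg ly et(2))
      ultimately show ?thesis by simp
    qed
    then show "det (\<chi> i j. a i * a j + g_form A F p y (e i) (e j)) = (det W)\<^sup>2 * det g"
      by (simp add: det_gram W w_def)
  qed
  have "polar_density A F \<sigma> p r y = s"
    unfolding polar_density_def
  proof (rule the_equality)
    show "\<forall>a e. (\<forall>i. e i \<in> indicatrix_tangent A F p y) \<longrightarrow>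
      vol A \<sigma> (finsler_exp A F p (tscale r y)) (\<lambda>i. dexp A F p (tscale r y) (tlin (a i) y r (e i))) =
      s * sqrt (det (\<chi> i j. a i * a j + g_form A F p y (e i) (e j)))"
    proof (intro allI impI)
      fix a :: "'n \<Rightarrow> real" and e :: "'n \<Rightarrow> ('m, 'n) tvec" assume e: "\<forall>i. e i \<in> indicatrix_tangent A F p y"
      show "vol A \<sigma> (finsler_exp A F p (tscale r y)) (\<lambda>i. dexp A F p (tscale r y) (tlin (a i) y r (e i))) =
        s * sqrt (det (\<chi> i j. a i * a j + g_form A F p y (e i) (e j)))"
        using main[of e _ a] e q(1) by (simp add: ry real_sqrt_mult)
    qed
  next
    fix s' assume s': "\<forall>a e. (\<forall>i. e i \<in> indicatrix_tangent A F p y) \<longrightarrow>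
      vol A \<sigma> (finsler_exp A F p (tscale r y)) (\<lambda>i. dexp A F p (tscale r y) (tlin (a i) y r (e i))) =
      s' * sqrt (det (\<chi> i j. a i * a j + g_form A F p y (e i) (e j)))"
    \<comment> \<open>The standard basis, decomposed as a i y + e i. Then W is the identity, and det
      g > 0 determines s'.\<close>
    define a where "a i = l $ i" for i
    define e where "e i = tvec_of A d p (axis i 1 - a i *\<^sub>R ?y)" for i
    have la: "l \<bullet> axis i 1 = a i" for i by (simp add: a_def inner_axis)
    have e: "e i \<in> indicatrix_tangent A F p y" for i
      unfolding indicatrix_tangent_iff(1)[OF y d] e_def tvec_of_self[OF d] g_def[symmetric] lg(1)
      using tvec_of_tangent[OF d] by (simp add: inner_diff_right ly la)
    have W: "(mat 1 :: real^'n^'n) = (\<chi> i. a i *\<^sub>R ?y + e i d)"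
      by (simp add: e_def tvec_of_self[OF d] vec_eq_iff mat_def axis_def)
    have "s' * sqrt (det g) = s * sqrt (det g)"
      using s'[rule_format, OF e, of a] main[OF e W] q(1) by (simp add: ry)
    then show "s' = s" using gpos by simp
  qed
  then show ?thesis by (simp add: s_def)
qed

lemma polar_factor_pos:
  assumes y: "y \<in> indicatrix A F p" and c: "c \<in> charts_at A p"
  shows "polar_factor c p y > 0"
proof -
  let ?d = "chart_at A p"
  note d = chart_at_in[of p]
  have "?d \<in> A" "cmap ?d p \<in> cimg ?d" using d chart(6) by (auto simp: charts_at_iff)
  from gl_det_pos[OF this indicatrix_tangent_iff(2)[OF y d]] jac_det_nonzero[OF d c]
  show ?thesis by (simp add: polar_factor_def Let_def)
qed

end

section \<open>Expansion of the density\<close>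

text \<open>R is A'' and enters with its first-order expansion. Integration gives P = 1 + t R(0) +
  t^2/2 R' + o(t^2) and A/t = 1 + t/2 R(0) + t^2/6 R' + o(t^2); the coefficients are grouped as B1 =
  R(0)/2 and B2 = R'/6 to fit \<open>trace_logarithmic_derivative\<close>.\<close>

lemma jacobi_expansion:
  fixes A P R :: "real \<Rightarrow> real^'n^'n"
  assumes \<epsilon>: "\<epsilon> > 0"
    and A: "\<And>t i j. \<bar>t\<bar> < \<epsilon> \<Longrightarrow> ((\<lambda>t. A t $ i $ j) has_real_derivative P t $ i $ j) (at t)"
    and P: "\<And>t i j. \<bar>t\<bar> < \<epsilon> \<Longrightarrow> ((\<lambda>t. P t $ i $ j) has_real_derivative R t $ i $ j) (at t)"
    and R: "\<And>i j. ((\<lambda>t. R t $ i $ j) has_real_derivative R' $ i $ j) (at 0)"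
    and init: "A 0 = 0" "P 0 = mat 1"
  shows "((\<lambda>t. (1/t\<^sup>2) *\<^sub>R ((1/t) *\<^sub>R A t - mat 1 - t *\<^sub>R ((1/2) *\<^sub>R R 0))) \<longlongrightarrow> (1/6) *\<^sub>R R') (at_right 0)"
    and "((\<lambda>t. (1/t\<^sup>2) *\<^sub>R (P t - mat 1 - (2 * t) *\<^sub>R ((1/2) *\<^sub>R R 0))) \<longlongrightarrow> 3 *\<^sub>R ((1/6) *\<^sub>R R')) (at_right 0)"
proof -
  have lim: "(f \<longlongrightarrow> f 0) (at_right 0)" if "(f has_real_derivative D) (at 0)" for f D
    using DERIV_isCont[OF that] by (simp add: isCont_def filterlim_at_split)
  have A0: "((\<lambda>t. A t $ i $ j) has_real_derivative P 0 $ i $ j) (at 0)"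
    and P0: "((\<lambda>t. P t $ i $ j) has_real_derivative R 0 $ i $ j) (at 0)" for i j
    using A[of 0] P[of 0] \<epsilon> by auto
  have pP: "peano (Suc (Suc 0)) (\<lambda>k. if k = 0 then P 0 $ i $ j else
      (if k - 1 = 0 then R 0 $ i $ j else R' $ i $ j) / real k) (\<lambda>t. P t $ i $ j)" for i j
  proof (rule peano_integrate[OF _ lim[OF P0] peano_1_derivative[OF R]])
    show "eventually (\<lambda>t. ((\<lambda>t. P t $ i $ j) has_real_derivative R t $ i $ j) (at t)) (at_right 0)"
      by (rule eventually_at_right_0I[OF \<epsilon>]) (use P in auto)
  qed
  have pA: "peano (Suc (Suc (Suc 0))) (\<lambda>k. if k = 0 then A 0 $ i $ j else (if k - 1 = 0 then P 0 $ i $ j else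
      (if k - 1 - 1 = 0 then R 0 $ i $ j else R' $ i $ j) / real (k - 1)) / real k) (\<lambda>t. A t $ i $ j)" for i j
  proof (rule peano_integrate[OF _ lim[OF A0] pP])
    show "eventually (\<lambda>t. ((\<lambda>t. A t $ i $ j) has_real_derivative P t $ i $ j) (at t)) (at_right 0)"
      by (rule eventually_at_right_0I[OF \<epsilon>]) (use A in auto)
  qed
  show "((\<lambda>t. (1/t\<^sup>2) *\<^sub>R (P t - mat 1 - (2 * t) *\<^sub>R ((1/2) *\<^sub>R R 0))) \<longlongrightarrow> 3 *\<^sub>R ((1/6) *\<^sub>R R')) (at_right 0)"
  proof (rule tendsto_matrixI)
    fix i j
    have "((\<lambda>t. (P t $ i $ j - (mat 1 $ i $ j + t * R 0 $ i $ j)) / t\<^sup>2) \<longlongrightarrow> R' $ i $ j / 2) (at_right 0)"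
      using peano_Suc_limit[OF pP[of i j]] init by (simp add: power2_eq_square mult_ac)
    moreover have ev: "eventually (\<lambda>t. (P t $ i $ j - (mat 1 $ i $ j + t * R 0 $ i $ j)) / t\<^sup>2
        = ((1/t\<^sup>2) *\<^sub>R (P t - mat 1 - (2 * t) *\<^sub>R ((1/2) *\<^sub>R R 0))) $ i $ j) (at_right 0)"
      using eventually_at_right_less[of "0::real"] by eventually_elim (simp add: diff_diff_eq)
    ultimately show "((\<lambda>t. ((1/t\<^sup>2) *\<^sub>R (P t - mat 1 - (2 * t) *\<^sub>R ((1/2) *\<^sub>R R 0))) $ i $ j) \<longlongrightarrow> (3 *\<^sub>R ((1/6) *\<^sub>R R')) $ i $ j) (at_right 0)"
      unfolding tendsto_cong[OF ev, symmetric] by simp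
  qed
  show "((\<lambda>t. (1/t\<^sup>2) *\<^sub>R ((1/t) *\<^sub>R A t - mat 1 - t *\<^sub>R ((1/2) *\<^sub>R R 0))) \<longlongrightarrow> (1/6) *\<^sub>R R') (at_right 0)"
  proof (rule tendsto_matrixI)
    fix i j
    have "((\<lambda>t. (A t $ i $ j - (t * mat 1 $ i $ j + t\<^sup>2 * (R 0 $ i $ j / 2))) / t ^ 3) \<longlongrightarrow> R' $ i $ j / 6) (at_right 0)"
      using peano_Suc_limit[OF pA[of i j]] init by (simp add: power2_eq_square power3_eq_cube mult_ac)
    moreover have "eventually (\<lambda>t. (A t $ i $ j - (t * mat 1 $ i $ j + t\<^sup>2 * (R 0 $ i $ j / 2))) / t ^ 3
        = ((1/t\<^sup>2) *\<^sub>R ((1/t) *\<^sub>R A t - mat 1 - t *\<^sub>R ((1/2) *\<^sub>R R 0))) $ i $ j) (at_right 0)"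
      using eventually_at_right_less[of "0::real"]
      by eventually_elim (simp add: field_simps power2_eq_square power3_eq_cube)
    ultimately show "((\<lambda>t. ((1/t\<^sup>2) *\<^sub>R ((1/t) *\<^sub>R A t - mat 1 - t *\<^sub>R ((1/2) *\<^sub>R R 0))) $ i $ j) \<longlongrightarrow> ((1/6) *\<^sub>R R') $ i $ j) (at_right 0)"
      using tendsto_cong by fastforce
  qed
qed

section \<open>Derivatives along the geodesic flow\<close>

context finsler_manifold
begin

text \<open>The derivative along the geodesic vector field y^k d/dx^k - 2 G^k d/dy^k, in partial
  derivatives so as to match the curvature formula.\<close>

definition flow_deriv :: "('m, 'n) chart \<Rightarrow> (real^'n \<Rightarrow> real^'n \<Rightarrow> real) \<Rightarrow> real^'n \<Rightarrow> real^'n \<Rightarrow> real" where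
  "flow_deriv c f x \<xi> = (\<Sum>k\<in>UNIV. pdx k f x \<xi> * \<xi> $ k) - 2 * (\<Sum>k\<in>UNIV. pdy k f x \<xi> * spray A F c x \<xi> $ k)"

lemma flow_deriv_eq:
  assumes "(case_prod f has_derivative D) (at (x, \<xi>))"
  shows "flow_deriv c f x \<xi> = D (geodesic_field c (x, \<xi>))"
  unfolding geodesic_field_def fst_conv snd_conv derivative_pd[OF assms] flow_deriv_def
  by (simp add: sum_distrib_left sum_negf mult_ac)

lemma flow_deriv_curve:
  assumes f: "smooth_on (slit c) (case_prod f)" and u: "u t \<in> slit c" "(u has_vector_derivative geodesic_field c (u t)) (at t)"
  shows "((\<lambda>s. f (fst (u s)) (snd (u s))) has_real_derivative flow_deriv c f (fst (u t)) (snd (u t))) (at t)"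
proof -
  let ?D = "frechet_derivative (case_prod f) (at (u t))"
  have D: "(case_prod f has_derivative ?D) (at (u t))" by (rule smooth_onD[OF f u(1)])
  have "((\<lambda>s. case_prod f (u s)) has_derivative (\<lambda>h. ?D (h *\<^sub>R geodesic_field c (u t)))) (at t)"
    by (rule has_derivative_compose[OF u(2)[unfolded has_vector_derivative_def] D])
  then show ?thesis
    using flow_deriv_eq[of f ?D "fst (u t)" "snd (u t)" c] D linear_scale[OF has_derivative_linear[OF D]]
    unfolding has_field_derivative_def by (simp add: case_prod_beta' mult_commute_abs)
qed

lemma smooth_pd_Gl:
  assumes "c \<in> A"
  shows "smooth_on (slit c) (case_prod (pdx i (Gl c j)))" "smooth_on (slit c) (case_prod (pdy i (Gl c j)))"
  using smooth_on_pd[OF open_slit[OF assms] smooth_Gl[OF assms]] by blast+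

text \<open>The coefficients of the linearized geodesic equation: a solution (M, P) has the
  derivative (P, - 2 G_x M - 2 N P).\<close>

lemma derivative_geodesic_field:
  assumes c: "c \<in> A" and z: "z \<in> slit c"
  shows "fst (frechet_derivative (geodesic_field c) (at z) h) = snd h"
    "snd (frechet_derivative (geodesic_field c) (at z) h) $ i =
      (-2) * ((\<Sum>k\<in>UNIV. pdx k (Gl c i) (fst z) (snd z) * fst h $ k) + (\<Sum>k\<in>UNIV. pdy k (Gl c i) (fst z) (snd z) * snd h $ k))"
proof -
  let ?S = "\<lambda>z. spray A F c (fst z) (snd z)"
  let ?D = "frechet_derivative ?S (at z)"
  have D: "(?S has_derivative ?D) (at z)" by (rule smooth_onD[OF smooth_spray[OF c] z])
  have "(geodesic_field c has_derivative (\<lambda>h. (snd h, (-2) *\<^sub>R ?D h))) (at z)"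
    unfolding geodesic_field_def[abs_def]
    by (intro has_derivative_Pair has_derivative_snd has_derivative_ident has_derivative_scaleR_right D)
  then have G: "frechet_derivative (geodesic_field c) (at z) = (\<lambda>h. (snd h, (-2) *\<^sub>R ?D h))"
    by (rule frechet_derivative_at[symmetric])
  show "fst (frechet_derivative (geodesic_field c) (at z) h) = snd h" unfolding G by simp
  have "(case_prod (Gl c i) has_derivative (\<lambda>h. ?D h $ i)) (at (fst z, snd z))"
    using bounded_linear.has_derivative[OF bounded_linear_vec_nth D, of i] by (simp add: case_prod_beta')
  from derivative_pd[OF this, of "fst h" "snd h"]
  show "snd (frechet_derivative (geodesic_field c) (at z) h) $ i =
      (-2) * ((\<Sum>k\<in>UNIV. pdx k (Gl c i) (fst z) (snd z) * fst h $ k) + (\<Sum>k\<in>UNIV. pdy k (Gl c i) (fst z) (snd z) * snd h $ k))"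
    unfolding G by simp
qed

text \<open>The trace of the nonlinear connection N^i_j = dG^i/dy^j.\<close>

definition trN :: "('m, 'n) chart \<Rightarrow> real^'n \<Rightarrow> real^'n \<Rightarrow> real" where
  "trN c x \<xi> = (\<Sum>i\<in>UNIV. pdy i (Gl c i) x \<xi>)"

lemma trN_homogeneous:
  assumes "c \<in> A" "x \<in> cimg c" "a > 0" "\<xi> \<noteq> 0"
  shows "trN c x (a *\<^sub>R \<xi>) = a * trN c x \<xi>"
proof -
  have "a * pdy i (Gl c i) x (a *\<^sub>R \<xi>) = a ^ 2 * pdy i (Gl c i) x \<xi>" for i
    by (rule homogeneous_pdy)
      (use assms spray_homogeneous smooth_differentiable(2)[OF smooth_Gl] in auto)
  then have "pdy i (Gl c i) x (a *\<^sub>R \<xi>) = a * pdy i (Gl c i) x \<xi>" for i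
    using assms(3) by (simp add: power2_eq_square mult.assoc)
  then show ?thesis by (simp add: trN_def sum_distrib_left)
qed

lemma flow_deriv_trN:
  assumes "c \<in> A" "x \<in> cimg c" "\<xi> \<noteq> 0"
  shows "flow_deriv c (trN c) x \<xi> = (\<Sum>i\<in>UNIV. flow_deriv c (pdy i (Gl c i)) x \<xi>)"
    "(case_prod (trN c) has_derivative (\<lambda>h. \<Sum>i\<in>UNIV. frechet_derivative (case_prod (pdy i (Gl c i))) (at (x, \<xi>)) h)) (at (x, \<xi>))"
proof -
  note D = smooth_differentiable(1)[OF smooth_pd_Gl(2)[OF assms(1)] assms(2,3)]
  show T: "(case_prod (trN c) has_derivative (\<lambda>h. \<Sum>i\<in>UNIV. frechet_derivative (case_prod (pdy i (Gl c i))) (at (x, \<xi>)) h)) (at (x, \<xi>))"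
  proof -
    have "((\<lambda>z. \<Sum>i\<in>UNIV. case_prod (pdy i (Gl c i)) z) has_derivative
        (\<lambda>h. \<Sum>i\<in>UNIV. frechet_derivative (case_prod (pdy i (Gl c i))) (at (x, \<xi>)) h)) (at (x, \<xi>))"
      by (intro has_derivative_sum D)
    then show ?thesis by (simp add: trN_def case_prod_beta')
  qed
  show "flow_deriv c (trN c) x \<xi> = (\<Sum>i\<in>UNIV. flow_deriv c (pdy i (Gl c i)) x \<xi>)"
    unfolding flow_deriv_eq[OF T] flow_deriv_eq[OF D] ..
qed

text \<open>2 F F' = (F^2)' = 0 by conservation of energy, and F > 0 on the slit bundle.\<close>

lemma flow_deriv_F:
  assumes "c \<in> A" "x \<in> cimg c" "\<xi> \<noteq> 0"
  shows "flow_deriv c (Fl c) x \<xi> = 0"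
proof -
  note D = smooth_differentiable(1)[OF smooth_Fl[OF assms(1)] assms(2,3)]
  have D2: "(case_prod (F2 c) has_derivative (\<lambda>h. 2 * Fl c x \<xi> * frechet_derivative (case_prod (Fl c)) (at (x, \<xi>)) h)) (at (x, \<xi>))"
    using has_derivative_power[OF D, of 2] by (simp add: case_prod_beta' mult_ac)
  have "2 * Fl c x \<xi> * flow_deriv c (Fl c) x \<xi> = flow_deriv c (F2 c) x \<xi>"
    unfolding flow_deriv_eq[OF D] flow_deriv_eq[OF D2] ..
  also have "\<dots> = 0" using F2_conserved[OF assms] by (simp add: flow_deriv_def)
  finally show ?thesis using Fl_pos[OF assms] by simp
qed

text \<open>In the trace of the curvature the two middle sums combine to minus the flow derivative
  of dG^i/dy^i, which leaves 2 tr G_x - tr N' - tr N^2.\<close>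

lemma ricci_formula:
  "ricci A F p y = (let c = chart_at A p; x = cmap c p; \<xi> = y c in
     2 * (\<Sum>i\<in>UNIV. pdx i (Gl c i) x \<xi>) - (\<Sum>i\<in>UNIV. flow_deriv c (pdy i (Gl c i)) x \<xi>)
     - (\<Sum>i\<in>UNIV. \<Sum>j\<in>UNIV. pdy j (Gl c i) x \<xi> * pdy i (Gl c j) x \<xi>))"
  by (simp add: ricci_def riemann_curvature_loc_def Let_def trace_eq_sum flow_deriv_def sum.distrib sum_subtractf
      sum_distrib_left mult_ac)

end

section \<open>The second-order expansion of the density\<close>

context finsler_measure
begin

definition dlog\<sigma> :: "('m, 'n) chart \<Rightarrow> real^'n \<Rightarrow> real^'n \<Rightarrow> real" where
  "dlog\<sigma> c x \<xi> = frechet_derivative (\<sigma> c) (at x) \<xi> / \<sigma> c x"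

lemma dlog\<sigma>_scale:
  assumes "c \<in> A" "x \<in> cimg c" shows "dlog\<sigma> c x (a *\<^sub>R \<xi>) = a * dlog\<sigma> c x \<xi>"
  using linear_scale[OF has_derivative_linear[OF smooth_onD[OF smooth_\<sigma>[OF assms(1)] assms(2)]]]
  by (simp add: dlog\<sigma>_def)

lemma smooth_dlog\<sigma>:
  assumes c: "c \<in> A" shows "smooth_on (slit c) (case_prod (dlog\<sigma> c))"
  unfolding smooth_on_def
proof
  fix k
  note o = open_slit[OF c]
  have s: "Ck_on k (\<lambda>z. f (fst z)) (slit c)" if "smooth_on (cimg c) f" for f :: "real^'n \<Rightarrow> real"
    by (rule Ck_on_compose_linear[OF chart(2)[OF c] _ bounded_linear_fst o])
      (use that in \<open>auto simp: smooth_on_def slit_def\<close>)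
  have 1: "Ck_on k (\<lambda>z. frechet_derivative (\<sigma> c) (at (fst z)) (axis i 1)) (slit c)" for i
    by (rule s) (rule smooth_on_frechet_derivative[OF smooth_\<sigma>[OF c]])
  have 2: "Ck_on k (\<lambda>z. \<sigma> c (fst z)) (slit c)" by (rule s[OF smooth_\<sigma>[OF c]])
  have "Ck_on k (\<lambda>z. (\<Sum>i\<in>UNIV. snd z $ i * frechet_derivative (\<sigma> c) (at (fst z)) (axis i 1)) * inverse (\<sigma> c (fst z))) (slit c)"
  proof (intro Ck_on_mult Ck_on_sum Ck_on_inverse o 1 2
      Ck_on_linear[OF bounded_linear_compose[OF bounded_linear_vec_nth bounded_linear_snd]])
    show "\<sigma> c (fst z) \<noteq> 0" if "z \<in> slit c" for z
      using \<sigma>_pos[OF c, of "fst z"] that by (auto simp: slit_def)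
  qed
  then show "Ck_on k (case_prod (dlog\<sigma> c)) (slit c)"
  proof (rule Ck_on_cong[OF o, rotated])
    fix z assume z: "z \<in> slit c"
    have "linear (frechet_derivative (\<sigma> c) (at (fst z)))"
      by (rule has_derivative_linear[OF smooth_onD[OF smooth_\<sigma>[OF c]]]) (use z in \<open>simp add: slit_def mem_Times_iff\<close>)
    from linear_axis_sum[OF this, of "snd z"]
    show "(\<Sum>i\<in>UNIV. snd z $ i * frechet_derivative (\<sigma> c) (at (fst z)) (axis i 1)) * inverse (\<sigma> c (fst z)) = case_prod (dlog\<sigma> c) z"
      by (simp add: dlog\<sigma>_def case_prod_beta' divide_inverse)
  qed
qed

text \<open>The coefficient \<beta> of the overview before \<alpha>' is split off: - 2/3 tr N'
  consists of - tr N', which belongs to \<alpha>', and 1/3 tr N', which belongs to - Ric/3.\<close>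

definition second_coeff :: "('m, 'n) chart \<Rightarrow> real^'n \<Rightarrow> real^'n \<Rightarrow> real" where
  "second_coeff c x \<xi> =
    flow_deriv c (dlog\<sigma> c) x \<xi> - 2/3 * (\<Sum>i\<in>UNIV. pdx i (Gl c i) x \<xi>) - 2/3 * (\<Sum>i\<in>UNIV. flow_deriv c (pdy i (Gl c i)) x \<xi>)
      + 1/3 * (\<Sum>i\<in>UNIV. \<Sum>j\<in>UNIV. pdy j (Gl c i) x \<xi> * pdy i (Gl c j) x \<xi>)"

text \<open>The logarithmic derivative of f is dlog \<sigma> + tr (P M^-1) - n/t, by Jacobi's
  formula and the division by t^n. The singular parts of the last two terms cancel, and the
  first-order expansion of the sum is fed into \<open>peano_logarithmic_derivative\<close>.\<close>

lemma polar_expansion: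
  assumes fc: "forward_complete A F" and y: "y \<in> indicatrix A F p" and c: "c \<in> charts_at A p"
  defines "x \<equiv> cmap c p" and "\<xi> \<equiv> y c"
  defines "f0 \<equiv> polar_factor c p y * \<sigma> c x" and "\<alpha> \<equiv> dlog\<sigma> c x \<xi> - trN c x \<xi>"
    and "\<beta> \<equiv> second_coeff c x \<xi>"
  obtains f where "eventually (\<lambda>r. polar_density A F \<sigma> p r y = r ^ (CARD('n) - 1) * f r) (at_right 0)"
    "peano 2 (\<lambda>j. if j = 0 then f0 else if j = 1 then f0 * \<alpha> else f0 * (\<beta> + \<alpha>\<^sup>2) / 2) f"
proof -
  let ?N = "CARD('n)"
  have cA: "c \<in> A" "x \<in> cimg c" using c chart(6) by (auto simp: charts_at_iff x_def)
  have nz: "\<xi> \<noteq> 0" unfolding \<xi>_def by (rule indicatrix_tangent_iff(2)[OF y c])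
  obtain \<epsilon> u Z where \<epsilon>: "\<epsilon> > 0" and u0: "u 0 = (x, \<xi>)"
    and us: "\<And>t. \<bar>t\<bar> < \<epsilon> \<Longrightarrow> u t \<in> slit c"
    and u': "\<And>t. \<bar>t\<bar> < \<epsilon> \<Longrightarrow> (u has_vector_derivative geodesic_field c (u t)) (at t)"
    and Z0: "\<And>i. Z i 0 = (0, axis i 1)"
    and Z': "\<And>i t. \<bar>t\<bar> < \<epsilon> \<Longrightarrow> (Z i has_vector_derivative frechet_derivative (geodesic_field c) (at (u t)) (Z i t)) (at t)"
    and ex: "\<And>r. 0 < r \<Longrightarrow> r < \<epsilon> \<Longrightarrow> finsler_exp A F p (tvec_of A c p (r *\<^sub>R \<xi>)) = cinv c (fst (u r))"
    and dex: "\<And>r v. 0 < r \<Longrightarrow> r < \<epsilon> \<Longrightarrow> dexp A F p (tvec_of A c p (r *\<^sub>R \<xi>)) (tvec_of A c p v) =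
      tvec_of A c (cinv c (fst (u r))) ((1/r) *\<^sub>R (\<Sum>i\<in>UNIV. v $ i *\<^sub>R fst (Z i r)))"
    by (rule exp_chart[OF fc c nz, folded x_def]) (rule that, assumption+)
  have xs: "fst (u t) \<in> cimg c" if "\<bar>t\<bar> < \<epsilon>" for t using us[OF that] by (auto simp: slit_def mem_Times_iff)
  define M where "M t = (\<chi> i j. fst (Z j t) $ i)" for t
  define P where "P t = (\<chi> i j. snd (Z j t) $ i)" for t
  define Gx where "Gx t = (\<chi> i j. pdx j (Gl c i) (fst (u t)) (snd (u t)))" for t
  define Nm where "Nm t = (\<chi> i j. pdy j (Gl c i) (fst (u t)) (snd (u t)))" for t
  \<comment> \<open>The right-hand side of the linearized geodesic equation, so that R = P' =
    M''.\<close>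
  define R where "R t = (-2) *\<^sub>R (Gx t ** M t + Nm t ** P t)" for t
  define N' where "N' = (\<chi> i j. flow_deriv c (pdy j (Gl c i)) x \<xi>)"
  \<comment> \<open>The derivative of R at 0. The derivative of G_x drops out, being multiplied by M
    0 = 0.\<close>
  define R' where "R' = (-2) *\<^sub>R (Gx 0 + N' + Nm 0 ** R 0)"
  define f where "f r = polar_factor c p y * \<sigma> c (fst (u r)) * \<bar>det (M r)\<bar> / r ^ ?N" for r
  have M0: "M 0 = 0" and P0: "P 0 = mat 1"
    by (auto simp: M_def P_def Z0 vec_eq_iff mat_def axis_def)
  have R0: "R 0 = (-2) *\<^sub>R Nm 0" by (simp add: R_def M0 P0)
  have dens: "eventually (\<lambda>r. polar_density A F \<sigma> p r y = r ^ (?N - 1) * f r) (at_right 0)"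
  proof (rule eventually_at_right_0I[OF \<epsilon>])
    fix r assume r: "0 < r" "r < \<epsilon>"
    let ?q = "cinv c (fst (u r))"
    have rc: "fst (u r) \<in> cimg c" using xs[of r] r by simp
    have Mv: "(\<Sum>i\<in>UNIV. v $ i *\<^sub>R fst (Z i r)) = M r *v v" for v
      by (simp add: M_def vec_eq_iff matrix_vector_mult_def mult.commute)
    show "polar_density A F \<sigma> p r y = r ^ (?N - 1) * f r"
      using polar_density_formula[OF y c r(1) ex[OF r, unfolded \<xi>_def] charts_at_cinv[OF cA(1) rc]
          dex[OF r, unfolded Mv \<xi>_def]] chart(7)[OF cA(1) rc] by (simp add: f_def)
  qed
  have dM: "((\<lambda>t. M t $ i $ j) has_real_derivative P t $ i $ j) (at t)"
    and dP: "((\<lambda>t. P t $ i $ j) has_real_derivative R t $ i $ j) (at t)" if t: "\<bar>t\<bar> < \<epsilon>" for t i j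
  proof -
    note bl = bounded_linear.has_vector_derivative[OF _ Z'[OF t, of j]]
    have "((\<lambda>t. fst (Z j t) $ i) has_vector_derivative fst (frechet_derivative (geodesic_field c) (at (u t)) (Z j t)) $ i) (at t)"
      by (rule bl[OF bounded_linear_compose[OF bounded_linear_vec_nth bounded_linear_fst]])
    then show "((\<lambda>t. M t $ i $ j) has_real_derivative P t $ i $ j) (at t)"
      unfolding derivative_geodesic_field(1)[OF cA(1) us[OF t]] has_real_derivative_iff_has_vector_derivative by (simp add: M_def P_def)
    have "((\<lambda>t. snd (Z j t) $ i) has_vector_derivative snd (frechet_derivative (geodesic_field c) (at (u t)) (Z j t)) $ i) (at t)"
      by (rule bl[OF bounded_linear_compose[OF bounded_linear_vec_nth bounded_linear_snd]])
    then show "((\<lambda>t. P t $ i $ j) has_real_derivative R t $ i $ j) (at t)"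
      unfolding derivative_geodesic_field(2)[OF cA(1) us[OF t]] has_real_derivative_iff_has_vector_derivative
      by (simp add: R_def M_def P_def Gx_def Nm_def matrix_matrix_mult_def)
  qed
  have \<epsilon>0: "\<bar>0\<bar> < \<epsilon>" using \<epsilon> by simp
  note flow0 = flow_deriv_curve[OF _ us[OF \<epsilon>0] u'[OF \<epsilon>0], unfolded u0 fst_conv snd_conv]
  have dR: "((\<lambda>t. R t $ i $ j) has_real_derivative R' $ i $ j) (at 0)" for i j
  proof -
    have dG: "((\<lambda>t. Gx t $ i $ k) has_real_derivative flow_deriv c (pdx k (Gl c i)) x \<xi>) (at 0)" for k
      using flow0[OF smooth_pd_Gl(1)[OF cA(1)]] by (simp add: Gx_def)
    have dN: "((\<lambda>t. Nm t $ i $ k) has_real_derivative N' $ i $ k) (at 0)" for k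
      using flow0[OF smooth_pd_Gl(2)[OF cA(1)]] by (simp add: Nm_def N'_def)
    have PK: "P 0 $ k $ j = (if k = j then 1 else 0)" for k by (simp add: P0 mat_def)
    have d: "((\<lambda>t. (-2) * ((\<Sum>k\<in>UNIV. Gx t $ i $ k * M t $ k $ j) + (\<Sum>k\<in>UNIV. Nm t $ i $ k * P t $ k $ j)))
      has_real_derivative (-2) * ((\<Sum>k\<in>UNIV. flow_deriv c (pdx k (Gl c i)) x \<xi> * M 0 $ k $ j + P 0 $ k $ j * Gx 0 $ i $ k)
        + (\<Sum>k\<in>UNIV. N' $ i $ k * P 0 $ k $ j + R 0 $ k $ j * Nm 0 $ i $ k))) (at 0)"
      by (intro DERIV_cmult DERIV_add DERIV_sum DERIV_mult dG dN dM dP \<epsilon>0)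
    have c1: "(\<Sum>k\<in>UNIV. flow_deriv c (pdx k (Gl c i)) x \<xi> * M 0 $ k $ j + P 0 $ k $ j * Gx 0 $ i $ k) = Gx 0 $ i $ j"
      by (simp add: M0 PK if_distrib if_distribR cong: if_cong)
    have "(\<Sum>k\<in>UNIV. N' $ i $ k * P 0 $ k $ j) = N' $ i $ j"
      by (simp add: PK if_distrib if_distribR cong: if_cong)
    then have c2: "(\<Sum>k\<in>UNIV. N' $ i $ k * P 0 $ k $ j + R 0 $ k $ j * Nm 0 $ i $ k)
        = N' $ i $ j + (\<Sum>k\<in>UNIV. Nm 0 $ i $ k * R 0 $ k $ j)"
      by (simp only: sum.distrib) (simp add: mult.commute)
    have e1: "R' $ i $ j = (-2) * (Gx 0 $ i $ j + (N' $ i $ j + (\<Sum>k\<in>UNIV. Nm 0 $ i $ k * R 0 $ k $ j)))"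
      by (simp add: R'_def matrix_matrix_mult_def)
    have fe: "(\<lambda>t. R t $ i $ j) = (\<lambda>t. (-2) * ((\<Sum>k\<in>UNIV. Gx t $ i $ k * M t $ k $ j) + (\<Sum>k\<in>UNIV. Nm t $ i $ k * P t $ k $ j)))"
      by (simp add: R_def matrix_matrix_mult_def)
    show ?thesis using d unfolding c1 c2 fe e1 .
  qed
  define B1 where "B1 = (1/2) *\<^sub>R R 0"
  define B2 where "B2 = (1/6) *\<^sub>R R'"
  have "((\<lambda>t. (1/t\<^sup>2) *\<^sub>R ((1/t) *\<^sub>R M t - mat 1 - t *\<^sub>R B1)) \<longlongrightarrow> B2) (at_right 0)"
    "((\<lambda>t. (1/t\<^sup>2) *\<^sub>R (P t - mat 1 - (2 * t) *\<^sub>R B1)) \<longlongrightarrow> 3 *\<^sub>R B2) (at_right 0)"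
    unfolding B1_def B2_def by (rule jacobi_expansion[OF \<epsilon> dM dP dR M0 P0]; assumption)+
  note T = trace_logarithmic_derivative[OF this]
  define l where "l r = dlog\<sigma> c (fst (u r)) (snd (u r)) + (trace (P r ** matrix_inv (M r)) - real ?N / r)" for r
  have dlog: "((\<lambda>t. dlog\<sigma> c (fst (u t)) (snd (u t))) has_real_derivative flow_deriv c (dlog\<sigma> c) x \<xi>) (at 0)"
    using flow0[OF smooth_dlog\<sigma>[OF cA(1)]] .
  have tB1: "trace B1 = - trN c x \<xi>"
    by (simp add: B1_def R0 trace_eq_sum Nm_def u0 trN_def sum_negf)
  \<comment> \<open>With B1 = - N and R(0) = - 2 N one gets 2 B2 = - 2/3 (G_x + N' - 2 N^2);
    subtracting B1^2 = N^2 leaves 1/3 N^2.\<close>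
  have tB2: "trace (2 *\<^sub>R B2 - B1 ** B1) = \<beta> - flow_deriv c (dlog\<sigma> c) x \<xi>"
  proof -
    have B1N: "B1 = - Nm 0" by (simp add: B1_def R0)
    have NN: "trace (Nm 0 ** Nm 0) = (\<Sum>i\<in>UNIV. \<Sum>j\<in>UNIV. pdy j (Gl c i) x \<xi> * pdy i (Gl c j) x \<xi>)"
      by (simp add: trace_eq_sum matrix_matrix_mult_def Nm_def u0)
    have B11: "B1 ** B1 = Nm 0 ** Nm 0" unfolding B1N by (simp add: vec_eq_iff matrix_matrix_mult_def)
    have "Nm 0 ** R 0 = (-2) *\<^sub>R (Nm 0 ** Nm 0)" unfolding R0 by (rule matrix_mult_linear(2))
    then have "2 *\<^sub>R B2 - B1 ** B1 = (-2/3) *\<^sub>R Gx 0 - (2/3) *\<^sub>R N' + (1/3) *\<^sub>R (Nm 0 ** Nm 0)"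
      unfolding B2_def R'_def B11 by (simp add: vec_eq_iff algebra_simps)
    then have "trace (2 *\<^sub>R B2 - B1 ** B1) = (-2/3) * trace (Gx 0) - (2/3) * trace N' + (1/3) * trace (Nm 0 ** Nm 0)"
      by (simp add: trace_eq_sum sum_subtractf sum.distrib sum_distrib_left)
    then show ?thesis
      unfolding NN by (simp add: \<beta>_def second_coeff_def trace_eq_sum Gx_def N'_def u0)
  qed
  have lim0: "(g \<longlongrightarrow> g 0) (at_right 0)" if "(g has_real_derivative D) (at 0)" for g D
    using DERIV_isCont[OF that] by (simp add: isCont_def filterlim_at_split)
  have l1: "(l \<longlongrightarrow> \<alpha>) (at_right 0)"
    using tendsto_add[OF lim0[OF dlog] T(3)] unfolding l_def[abs_def] tB1 by (simp add: u0 \<alpha>_def)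
  have l2: "((\<lambda>r. (l r - \<alpha>) / r) \<longlongrightarrow> \<beta>) (at_right 0)"
  proof -
    have "((\<lambda>r. (dlog\<sigma> c (fst (u r)) (snd (u r)) - dlog\<sigma> c x \<xi>) / r) \<longlongrightarrow> flow_deriv c (dlog\<sigma> c) x \<xi>) (at_right 0)"
      using dlog unfolding has_field_derivative_iff by (simp add: u0 filterlim_at_split)
    from tendsto_add[OF this T(4)]
    show ?thesis unfolding tB1 tB2 l_def \<alpha>_def by (simp add: add_divide_distrib[symmetric] algebra_simps)
  qed
  have \<sigma>D: "((\<lambda>t. \<sigma> c (fst (u t))) has_real_derivative \<sigma> c (fst (u t)) * dlog\<sigma> c (fst (u t)) (snd (u t))) (at t)"
    if t: "\<bar>t\<bar> < \<epsilon>" for t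
  proof -
    have D: "(\<sigma> c has_derivative frechet_derivative (\<sigma> c) (at (fst (u t)))) (at (fst (u t)))"
      by (rule smooth_onD[OF smooth_\<sigma>[OF cA(1)] xs[OF t]])
    have "((\<lambda>t. fst (u t)) has_derivative (\<lambda>h. h *\<^sub>R snd (u t))) (at t)"
      using bounded_linear.has_vector_derivative[OF bounded_linear_fst u'[OF t]]
      by (simp add: has_vector_derivative_def geodesic_field_def)
    from has_derivative_compose[OF this D]
    have "((\<lambda>t. \<sigma> c (fst (u t))) has_real_derivative frechet_derivative (\<sigma> c) (at (fst (u t))) (snd (u t))) (at t)"
      unfolding has_field_derivative_def by (simp add: linear_scale[OF has_derivative_linear[OF D]] mult_commute_abs)
    then show ?thesis using \<sigma>_pos[OF cA(1) xs[OF t]] by (simp add: dlog\<sigma>_def)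
  qed
  \<comment> \<open>f without the absolute value, which is the version to differentiate; the two
    agree for small r > 0, where det (M r) > 0.\<close>
  define fd where "fd r = polar_factor c p y * \<sigma> c (fst (u r)) * det (M r) / r ^ ?N" for r
  have fdf: "eventually (\<lambda>r. fd r = f r) (at_right 0)"
    using T(1) by eventually_elim (simp add: fd_def f_def)
  have rng: "eventually (\<lambda>r. 0 < r \<and> r < \<epsilon>) (at_right 0)" by (rule eventually_at_right_0I[OF \<epsilon>]) simp
  have fder: "eventually (\<lambda>r. (fd has_real_derivative fd r * l r) (at r)) (at_right 0)"
    using T(1) rng
  proof eventually_elim
    case (elim r)
    then have r: "0 < r" "\<bar>r\<bar> < \<epsilon>" by auto
    have "matrix_inv (M r) ** M r = mat 1" using elim by (intro matrix_inv_mult) simp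
    then have K: "P r = (P r ** matrix_inv (M r)) ** M r" by (simp add: matrix_mul_assoc[symmetric])
    note d = has_real_derivative_det[OF dM[OF r(2)] K]
    have p: "((\<lambda>r. inverse (r ^ ?N)) has_real_derivative - (real ?N / r) * inverse (r ^ ?N)) (at r)"
    proof -
      have "((\<lambda>r. inverse (r ^ ?N)) has_real_derivative - (inverse (r ^ ?N) * (real ?N * r ^ (?N - Suc 0)) * inverse (r ^ ?N))) (at r)"
        by (rule DERIV_inverse'[OF DERIV_pow]) (use r in simp)
      moreover have "r ^ (?N - Suc 0) = r ^ ?N / r" using r by (subst power_diff) (simp_all add: Suc_leI)
      ultimately show ?thesis using r by (simp add: field_simps)
    qed
    have "((\<lambda>r. polar_factor c p y * (\<sigma> c (fst (u r)) * (det (M r) * inverse (r ^ ?N)))) has_real_derivative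
      polar_factor c p y * ((\<sigma> c (fst (u r)) * dlog\<sigma> c (fst (u r)) (snd (u r))) * (det (M r) * inverse (r ^ ?N))
        + ((trace (P r ** matrix_inv (M r)) * det (M r)) * inverse (r ^ ?N)
          + (- (real ?N / r) * inverse (r ^ ?N)) * det (M r)) * \<sigma> c (fst (u r)))) (at r)"
      by (intro DERIV_cmult DERIV_mult d p \<sigma>D r)
    then show ?case unfolding fd_def[abs_def] l_def
      by (simp add: divide_inverse algebra_simps)
  qed
  have flim: "(fd \<longlongrightarrow> f0) (at_right 0)"
  proof -
    have "((\<lambda>r. polar_factor c p y * \<sigma> c (fst (u r)) * (det (M r) / r ^ ?N)) \<longlongrightarrow> polar_factor c p y * \<sigma> c (fst (u 0)) * 1) (at_right 0)"
      by (intro tendsto_intros T(2) lim0[OF \<sigma>D[OF \<epsilon>0]])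
    then show ?thesis by (simp add: fd_def[abs_def] f0_def u0)
  qed
  have "peano 2 (\<lambda>j. if j = 0 then f0 else if j = 1 then f0 * \<alpha> else f0 * (\<beta> + \<alpha>\<^sup>2) / 2) f"
    by (rule peano_cong[OF peano_logarithmic_derivative[OF fder flim l1 l2] fdf]) simp
  with dens show ?thesis using that by blast
qed

section \<open>Distortion and S-curvature\<close>

lemma polar_factor_chart_at:
  assumes y: "y \<in> indicatrix A F p"
  defines "c \<equiv> chart_at A p"
  shows "polar_factor c p y * \<sigma> c (cmap c p) = exp (- distortion A F \<sigma> p y)"
proof -
  have c: "c \<in> charts_at A p" unfolding c_def by (rule chart_at_in)
  have cA: "c \<in> A" "cmap c p \<in> cimg c" using c chart(6) by (auto simp: charts_at_iff)
  have g: "det (gl c (cmap c p) (y c)) > 0"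
    by (rule gl_det_pos[OF cA indicatrix_tangent_iff(2)[OF y c]])
  have "det (matrix (jac c c p)) = 1"
    unfolding jac_id[OF c] by (simp add: matrix_id_mat_1)
  then show ?thesis
    using g \<sigma>_pos[OF cA]
    by (simp add: polar_factor_def distortion_def Let_def c_def[symmetric] exp_minus)
qed

text \<open>g has degree 0 in the fibre. Together with \<open>unit_vector\<close> this carries
  constancy of the distortion from unit vectors to all nonzero ones, such as velocities of geodesics
  whose length has not been computed.\<close>

lemma distortion_scale:
  assumes "v \<in> tangent_space A p" "c \<in> charts_at A p" "v c \<noteq> 0" "a > 0"
  shows "distortion A F \<sigma> p (tscale a v) = distortion A F \<sigma> p v"
proof -
  let ?d = "chart_at A p"
  note d = chart_at_in[of p]
  have dA: "?d \<in> A" "cmap ?d p \<in> cimg ?d" using d chart(6) by (auto simp: charts_at_iff)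
  have "v ?d \<noteq> 0"
  proof
    assume "v ?d = 0"
    then show False
      using tangent_jac[OF assms(1) d assms(2)] assms(3) linear_0[OF jac_linear[OF d assms(2)]] by simp
  qed
  from gl_homogeneous[OF dA assms(4) this] show ?thesis by (simp add: distortion_def Let_def tscale_def)
qed

lemma unit_vector:
  assumes "v \<in> tangent_space A p" "c \<in> charts_at A p" "v c \<noteq> 0"
  shows "F p v > 0" "tscale (1 / F p v) v \<in> indicatrix A F p"
proof -
  have cA: "c \<in> A" "cmap c p \<in> cimg c" using assms(2) chart(6) by (auto simp: charts_at_iff)
  show pos: "F p v > 0" unfolding F_eq_Fl[OF assms(1,2)] by (rule Fl_pos[OF cA assms(3)])
  have "F p (tscale (1 / F p v) v) = 1"
    using finsler assms(1) pos by (simp add: finsler_structure_def)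
  then show "tscale (1 / F p v) v \<in> indicatrix A F p"
    using tangent_tlin(2)[OF assms(1,1)] by (simp add: indicatrix_def)
qed

text \<open>For short times a geodesic through p stays in the chart and its velocity stays nonzero,
  so the distortion along it is constant. The existence of a two-sided geodesic matters too: without
  one the definite description in \<open>S_curvature\<close> would not be determined.\<close>

lemma S_curvature_eq_0:
  assumes fc: "forward_complete A F"
    and dist: "\<And>p y. y \<in> indicatrix A F p \<Longrightarrow> distortion A F \<sigma> p y = \<tau>"
    and y: "y \<in> indicatrix A F p"
  shows "S_curvature A F \<sigma> p y = 0"
proof -
  have const: "distortion A F \<sigma> q v = \<tau>" if "v \<in> tangent_space A q" "c \<in> charts_at A q" "v c \<noteq> 0" for q v c
    using dist[OF unit_vector(2)[OF that]] distortion_scale[OF that, of "1 / F q v"] unit_vector(1)[OF that] by simp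
  let ?c = "chart_at A p"
  note c = chart_at_in[of p]
  have cA: "?c \<in> A" "p \<in> cdom ?c" using c by (auto simp: charts_at_iff)
  have nz: "y ?c \<noteq> 0" by (rule indicatrix_tangent_iff(2)[OF y c])
  have yt: "y \<in> tangent_space A p" using y by (simp add: indicatrix_def)
  have der: "((\<lambda>t. distortion A F \<sigma> (\<eta> t) (velocity A {-\<epsilon><..<\<epsilon>} \<eta> t)) has_real_derivative 0) (at 0)"
    if \<epsilon>: "\<epsilon> > 0" and g: "geodesic_from A F {-\<epsilon><..<\<epsilon>} p y \<eta>" for \<epsilon> \<eta>
  proof -
    let ?I = "{-\<epsilon><..<\<epsilon>}"
    have go: "geodesic_on A F ?I \<eta>" "\<eta> 0 = p" "velocity A ?I \<eta> 0 = y" using g by (auto simp: geodesic_from_def)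
    have at: "at t within ?I = at t" if "t \<in> ?I" for t
      by (rule at_within_open[OF that open_greaterThanLessThan])
    have I0: "0 \<in> ?I" using \<epsilon> by simp
    have "open (\<eta> -` cdom ?c \<inter> ?I)"
      using go(1) chart(1)[OF cA(1)] continuous_on_open_vimage[of ?I \<eta>] by (simp add: geodesic_on_def)
    then have "eventually (\<lambda>t. t \<in> \<eta> -` cdom ?c \<inter> ?I) (nhds 0)"
      by (rule eventually_nhds_in_open) (use cA(2) go(2) I0 in simp)
    then have "eventually (\<lambda>t. \<eta> t \<in> cdom ?c) (nhds 0)" by eventually_elim simp
    moreover have "eventually (\<lambda>t. velocity A ?I \<eta> t ?c \<noteq> 0) (nhds 0)"
    proof -
      have "((\<lambda>s. velocity A ?I \<eta> s ?c) has_vector_derivative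
          (-2) *\<^sub>R spray A F ?c (cmap ?c (\<eta> 0)) (velocity A ?I \<eta> 0 ?c)) (at 0 within ?I)"
        using go(1,2) I0 c unfolding geodesic_on_def by blast
      then have "isCont (\<lambda>s. velocity A ?I \<eta> s ?c) 0"
        unfolding at[OF I0] by (rule has_vector_derivative_continuous)
      then have "((\<lambda>s. velocity A ?I \<eta> s ?c) \<longlongrightarrow> y ?c) (at 0)" unfolding isCont_def go(3) .
      from tendsto_imp_eventually_ne[OF this nz] show ?thesis
        using nz go(3) by (simp add: eventually_nhds_conv_at)
    qed
    moreover have "eventually (\<lambda>t. t \<in> ?I) (nhds 0)" using I0 by (intro eventually_nhds_in_open) auto
    ultimately have "eventually (\<lambda>t. distortion A F \<sigma> (\<eta> t) (velocity A ?I \<eta> t) = \<tau>) (nhds 0)"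
    proof eventually_elim
      case (elim t)
      have "velocity A ?I \<eta> t \<in> tangent_space A (\<eta> t)"
        by (rule velocity_tangent[OF go(1)]) (use elim at in auto)
      then show ?case using const[of _ "\<eta> t" ?c] elim cA by (simp add: charts_at_iff)
    qed
    then show ?thesis using DERIV_cong_ev[OF refl _ refl, of _ "\<lambda>t. \<tau>" 0 0] by simp
  qed
  obtain \<epsilon> \<eta> where ge: "\<epsilon> > 0" "geodesic_from A F {-\<epsilon><..<\<epsilon>} p (tvec_of A ?c p (y ?c)) \<eta>"
    by (rule exp_chart[OF fc c nz]) blast
  then have ge': "geodesic_from A F {-\<epsilon><..<\<epsilon>} p y \<eta>" using tvec_of_tangent_self[OF yt c] by simp
  show ?thesis unfolding S_curvature_def
  proof (rule the_equality)
    show "\<exists>\<epsilon>>0. \<exists>\<eta>. geodesic_from A F {-\<epsilon><..<\<epsilon>} p y \<eta> \<and>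
      ((\<lambda>t. distortion A F \<sigma> (\<eta> t) (velocity A {-\<epsilon><..<\<epsilon>} \<eta> t)) has_real_derivative 0) (at 0)"
      using ge(1) ge' der by blast
    show "s = 0" if "\<exists>\<epsilon>>0. \<exists>\<eta>. geodesic_from A F {-\<epsilon><..<\<epsilon>} p y \<eta> \<and>
      ((\<lambda>t. distortion A F \<sigma> (\<eta> t) (velocity A {-\<epsilon><..<\<epsilon>} \<eta> t)) has_real_derivative s) (at 0)" for s
      using that der DERIV_unique by blast
  qed
qed

text \<open>The density is r^(n - 1) f, so its derivative of order n - 1 + i at 0 fixes the i-th
  coefficient of f. As n > 1, the orders for i = 0, 1, 2 all lie in the range k >= 1 of the
  definition.\<close>

lemma infinitesimal_harmonic_coefficients:
  assumes n: "CARD('n) > 1" and fc: "forward_complete A F" and ih: "infinitesimal_harmonic A F \<sigma>"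
  obtains a0 a1 a2 where
    "\<And>p y c. y \<in> indicatrix A F p \<Longrightarrow> c \<in> charts_at A p \<Longrightarrow> polar_factor c p y * \<sigma> c (cmap c p) = a0"
    "\<And>p y c. y \<in> indicatrix A F p \<Longrightarrow> c \<in> charts_at A p \<Longrightarrow> dlog\<sigma> c (cmap c p) (y c) - trN c (cmap c p) (y c) = a1"
    "\<And>p y c. y \<in> indicatrix A F p \<Longrightarrow> c \<in> charts_at A p \<Longrightarrow> second_coeff c (cmap c p) (y c) = a2"
proof -
  let ?m = "CARD('n) - 1"
  have m: "?m \<ge> 1" using n by simp
  have "\<exists>b. \<forall>p. \<forall>y\<in>indicatrix A F p. has_radial_derivative (?m + i) (\<lambda>r. polar_density A F \<sigma> p r y) b" for i
    using ih m unfolding infinitesimal_harmonic_def by (metis trans_le_add1)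
  then obtain b where b: "\<And>i p y. y \<in> indicatrix A F p \<Longrightarrow> has_radial_derivative (?m + i) (\<lambda>r. polar_density A F \<sigma> p r y) (b i)"
    by metis
  define a where "a i = b i / fact (?m + i)" for i
  have key: "f0 = a 0 \<and> f0 * \<alpha> = a 1 \<and> f0 * (\<beta> + \<alpha>\<^sup>2) / 2 = a 2 \<and> f0 > 0"
    if y: "y \<in> indicatrix A F p" and c: "c \<in> charts_at A p"
      and f0: "f0 = polar_factor c p y * \<sigma> c (cmap c p)"
      and \<alpha>: "\<alpha> = dlog\<sigma> c (cmap c p) (y c) - trN c (cmap c p) (y c)"
      and \<beta>: "\<beta> = second_coeff c (cmap c p) (y c)"
    for p y c f0 \<alpha> \<beta>
  proof -
    let ?a = "\<lambda>j::nat. if j = 0 then f0 else if j = 1 then f0 * \<alpha> else f0 * (\<beta> + \<alpha>\<^sup>2) / 2"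
    obtain f where dens: "eventually (\<lambda>r. polar_density A F \<sigma> p r y = r ^ ?m * f r) (at_right 0)"
      and pe: "peano 2 ?a f"
      using polar_expansion[OF fc y c, folded f0 \<alpha> \<beta>] by blast
    have "?a i = a i" if "i \<le> 2" for i
    proof -
      have "b i = fact (?m + i) * ?a i"
        by (rule radial_derivative_times_power[OF has_radial_derivative_cong[OF b[OF y] dens] peano_le[OF that pe] m])
      then show ?thesis by (simp add: a_def)
    qed
    from this[of 0] this[of 1] this[of 2] have "f0 = a 0 \<and> f0 * \<alpha> = a 1 \<and> f0 * (\<beta> + \<alpha>\<^sup>2) / 2 = a 2" by simp
    moreover have "f0 > 0"
      using polar_factor_pos[OF y c] \<sigma>_pos[of c "cmap c p"] c chart(6) unfolding f0 by (simp add: charts_at_iff)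
    ultimately show ?thesis by blast
  qed
  \<comment> \<open>The constants solve f0 \<alpha> = a 1 and f0 (\<beta> + \<alpha>^2)/2 = a 2 for
    \<alpha> and \<beta>, where f0 = a 0 is positive.\<close>
  show ?thesis
  proof (rule that[of "a 0" "a 1 / a 0" "2 * a 2 / a 0 - (a 1 / a 0)\<^sup>2"])
    fix p y c assume yc: "y \<in> indicatrix A F p" "c \<in> charts_at A p"
    define f0 where "f0 = polar_factor c p y * \<sigma> c (cmap c p)"
    define \<alpha> where "\<alpha> = dlog\<sigma> c (cmap c p) (y c) - trN c (cmap c p) (y c)"
    define \<beta> where "\<beta> = second_coeff c (cmap c p) (y c)"
    have k: "f0 = a 0" "f0 * \<alpha> = a 1" "f0 * (\<beta> + \<alpha>\<^sup>2) / 2 = a 2" "f0 > 0"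
      using key[OF yc f0_def \<alpha>_def \<beta>_def] by blast+
    show "polar_factor c p y * \<sigma> c (cmap c p) = a 0" using k(1) unfolding f0_def .
    have \<alpha>: "\<alpha> = a 1 / a 0" using k by (simp add: field_simps)
    then show "dlog\<sigma> c (cmap c p) (y c) - trN c (cmap c p) (y c) = a 1 / a 0" unfolding \<alpha>_def .
    have "\<beta> + \<alpha>\<^sup>2 = 2 * a 2 / a 0" using k(3,4) unfolding k(1) by (simp add: field_simps)
    then have "\<beta> = 2 * a 2 / a 0 - (a 1 / a 0)\<^sup>2" unfolding \<alpha> by linarith
    then show "second_coeff c (cmap c p) (y c) = 2 * a 2 / a 0 - (a 1 / a 0)\<^sup>2" unfolding \<beta>_def .
  qed
qed

text \<open>Homogeneity of degree 1 turns the equation on unit vectors into dlog \<sigma> = tr N + C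
  F on the slit bundle of the chart. This set is open, so the equation may be differentiated along
  the flow, and F contributes nothing by \<open>flow_deriv_F\<close>.\<close>

lemma flow_deriv_dlog\<sigma>:
  assumes C: "\<And>p y c. y \<in> indicatrix A F p \<Longrightarrow> c \<in> charts_at A p \<Longrightarrow>
      dlog\<sigma> c (cmap c p) (y c) - trN c (cmap c p) (y c) = C"
    and c: "c \<in> A" "x \<in> cimg c" "\<xi> \<noteq> 0"
  shows "flow_deriv c (dlog\<sigma> c) x \<xi> = flow_deriv c (trN c) x \<xi>"
proof -
  have eq: "dlog\<sigma> c z \<eta> = trN c z \<eta> + C * Fl c z \<eta>" if z: "z \<in> cimg c" "\<eta> \<noteq> 0" for z \<eta>
  proof -
    let ?q = "cinv c z" and ?v = "tvec_of A c (cinv c z) \<eta>"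
    have q: "c \<in> charts_at A ?q" "cmap c ?q = z" using charts_at_cinv[OF c(1) z(1)] chart(7)[OF c(1) z(1)] by auto
    have v: "?v \<in> tangent_space A ?q" "?v c = \<eta>" using tvec_of_tangent[OF q(1)] tvec_of_self[OF q(1)] by auto
    have vn: "?v c \<noteq> 0" using v z by simp
    have Fv: "F ?q ?v = Fl c z \<eta>" by (simp add: F_loc_def)
    \<comment> \<open>Normalizes \<eta> to unit length; the factor a cancels again since all terms
      have degree 1.\<close>
    define a where "a = 1 / Fl c z \<eta>"
    have a: "a > 0" "a * Fl c z \<eta> = 1" using Fl_pos[OF c(1) z] by (auto simp: a_def)
    have "dlog\<sigma> c z (a *\<^sub>R \<eta>) - trN c z (a *\<^sub>R \<eta>) = C"
      using C[OF unit_vector(2)[OF v(1) q(1) vn] q(1)] unfolding Fv q(2) by (simp add: tscale_def v(2) a_def)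
    then have "a * (dlog\<sigma> c z \<eta> - trN c z \<eta>) = a * (C * Fl c z \<eta>)"
      using a(2) by (simp add: dlog\<sigma>_scale[OF c(1) z(1)] trN_homogeneous[OF c(1) z(1) a(1) z(2)] algebra_simps)
    then show ?thesis using a(1) by simp
  qed
  note DT = flow_deriv_trN(2)[OF c] and DF = smooth_differentiable(1)[OF smooth_Fl[OF c(1)] c(2,3)]
  have eq': "(case z of (x, \<xi>) \<Rightarrow> trN c x \<xi>) + C * (case z of (x, \<xi>) \<Rightarrow> Fl c x \<xi>) = case_prod (dlog\<sigma> c) z" if "z \<in> slit c" for z
    using eq[of "fst z" "snd z"] that by (simp add: slit_def mem_Times_iff case_prod_beta')
  have "(case_prod (dlog\<sigma> c) has_derivative (\<lambda>h. (\<Sum>i\<in>UNIV. frechet_derivative (case_prod (pdy i (Gl c i))) (at (x, \<xi>)) h)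
      + C * frechet_derivative (case_prod (Fl c)) (at (x, \<xi>)) h)) (at (x, \<xi>))"
    by (rule has_derivative_transform_within_open[OF has_derivative_add[OF DT has_derivative_mult_right[OF DF]] open_slit[OF c(1)]])
      (use c in \<open>simp add: slit_iff\<close>, rule eq')
  from flow_deriv_eq[OF this] show ?thesis
    using flow_deriv_F[OF c] unfolding flow_deriv_eq[OF DT] flow_deriv_eq[OF DF] by simp
qed

text \<open>The leading coefficient fixes the distortion, which settles the S-curvature. For the
  Ricci curvature, dlog \<sigma> and tr N have the same flow derivative, so that \<beta> reduces to
  - Ric/3.\<close>

theorem infinitesimal_harmonic_curvatures:
  assumes n: "CARD('n) > 1" and fc: "forward_complete A F" and ih: "infinitesimal_harmonic A F \<sigma>"
  shows "constant_S_curvature A F \<sigma>" "constant_ricci_curvature A F"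
proof -
  obtain a0 a1 a2 where
    a0: "\<And>p y c. y \<in> indicatrix A F p \<Longrightarrow> c \<in> charts_at A p \<Longrightarrow> polar_factor c p y * \<sigma> c (cmap c p) = a0"
    and a1: "\<And>p y c. y \<in> indicatrix A F p \<Longrightarrow> c \<in> charts_at A p \<Longrightarrow> dlog\<sigma> c (cmap c p) (y c) - trN c (cmap c p) (y c) = a1"
    and a2: "\<And>p y c. y \<in> indicatrix A F p \<Longrightarrow> c \<in> charts_at A p \<Longrightarrow> second_coeff c (cmap c p) (y c) = a2"
    using infinitesimal_harmonic_coefficients[OF n fc ih] by blast
  have "distortion A F \<sigma> p y = - ln a0" if "y \<in> indicatrix A F p" for p y
    using polar_factor_chart_at[OF that] a0[OF that chart_at_in] by (metis ln_exp minus_minus)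
  from S_curvature_eq_0[OF fc this] show "constant_S_curvature A F \<sigma>"
    unfolding constant_S_curvature_def by blast
  have "ricci A F p y = - 3 * a2" if y: "y \<in> indicatrix A F p" for p y
  proof -
    let ?c = "chart_at A p"
    note c = chart_at_in[of p]
    have cA: "?c \<in> A" "cmap ?c p \<in> cimg ?c" using c chart(6) by (auto simp: charts_at_iff)
    have nz: "y ?c \<noteq> 0" by (rule indicatrix_tangent_iff(2)[OF y c])
    have "flow_deriv ?c (dlog\<sigma> ?c) (cmap ?c p) (y ?c) = (\<Sum>i\<in>UNIV. flow_deriv ?c (pdy i (Gl ?c i)) (cmap ?c p) (y ?c))"
      unfolding flow_deriv_trN(1)[OF cA nz, symmetric] by (rule flow_deriv_dlog\<sigma>[OF _ cA nz]) (rule a1)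
    then show ?thesis using a2[OF y c] unfolding ricci_formula second_coeff_def Let_def by linarith
  qed
  then show "constant_ricci_curvature A F" unfolding constant_ricci_curvature_def by blast
qed

end

theorem theorem4p29:
  fixes A :: "('m::{t2_space, second_countable_topology}, 'n::finite) chart set"
    and F :: "'m \<Rightarrow> ('m, 'n) tvec \<Rightarrow> real"
    and \<mu> :: "'m measure"
    and \<sigma> :: "('m, 'n) chart \<Rightarrow> real^'n \<Rightarrow> real"
  assumes "CARD('n) > 1"
    and "smooth_atlas A"
    and "connected (UNIV :: 'm set)"
    and "orientable A"
    and "finsler_structure A F"
    and "forward_complete A F"
    and "volume_measure A \<mu> \<sigma>"
    and "infinitesimal_harmonic A F \<sigma>"
  shows "einstein A F \<and> constant_S_curvature A F \<sigma> \<and> constant_ricci_curvature A F"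
proof -
  interpret finsler_measure A F \<mu> \<sigma>
    by unfold_locales (use assms in auto)
  have "constant_ricci_curvature A F" "constant_S_curvature A F \<sigma>"
    by (rule infinitesimal_harmonic_curvatures; fact assms)+
  moreover from this(1) have "einstein A F"
    unfolding constant_ricci_curvature_def einstein_def by (elim exE) (rule exI)
  ultimately show ?thesis by blast
qed

end
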